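(* Let $V$ be a vector space of finite dimension $N>1$ over a field $\mathbb{F}$ and let $n,d_0,d$ be non-negative integers with $n>1$ and $2n+d_0+d=N$. Let $\eta$ be a Hermitian, alternating or quadratic form defined over $V$ with reduced Witt index $n$, anisotropic defect $d_0$ and singular defect $d$ (provided that such a form exists). For $1\le k\le n$ let $\mathcal{P}_k$ be the polar $k$-Grassmannian associated to $\eta$ and $\varepsilon_k$ its Grassmann embedding. Then: 1. If $\eta$ is Hermitian, then $\dim(\varepsilon_k)=\binom{N}{k}$, namely $\varepsilon_k(\mathcal{P}_k)$ spans $\mathrm{PG}(\bigwedge^kV)$. 2. If $\eta$ is alternating, then $\dim(\varepsilon_k)=\binom{N}{k}-\binom{N}{k-2}$. 3. Suppose $\eta$ is a quadratic form. Then $\dim(\varepsilon_k)=\binom{N}{k}$ if $\mathrm{char}(\mathbb{F})\neq 2$ and $\dim(\varepsilon_k)=\binom{N}{k}-\binom{N}{k-2}$ if $\mathrm{char}(\mathbb{F})=2$. In other words, if either $\mathrm{char}(\mathbb{F})\neq 2$ or $k=1$ then $\varepsilon_k(\mathcal{P}_k)$ spans $\mathrm{PG}(\bigwedge^kV)$; otherwise $\langle\varepsilon_k(\mathcal{P}_k)\rangle$ coincides with the span of the image of the Grassmann embedding of the symplectic $k$-Grassmannian associated with the bilinearization of $\eta$, i.e. with the span of all points $\langle v_1\wedge\dots\wedge v_k\rangle$ where $\langle v_1,\dots,v_k\rangle$ is a $k$-dimensional subspace of $V$ totally singular for the bilinearization of $\eta$.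
   Context: A Hermitian form is a form $h:V\times V\to\mathbb{F}$, sesquilinear with respect to an automorphism $\sigma$ of $\mathbb{F}$ of order $2$, with $h(y,x)=h(x,y)^\sigma$. An alternating form is a bilinear form $s$ with $s(x,x)=0$ for all $x$. For a quadratic form $q$, its bilinearization is $f_q(x,y)=q(x+y)-q(x)-q(y)$. A vector $v$ is singular if $\eta(v,v)=0$ (Hermitian or alternating case) or $\eta(v)=0$ (quadratic case); a subspace $X$ is totally singular if $\eta$ vanishes on $X\times X$ (Hermitian or alternating case) or on $X$ (quadratic case). Orthogonality $\perp$ is with respect to $\eta$, or its bilinearization if $\eta$ is quadratic. The radical $\mathrm{Rad}(\eta)$ is $V^\perp$ in the Hermitian or alternating case and the set of singular vectors of $V^\perp$ in the quadratic case; $\eta$ is non-degenerate if $\mathrm{Rad}(\eta)=0$. The singular defect of $\eta$ is $d=\dim\mathrm{Rad}(\eta)$; the reduced Witt index $n$ is the Witt index (maximal dimension of a totally singular subspace) of the non-degenerate form induced by $\eta$ on $V/\mathrm{Rad}(\eta)$. There is a decomposition $V=V_1\oplus\dots\oplus V_n\oplus V_0\oplus\mathrm{Rad}(\eta)$ with $V_1,\dots,V_n$ mutually orthogonal hyperbolic $2$-spaces and $V_0$ a totally anisotropic subspace (no non-zero singular vectors) orthogonal to each $V_i$; the anisotropic defect is $d_0=\dim(V_0)=N-2n-d$. The points of the polar $k$-Grassmannian $\mathcal{P}_k$ are the totally singular $k$-dimensional subspaces of $V$ (only the points matter here); it is called symplectic when the form is alternating. The Grassmann embedding $\varepsilon_k$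 maps a point $\langle v_1,\dots,v_k\rangle$ of $\mathcal{P}_k$ to the point $\langle v_1\wedge\dots\wedge v_k\rangle$ of $\mathrm{PG}(\bigwedge^kV)$; $\langle\varepsilon_k(\mathcal{P}_k)\rangle$ is the span of its image, and $\dim(\varepsilon_k)$ is the vector dimension of the subspace of $\bigwedge^kV$ corresponding to that span. Convention: $\binom{N}{-1}=0$. *)

theory Defs
  imports Complex_Main "HOL-Library.Function_Algebras" "HOL-Library.Multiset"
begin

section \<open>Hermitian, alternating and quadratic forms\<close>

text \<open>\<open>Hermitian \<sigma> h\<close> carries the field automorphism of the form.\<close>

datatype ('f, 'v) form =
    Hermitian "'f \<Rightarrow> 'f" "'v \<Rightarrow> 'v \<Rightarrow> 'f"
  | Alternating "'v \<Rightarrow> 'v \<Rightarrow> 'f"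
  | Quadratic "'v \<Rightarrow> 'f"

definition order_2_automorphism :: "('f::field \<Rightarrow> 'f) \<Rightarrow> bool" where
  "order_2_automorphism \<sigma> \<longleftrightarrow>
     bij \<sigma> \<and> \<sigma> 1 = 1 \<and> (\<forall>a b. \<sigma> (a + b) = \<sigma> a + \<sigma> b) \<and> (\<forall>a b. \<sigma> (a * b) = \<sigma> a * \<sigma> b) \<and>
     \<sigma> \<circ> \<sigma> = id \<and> \<sigma> \<noteq> id"

definition bilinearization :: "('v::ab_group_add \<Rightarrow> 'f::field) \<Rightarrow> 'v \<Rightarrow> 'v \<Rightarrow> 'f" where
  "bilinearization q x y = q (x + y) - q x - q y"

primrec singular :: "('f::field, 'v::ab_group_add) form \<Rightarrow> 'v \<Rightarrow> bool" where
  "singular (Hermitian \<sigma> h) v \<longleftrightarrow> h v v = 0"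
| "singular (Alternating s) v \<longleftrightarrow> s v v = 0"
| "singular (Quadratic q) v \<longleftrightarrow> q v = 0"

primrec totally_singular :: "('f::field, 'v::ab_group_add) form \<Rightarrow> 'v set \<Rightarrow> bool" where
  "totally_singular (Hermitian \<sigma> h) X \<longleftrightarrow> (\<forall>x\<in>X. \<forall>y\<in>X. h x y = 0)"
| "totally_singular (Alternating s) X \<longleftrightarrow> (\<forall>x\<in>X. \<forall>y\<in>X. s x y = 0)"
| "totally_singular (Quadratic q) X \<longleftrightarrow> (\<forall>x\<in>X. q x = 0)"

primrec orth :: "('f::field, 'v::ab_group_add) form \<Rightarrow> 'v \<Rightarrow> 'v \<Rightarrow> bool" where
  "orth (Hermitian \<sigma> h) x y \<longleftrightarrow> h x y = 0"
| "orth (Alternating s) x y \<longleftrightarrow> s x y = 0"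
| "orth (Quadratic q) x y \<longleftrightarrow> bilinearization q x y = 0"

definition perp :: "('f::field, 'v::ab_group_add) form \<Rightarrow> 'v set \<Rightarrow> 'v set" where
  "perp \<eta> X = {v. \<forall>x\<in>X. orth \<eta> v x}"

text \<open>In the Hermitian and alternating case every vector of \<open>perp \<eta> UNIV\<close> is singular, so the
  intersection with the singular vectors only matters for quadratic forms.\<close>

definition radical :: "('f::field, 'v::ab_group_add) form \<Rightarrow> 'v set" where
  "radical \<eta> = {v \<in> perp \<eta> UNIV. singular \<eta> v}"

lemma radical_simps:
  "radical (Hermitian \<sigma> h) = perp (Hermitian \<sigma> h) UNIV"
  "radical (Alternating s) = perp (Alternating s) UNIV"
  "radical (Quadratic q) = {v \<in> perp (Quadratic q) UNIV. q v = 0}"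
  by (auto simp: radical_def perp_def)

primrec pullback :: "('w \<Rightarrow> 'v) \<Rightarrow> ('f, 'v) form \<Rightarrow> ('f, 'w) form" where
  "pullback \<pi> (Hermitian \<sigma> h) = Hermitian \<sigma> (\<lambda>x y. h (\<pi> x) (\<pi> y))"
| "pullback \<pi> (Alternating s) = Alternating (\<lambda>x y. s (\<pi> x) (\<pi> y))"
| "pullback \<pi> (Quadratic q) = Quadratic (\<lambda>x. q (\<pi> x))"

definition bilinear_form :: "('f::field \<Rightarrow> 'v::ab_group_add \<Rightarrow> 'v) \<Rightarrow> ('v \<Rightarrow> 'v \<Rightarrow> 'f) \<Rightarrow> bool" where
  "bilinear_form scale s \<longleftrightarrow>
     (\<forall>y. Vector_Spaces.linear scale (*) (\<lambda>x. s x y)) \<and> (\<forall>x. Vector_Spaces.linear scale (*) (s x))"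

text \<open>Hermitian forms are taken linear in the first and semilinear in the second argument.\<close>

definition hermitian_form :: "('f::field \<Rightarrow> 'v::ab_group_add \<Rightarrow> 'v) \<Rightarrow> ('f \<Rightarrow> 'f) \<Rightarrow> ('v \<Rightarrow> 'v \<Rightarrow> 'f) \<Rightarrow> bool" where
  "hermitian_form scale \<sigma> h \<longleftrightarrow>
     order_2_automorphism \<sigma> \<and>
     (\<forall>y. Vector_Spaces.linear scale (*) (\<lambda>x. h x y)) \<and>
     (\<forall>x y z. h x (y + z) = h x y + h x z) \<and> (\<forall>c x y. h x (scale c y) = \<sigma> c * h x y) \<and>
     (\<forall>x y. h y x = \<sigma> (h x y))"

definition alternating_form :: "('f::field \<Rightarrow> 'v::ab_group_add \<Rightarrow> 'v) \<Rightarrow> ('v \<Rightarrow> 'v \<Rightarrow> 'f) \<Rightarrow> bool" where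
  "alternating_form scale s \<longleftrightarrow> bilinear_form scale s \<and> (\<forall>x. s x x = 0)"

definition quadratic_form :: "('f::field \<Rightarrow> 'v::ab_group_add \<Rightarrow> 'v) \<Rightarrow> ('v \<Rightarrow> 'f) \<Rightarrow> bool" where
  "quadratic_form scale q \<longleftrightarrow> (\<forall>c x. q (scale c x) = c\<^sup>2 * q x) \<and> bilinear_form scale (bilinearization q)"

primrec is_form :: "('f::field \<Rightarrow> 'v::ab_group_add \<Rightarrow> 'v) \<Rightarrow> ('f, 'v) form \<Rightarrow> bool" where
  "is_form scale (Hermitian \<sigma> h) \<longleftrightarrow> hermitian_form scale \<sigma> h"
| "is_form scale (Alternating s) \<longleftrightarrow> alternating_form scale s"
| "is_form scale (Quadratic q) \<longleftrightarrow> quadratic_form scale q"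

definition witt_index :: "('f::field \<Rightarrow> 'v::ab_group_add \<Rightarrow> 'v) \<Rightarrow> ('f, 'v) form \<Rightarrow> nat" where
  "witt_index scale \<eta> = Max {vector_space.dim scale X | X.
       module.subspace scale X \<and> totally_singular \<eta> X}"

definition singular_defect :: "('f::field \<Rightarrow> 'v::ab_group_add \<Rightarrow> 'v) \<Rightarrow> ('f, 'v) form \<Rightarrow> nat" where
  "singular_defect scale \<eta> = vector_space.dim scale (radical \<eta>)"

text \<open>The Witt index of the form induced on \<open>V / Rad \<eta>\<close>. There is no type for this quotient:
  its subspaces are the \<open>X / Rad \<eta>\<close> with \<open>X\<close> a subspace containing \<open>Rad \<eta>\<close>. The lemma
  \<open>witt_index_quotient\<close> below shows that this is the \<^const>\<open>witt_index\<close> of the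
  induced form in every model of the quotient space.\<close>

definition reduced_witt_index :: "('f::field \<Rightarrow> 'v::ab_group_add \<Rightarrow> 'v) \<Rightarrow> ('f, 'v) form \<Rightarrow> nat" where
  "reduced_witt_index scale \<eta> =
     Max {vector_space.dim scale X - vector_space.dim scale (radical \<eta>) | X.
       module.subspace scale X \<and> radical \<eta> \<subseteq> X \<and> totally_singular \<eta> X}"

text \<open>The dimension of the anisotropic summand \<open>V\<^sub>0\<close> in a decomposition of \<open>V\<close> into \<open>n\<close> mutually
  orthogonal hyperbolic 2-spaces, \<open>V\<^sub>0\<close> and \<open>Rad \<eta>\<close>, that is, \<open>N - 2n - d\<close>.\<close>

definition anisotropic_defect :: "('f::field \<Rightarrow> 'v::ab_group_add \<Rightarrow> 'v) \<Rightarrow> ('f, 'v) form \<Rightarrow> nat" where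
  "anisotropic_defect scale \<eta> =
     vector_space.dim scale UNIV - 2 * reduced_witt_index scale \<eta> - singular_defect scale \<eta>"

lemma totally_singular_pullback: "totally_singular (pullback \<pi> \<eta>) X \<longleftrightarrow> totally_singular \<eta> (\<pi> ` X)"
  by (cases \<eta>) auto

lemma dim_vimage:
  fixes s1 :: "'f::field \<Rightarrow> 'v::ab_group_add \<Rightarrow> 'v" and s2 :: "'f \<Rightarrow> 'w::ab_group_add \<Rightarrow> 'w"
  assumes lin: "Vector_Spaces.linear s1 s2 \<pi>" and "surj \<pi>"
    and fin: "finite B0" "module.span s1 B0 = UNIV"
    and Y: "module.subspace s2 Y"
  shows "vector_space.dim s1 (\<pi> -` Y) = vector_space.dim s2 Y + vector_space.dim s1 {x. \<pi> x = 0}"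
proof -
  interpret lin: Vector_Spaces.linear s1 s2 \<pi> by fact
  interpret p: vector_space_pair s1 s2 by unfold_locales
  have finI: "finite B" if "lin.vs1.independent B" for B
    using lin.vs1.independent_span_bound[OF fin(1) that] fin(2) by simp
  obtain g where g: "Vector_Spaces.linear s2 s1 g" "\<pi> \<circ> g = id"
    using p.linear_surjective_right_inverse[OF lin \<open>surj \<pi>\<close>] by blast
  interpret g: Vector_Spaces.linear s2 s1 g by fact
  have \<pi>g: "\<pi> (g y) = y" for y using g(2) by (simp add: fun_eq_iff)
  have injg: "inj g" by (metis \<pi>g injI)
  obtain C where C: "C \<subseteq> Y" "lin.vs2.independent C" "Y \<subseteq> lin.vs2.span C" "card C = lin.vs2.dim Y"
    using lin.vs2.basis_exists by blast
  define K where "K = {x. \<pi> x = 0}"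
  have K: "lin.vs1.subspace K" unfolding K_def by (rule lin.subspace_kernel)
  obtain D where D: "D \<subseteq> K" "lin.vs1.independent D" "K \<subseteq> lin.vs1.span D" "card D = lin.vs1.dim K"
    using lin.vs1.basis_exists by blast
  have indg: "lin.vs1.independent (g ` C)"
    using g.independent_inj_image C(2) injg by blast
  have finC: "finite (g ` C)" and finD: "finite D" using finI indg D(2) by auto
  have spD: "lin.vs1.span D = K" using D K lin.vs1.span_subspace by blast
  have spC: "lin.vs2.span C = Y" using C Y lin.vs2.span_subspace by blast
  have sgC: "lin.vs1.span (g ` C) = g ` Y" using g.span_image spC by simp
  have disj: "g ` Y \<inter> K \<subseteq> {0}"
    using \<pi>g g.zero by (auto simp: K_def)
  have ind: "lin.vs1.independent (E \<union> D)" if "finite E" "E \<subseteq> g ` C" for E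
    using that
  proof (induction E rule: finite_induct)
    case empty
    then show ?case using D(2) by simp
  next
    case (insert e E)
    have "e \<notin> lin.vs1.span (E \<union> D)"
    proof
      assume "e \<in> lin.vs1.span (E \<union> D)"
      then obtain x y where xy: "e = x + y" "x \<in> lin.vs1.span E" "y \<in> K"
        unfolding lin.vs1.span_Un spD by blast
      have "x \<in> g ` Y" "e \<in> g ` Y"
        using xy(2) insert.prems sgC lin.vs1.span_mono[of E "g ` C"] lin.vs1.span_superset[of "g ` C"]
        by auto
      moreover have "lin.vs1.subspace (g ` Y)" using g.subspace_image Y by blast
      ultimately have "e - x \<in> g ` Y" using lin.vs1.subspace_diff by blast
      then have "y = 0" using xy disj by auto
      then have "e \<in> lin.vs1.span E" using xy by simp
      moreover have "lin.vs1.independent (insert e E)"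
        using lin.vs1.independent_mono[OF indg] insert.prems by blast
      ultimately show False
        using insert.hyps lin.vs1.independent_insert by metis
    qed
    then show ?case
      using insert lin.vs1.independent_insertI by auto
  qed
  have "lin.vs1.span (g ` C \<union> D) = \<pi> -` Y"
  proof
    show "lin.vs1.span (g ` C \<union> D) \<subseteq> \<pi> -` Y"
      unfolding lin.vs1.span_Un spD sgC using \<pi>g by (auto simp: K_def lin.add)
    show "\<pi> -` Y \<subseteq> lin.vs1.span (g ` C \<union> D)"
    proof
      fix x assume x: "x \<in> \<pi> -` Y"
      have "x = g (\<pi> x) + (x - g (\<pi> x))" by simp
      moreover have "x - g (\<pi> x) \<in> K" by (simp add: K_def lin.diff \<pi>g)
      ultimately show "x \<in> lin.vs1.span (g ` C \<union> D)"
        unfolding lin.vs1.span_Un spD sgC using x by blast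
    qed
  qed
  then have "lin.vs1.dim (\<pi> -` Y) = card (g ` C \<union> D)"
    using lin.vs1.dim_span_eq_card_independent[OF ind[OF finC order_refl]] by simp
  also have "\<dots> = card (g ` C) + card D"
  proof (rule card_Un_disjoint[OF finC finD])
    have "g ` C \<inter> D \<subseteq> {0}" using disj C(1) D(1) by blast
    moreover have "0 \<notin> D" using D(2) lin.vs1.dependent_zero[of D] by metis
    ultimately show "g ` C \<inter> D = {}" by (metis Int_iff equals0I singletonD subsetD)
  qed
  also have "card (g ` C) = card C" using injg by (simp add: card_image inj_on_subset)
  finally show ?thesis using C(4) D(4) by (simp add: K_def)
qed

lemma witt_index_quotient:
  fixes scale :: "'f::field \<Rightarrow> 'v::ab_group_add \<Rightarrow> 'v" and scaleQ :: "'f \<Rightarrow> 'q::ab_group_add \<Rightarrow> 'q"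
  assumes fin: "finite B" "module.span scale B = UNIV"
    and \<pi>: "Vector_Spaces.linear scale scaleQ \<pi>" "surj \<pi>" "{x. \<pi> x = 0} = radical \<eta>"
    and \<eta>: "\<eta> = pullback \<pi> \<eta>'"
  shows "witt_index scaleQ \<eta>' = reduced_witt_index scale \<eta>"
proof -
  interpret lin: Vector_Spaces.linear scale scaleQ \<pi> by fact
  have dimY: "lin.vs1.dim (\<pi> -` Y) = lin.vs2.dim Y + lin.vs1.dim (radical \<eta>)"
    if "lin.vs2.subspace Y" for Y
    using dim_vimage[OF \<pi>(1,2) fin that] \<pi>(3) by simp
  have "{lin.vs2.dim Y | Y. lin.vs2.subspace Y \<and> totally_singular \<eta>' Y} =
        {lin.vs1.dim X - lin.vs1.dim (radical \<eta>) | X.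
           lin.vs1.subspace X \<and> radical \<eta> \<subseteq> X \<and> totally_singular \<eta> X}" (is "?L = ?R")
  proof
    show "?L \<subseteq> ?R"
    proof
      fix m assume "m \<in> ?L"
      then obtain Y where Y: "m = lin.vs2.dim Y" "lin.vs2.subspace Y" "totally_singular \<eta>' Y"
        by blast
      have "lin.vs1.subspace (\<pi> -` Y)" using lin.subspace_vimage Y(2) by blast
      moreover have "radical \<eta> \<subseteq> \<pi> -` Y"
        unfolding \<pi>(3)[symmetric] using lin.vs2.subspace_0[OF Y(2)] by auto
      moreover have "totally_singular \<eta> (\<pi> -` Y)"
        using Y(3) \<pi>(2) by (simp add: \<eta> totally_singular_pullback surj_image_vimage_eq)
      moreover have "m = lin.vs1.dim (\<pi> -` Y) - lin.vs1.dim (radical \<eta>)"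
        using dimY[OF Y(2)] Y(1) by simp
      ultimately show "m \<in> ?R" by blast
    qed
    show "?R \<subseteq> ?L"
    proof
      fix m assume "m \<in> ?R"
      then obtain X where X: "m = lin.vs1.dim X - lin.vs1.dim (radical \<eta>)" "lin.vs1.subspace X"
          "radical \<eta> \<subseteq> X" "totally_singular \<eta> X"
        by blast
      have sub: "lin.vs2.subspace (\<pi> ` X)" using lin.subspace_image X(2) by blast
      have "\<pi> -` (\<pi> ` X) \<subseteq> X"
      proof
        fix x assume "x \<in> \<pi> -` (\<pi> ` X)"
        then obtain y where y: "y \<in> X" "\<pi> x = \<pi> y" by auto
        then have "x - y \<in> {x. \<pi> x = 0}" by (simp add: lin.diff)
        then have "x - y \<in> radical \<eta>" unfolding \<pi>(3) .
        then have "(x - y) + y \<in> X" using y X(2,3) lin.vs1.subspace_add by blast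
        then show "x \<in> X" by simp
      qed
      then have "\<pi> -` (\<pi> ` X) = X" by blast
      then have "m = lin.vs2.dim (\<pi> ` X)" using dimY[OF sub] X(1) by simp
      moreover have "totally_singular \<eta>' (\<pi> ` X)"
        using X(4) by (simp add: \<eta> totally_singular_pullback)
      ultimately show "m \<in> ?L" using sub by blast
    qed
  qed
  then show ?thesis
    unfolding witt_index_def reduced_witt_index_def by simp
qed

section \<open>Exterior powers\<close>

definition alternating_map ::
  "('f::field \<Rightarrow> 'v::ab_group_add \<Rightarrow> 'v) \<Rightarrow> ('f \<Rightarrow> 'w::ab_group_add \<Rightarrow> 'w) \<Rightarrow> nat \<Rightarrow> ('v list \<Rightarrow> 'w) \<Rightarrow> bool"
  where
  "alternating_map s1 s2 k f \<longleftrightarrow>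
     (\<forall>us x y vs. Suc (length us + length vs) = k \<longrightarrow>
        f (us @ (x + y) # vs) = f (us @ x # vs) + f (us @ y # vs)) \<and>
     (\<forall>us c x vs. Suc (length us + length vs) = k \<longrightarrow>
        f (us @ s1 c x # vs) = s2 c (f (us @ x # vs))) \<and>
     (\<forall>vs. length vs = k \<and> \<not> distinct vs \<longrightarrow> f vs = 0)"

text \<open>\<open>v\<^sub>1 \<and> \<dots> \<and> v\<^sub>k\<close> is realized as the evaluation functional \<open>A \<mapsto> A (v\<^sub>1, \<dots>, v\<^sub>k)\<close> on
  alternating \<open>k\<close>-linear forms, and \<open>\<Lambda>\<^sup>k V\<close> as the span of these functionals. By
  \<open>ext_power_universal\<close> below this is the exterior power: \<open>v\<^sub>1 \<and> \<dots> \<and> v\<^sub>k\<close> is the universal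
  alternating \<open>k\<close>-linear map on \<open>V\<close>.\<close>

definition ext_scale :: "'f::field \<Rightarrow> (('v list \<Rightarrow> 'f) \<Rightarrow> 'f) \<Rightarrow> (('v list \<Rightarrow> 'f) \<Rightarrow> 'f)" where
  "ext_scale c u = (\<lambda>A. c * u A)"

global_interpretation ext: vector_space ext_scale
  by unfold_locales (auto simp: ext_scale_def fun_eq_iff algebra_simps)

definition wedge :: "('f::field \<Rightarrow> 'v::ab_group_add \<Rightarrow> 'v) \<Rightarrow> 'v list \<Rightarrow> (('v list \<Rightarrow> 'f) \<Rightarrow> 'f)" where
  "wedge scale vs = (\<lambda>A. if alternating_map scale (*) (length vs) A then A vs else 0)"

definition ext_power :: "('f::field \<Rightarrow> 'v::ab_group_add \<Rightarrow> 'v) \<Rightarrow> nat \<Rightarrow> (('v list \<Rightarrow> 'f) \<Rightarrow> 'f) set" where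
  "ext_power scale k = ext.span {wedge scale vs | vs. length vs = k}"

lemma alternating_map_wedge: "alternating_map scale ext_scale k (wedge (scale :: 'f::field \<Rightarrow> 'v::ab_group_add \<Rightarrow> 'v))"
  unfolding alternating_map_def
proof (intro conjI allI impI ext)
  fix us and x y :: 'v and vs and A :: "'v list \<Rightarrow> 'f"
  show "wedge scale (us @ (x + y) # vs) A = (wedge scale (us @ x # vs) + wedge scale (us @ y # vs)) A"
    by (cases "alternating_map scale (*) (Suc (length us + length vs)) A")
      (simp_all add: wedge_def, simp add: alternating_map_def)
next
  fix us c and x :: 'v and vs and A :: "'v list \<Rightarrow> 'f"
  show "wedge scale (us @ scale c x # vs) A = ext_scale c (wedge scale (us @ x # vs)) A"
    by (cases "alternating_map scale (*) (Suc (length us + length vs)) A")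
      (simp_all add: wedge_def ext_scale_def, simp add: alternating_map_def)
next
  fix vs :: "'v list" and A :: "'v list \<Rightarrow> 'f"
  assume "length vs = k \<and> \<not> distinct vs"
  then show "wedge scale vs A = 0 A"
    by (cases "alternating_map scale (*) (length vs) A") (simp_all add: wedge_def, simp add: alternating_map_def)
qed

context
  fixes scale :: "'f::field \<Rightarrow> 'v::ab_group_add \<Rightarrow> 'v"
  assumes vector_space: "vector_space scale"
begin

interpretation vector_space scale by (fact vector_space)

lemma ext_power_universal:
  assumes "vector_space scaleW" and f: "alternating_map scale scaleW k f"
  shows "\<exists>g. Vector_Spaces.linear ext_scale scaleW g \<and> (\<forall>vs. length vs = k \<longrightarrow> g (wedge scale vs) = f vs)"
proof -
  interpret W: vector_space scaleW by fact
  interpret F: vector_space "(*) :: 'f \<Rightarrow> 'f \<Rightarrow> 'f" by unfold_locales (auto simp: algebra_simps)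
  interpret EW: vector_space_pair "ext_scale :: 'f \<Rightarrow> (('v list \<Rightarrow> 'f) \<Rightarrow> 'f) \<Rightarrow> _" scaleW by unfold_locales
  interpret EF: vector_space_pair "ext_scale :: 'f \<Rightarrow> (('v list \<Rightarrow> 'f) \<Rightarrow> 'f) \<Rightarrow> _" "(*) :: 'f \<Rightarrow> 'f \<Rightarrow> 'f" by unfold_locales
  interpret WF: vector_space_pair scaleW "(*) :: 'f \<Rightarrow> 'f \<Rightarrow> 'f" by unfold_locales
  define S where "S = {wedge scale vs | vs. length vs = k}"
  obtain B where B: "B \<subseteq> S" "ext.independent B" "S \<subseteq> ext.span B"
    using ext.maximal_independent_subset by blast
  have "\<forall>b\<in>B. \<exists>vs. length vs = k \<and> b = wedge scale vs" using B(1) unfolding S_def by blast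
  then obtain sel where sel: "\<And>b. b \<in> B \<Longrightarrow> length (sel b) = k \<and> b = wedge scale (sel b)" by metis
  obtain g where g: "Vector_Spaces.linear ext_scale scaleW g" "\<And>b. b \<in> B \<Longrightarrow> g b = f (sel b)"
    using EW.linear_independent_extend[OF B(2), of "\<lambda>b. f (sel b)"] by blast
  have "g (wedge scale vs) = f vs" if vs: "length vs = k" for vs
  proof (rule ccontr)
    define w where "w = g (wedge scale vs) - f vs"
    assume "g (wedge scale vs) \<noteq> f vs"
    then have "w \<noteq> 0" by (simp add: w_def)
    then have "W.independent {w}" by simp
    then obtain \<phi> where \<phi>: "Vector_Spaces.linear scaleW (*) \<phi>" "\<phi> w = 1"
      using WF.linear_independent_extend[of "{w}" "\<lambda>_. 1"] by blast
    interpret \<phi>: Vector_Spaces.linear scaleW "(*)" \<phi> by fact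
    define A where "A = (\<lambda>vs. \<phi> (f vs))"
    have A: "alternating_map scale (*) k A"
      using f unfolding alternating_map_def A_def by (simp add: \<phi>.add \<phi>.scale)
    have l1: "Vector_Spaces.linear ext_scale (*) (\<phi> \<circ> g)"
      using g(1) \<phi>(1) Vector_Spaces.linear_compose by blast
    have l2: "Vector_Spaces.linear ext_scale (*) (\<lambda>u. u A)"
      unfolding Vector_Spaces.linear_iff
      by (simp add: ext.vector_space_axioms F.vector_space_axioms ext_scale_def)
    have "(\<phi> \<circ> g) b = b A" if "b \<in> B" for b
    proof -
      have "b A = A (sel b)" using sel[OF that] A unfolding wedge_def by metis
      then show ?thesis using g(2)[OF that] by (simp add: A_def)
    qed
    moreover have "wedge scale vs \<in> ext.span B" using B(3) vs unfolding S_def by blast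
    ultimately have "(\<phi> \<circ> g) (wedge scale vs) = wedge scale vs A"
      using EF.linear_eq_on[OF l1 l2] by blast
    also have "\<dots> = \<phi> (f vs)" using A vs by (simp add: wedge_def A_def)
    finally have "\<phi> w = 0" by (simp add: w_def \<phi>.diff)
    then show False using \<phi>(2) by simp
  qed
  then show ?thesis using g(1) by blast
qed

end

lemma ext_power_universal_unique:
  fixes scale :: "'f::field \<Rightarrow> 'v::ab_group_add \<Rightarrow> 'v" and scaleW :: "'f \<Rightarrow> 'w::ab_group_add \<Rightarrow> 'w" and u :: "('v list \<Rightarrow> 'f) \<Rightarrow> 'f"
  assumes "Vector_Spaces.linear ext_scale scaleW g" "Vector_Spaces.linear ext_scale scaleW g'"
    and "\<And>vs. length vs = k \<Longrightarrow> g (wedge scale vs) = g' (wedge scale vs)"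
    and "u \<in> ext_power scale k"
  shows "g u = g' u"
proof -
  interpret g: Vector_Spaces.linear ext_scale scaleW g by fact
  interpret EW: vector_space_pair "ext_scale :: 'f \<Rightarrow> (('v list \<Rightarrow> 'f) \<Rightarrow> 'f) \<Rightarrow> _" scaleW by unfold_locales
  show ?thesis
    using EW.linear_eq_on[OF assms(1,2), of u "{wedge scale vs | vs. length vs = k}"] assms(3,4)
    unfolding ext_power_def by blast
qed

lemma wedge_add: "wedge scale (us @ (x + y) # vs) = wedge scale (us @ x # vs) + wedge scale (us @ y # vs)"
  using alternating_map_wedge[where scale = scale and k = "Suc (length us + length vs)"] by (auto simp: alternating_map_def)

lemma wedge_scale: "wedge scale (us @ scale c x # vs) = ext_scale c (wedge scale (us @ x # vs))"
  using alternating_map_wedge[where scale = scale and k = "Suc (length us + length vs)"] by (auto simp: alternating_map_def)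

lemma wedge_not_distinct: "\<not> distinct vs \<Longrightarrow> wedge scale vs = 0"
  using alternating_map_wedge[where scale = scale and k = "length vs"] by (auto simp: alternating_map_def)

lemma wedge_swap: "wedge scale (us @ x # y # vs) = - wedge scale (us @ y # x # vs)"
proof -
  have split: "wedge scale (us @ a # (b + c) # vs) = wedge scale (us @ a # b # vs) + wedge scale (us @ a # c # vs)" for a b c
    using wedge_add[of scale "us @ [a]" b c vs] by simp
  have "0 = wedge scale (us @ (x + y) # (x + y) # vs)" by (simp add: wedge_not_distinct)
  also have "\<dots> = wedge scale (us @ x # y # vs) + wedge scale (us @ y # x # vs)"
    by (simp add: wedge_add split wedge_not_distinct)
  finally show ?thesis by (simp add: eq_neg_iff_add_eq_0)
qed

lemma wedge_move: "wedge scale (us @ x # as @ bs) \<in> ext.span {wedge scale (us @ as @ x # bs)}"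
proof (induction as arbitrary: us)
  case Nil
  then show ?case by (simp add: ext.span_base)
next
  case (Cons a as)
  then have "wedge scale ((us @ [a]) @ x # as @ bs) \<in> ext.span {wedge scale ((us @ [a]) @ as @ x # bs)}" .
  then have "- wedge scale (us @ a # x # as @ bs) \<in> ext.span {wedge scale (us @ a # as @ x # bs)}"
    using ext.span_neg by simp
  then have "wedge scale (us @ x # a # as @ bs) \<in> ext.span {wedge scale (us @ a # as @ x # bs)}"
    by (subst wedge_swap)
  then show ?case by simp
qed

lemma wedge_perm: "mset xs = mset ys \<Longrightarrow> wedge scale (us @ xs) \<in> ext.span {wedge scale (us @ ys)}"
proof (induction xs arbitrary: us ys)
  case Nil
  then show ?case by (simp add: ext.span_base)
next
  case (Cons x xs)
  then have "x \<in> set ys" by (metis list.set_intros(1) mset_eq_setD)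
  then obtain as bs where ys: "ys = as @ x # bs" by (meson split_list)
  then have "mset xs = mset (as @ bs)" using Cons.prems by simp
  then have "wedge scale ((us @ [x]) @ xs) \<in> ext.span {wedge scale ((us @ [x]) @ as @ bs)}" by (rule Cons.IH)
  moreover have "ext.span {wedge scale (us @ x # as @ bs)} \<subseteq> ext.span {wedge scale (us @ as @ x # bs)}"
    by (rule ext.span_minimal[OF _ ext.subspace_span]) (use wedge_move[of scale us x as bs] in blast)
  ultimately show ?case using ys by auto
qed

context
  fixes scale :: "'f::field \<Rightarrow> 'v::ab_group_add \<Rightarrow> 'v"
  assumes vector_space: "vector_space scale"
begin

interpretation vector_space scale by (fact vector_space)

lemma wedge_expand:
  "set ws \<subseteq> span S \<Longrightarrow>
   wedge scale (us @ ws) \<in> ext.span {wedge scale (us @ xs) | xs. length xs = length ws \<and> set xs \<subseteq> S}"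
proof (induction ws arbitrary: us)
  case Nil
  then show ?case by (auto intro: ext.span_base)
next
  case (Cons w ws)
  let ?T = "ext.span {wedge scale (us @ xs) | xs. length xs = length (w # ws) \<and> set xs \<subseteq> S}"
  have "w \<in> span S" using Cons.prems by simp
  then have "wedge scale (us @ w # ws) \<in> ?T"
  proof (induction rule: span_induct_alt)
    case base
    have "wedge scale (us @ 0 # ws) = 0" using wedge_scale[of scale us 0 0 ws] by simp
    show ?case unfolding \<open>wedge scale (us @ 0 # ws) = 0\<close> by (rule ext.span_zero)
  next
    case (step c x y)
    have "wedge scale ((us @ [x]) @ ws) \<in>
        ext.span {wedge scale ((us @ [x]) @ xs) | xs. length xs = length ws \<and> set xs \<subseteq> S}"
      using Cons.prems by (intro Cons.IH) auto
    moreover have "{wedge scale ((us @ [x]) @ xs) | xs. length xs = length ws \<and> set xs \<subseteq> S} \<subseteq>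
        {wedge scale (us @ xs) | xs. length xs = length (w # ws) \<and> set xs \<subseteq> S}"
    proof safe
      fix xs assume "length xs = length ws" "set xs \<subseteq> S"
      then show "\<exists>ys. wedge scale ((us @ [x]) @ xs) = wedge scale (us @ ys) \<and> length ys = length (w # ws) \<and> set ys \<subseteq> S"
        using step(1) by (intro exI[of _ "x # xs"]) auto
    qed
    ultimately have "wedge scale ((us @ [x]) @ ws) \<in> ?T" using ext.span_mono by blast
    then have "wedge scale (us @ x # ws) \<in> ?T" by simp
    then show ?case
      using step(2)
      unfolding wedge_add wedge_scale length_Cons by (intro ext.span_add ext.span_scale)
  qed
  then show ?case .
qed

lemma wedge_basis:
  assumes "set ws \<subseteq> span (set vs)" "length ws = length vs" "distinct vs"
  shows "wedge scale ws \<in> ext.span {wedge scale vs}"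
proof -
  have "{wedge scale xs | xs. length xs = length ws \<and> set xs \<subseteq> set vs} \<subseteq> ext.span {wedge scale vs}"
  proof safe
    fix xs assume xs: "length xs = length ws" "set xs \<subseteq> set vs"
    show "wedge scale xs \<in> ext.span {wedge scale vs}"
    proof (cases "distinct xs")
      case True
      then have "card (set xs) = card (set vs)" using xs assms by (simp add: distinct_card)
      then have "set xs = set vs" using xs(2) by (simp add: card_subset_eq)
      then have "mset xs = mset vs" using True assms(3) set_eq_iff_mset_eq_distinct by blast
      then show ?thesis using wedge_perm[of xs vs scale "[]"] by simp
    qed (simp add: wedge_not_distinct ext.span_zero)
  qed
  then have "ext.span {wedge scale xs | xs. length xs = length ws \<and> set xs \<subseteq> set vs} \<subseteq> ext.span {wedge scale vs}"
    by (intro ext.span_minimal) auto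
  then show ?thesis using wedge_expand[OF assms(1), of "[]"] by auto
qed

end

section \<open>Polar Grassmannians and the Grassmann embedding\<close>

definition polar_grassmannian :: "('f::field \<Rightarrow> 'v::ab_group_add \<Rightarrow> 'v) \<Rightarrow> ('f, 'v) form \<Rightarrow> nat \<Rightarrow> 'v set set" where
  "polar_grassmannian scale \<eta> k = {X. module.subspace scale X \<and> totally_singular \<eta> X \<and> vector_space.dim scale X = k}"

definition is_basis_list :: "('f::field \<Rightarrow> 'v::ab_group_add \<Rightarrow> 'v) \<Rightarrow> 'v list \<Rightarrow> 'v set \<Rightarrow> bool" where
  "is_basis_list scale vs X \<longleftrightarrow> distinct vs \<and> \<not> module.dependent scale (set vs) \<and> module.span scale (set vs) = X"

text \<open>A point of the projective space of \<open>\<Lambda>\<^sup>k V\<close> is a 1-dimensional subspace. The wedge products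
  of all bases of \<open>X\<close> span the same one, see \<open>grassmann_embedding_basis\<close>.\<close>

definition grassmann_embedding :: "('f::field \<Rightarrow> 'v::ab_group_add \<Rightarrow> 'v) \<Rightarrow> nat \<Rightarrow> 'v set \<Rightarrow> (('v list \<Rightarrow> 'f) \<Rightarrow> 'f) set" where
  "grassmann_embedding scale k X = ext.span {wedge scale vs | vs. length vs = k \<and> is_basis_list scale vs X}"

definition grassmann_span :: "('f::field \<Rightarrow> 'v::ab_group_add \<Rightarrow> 'v) \<Rightarrow> ('f, 'v) form \<Rightarrow> nat \<Rightarrow> (('v list \<Rightarrow> 'f) \<Rightarrow> 'f) set" where
  "grassmann_span scale \<eta> k = ext.span (\<Union>X\<in>polar_grassmannian scale \<eta> k. grassmann_embedding scale k X)"

definition grassmann_dim :: "('f::field \<Rightarrow> 'v::ab_group_add \<Rightarrow> 'v) \<Rightarrow> ('f, 'v) form \<Rightarrow> nat \<Rightarrow> nat" where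
  "grassmann_dim scale \<eta> k = ext.dim (grassmann_span scale \<eta> k)"

lemma grassmann_embedding_basis:
  assumes "vector_space scale" and basis: "is_basis_list scale vs X" and len: "length vs = k"
  shows "grassmann_embedding scale k X = ext.span {wedge scale vs}"
proof
  interpret V: vector_space scale by fact
  show "ext.span {wedge scale vs} \<subseteq> grassmann_embedding scale k X"
    unfolding grassmann_embedding_def using basis len by (intro ext.span_mono) auto
  show "grassmann_embedding scale k X \<subseteq> ext.span {wedge scale vs}"
    unfolding grassmann_embedding_def
  proof (intro ext.span_minimal ext.subspace_span, safe)
    fix ws assume ws: "k = length ws" "is_basis_list scale ws X"
    then have "set ws \<subseteq> module.span scale (set vs)"
      using basis V.span_superset unfolding is_basis_list_def by blast
    then show "wedge scale ws \<in> ext.span {wedge scale vs}"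
      using assms(1) basis len ws by (intro wedge_basis) (auto simp: is_basis_list_def)
  qed
qed

text \<open>Binomial coefficients with \<open>(N choose j) = 0\<close> for negative \<open>j\<close>.\<close>

definition int_binomial :: "nat \<Rightarrow> int \<Rightarrow> int" where
  "int_binomial N j = (if j < 0 then 0 else int (N choose nat j))"

end

theory Submission
  imports Defs
begin

text \<open>
  \<open>V\<close> has a basis of mutually orthogonal hyperbolic pairs and single vectors, at least \<open>n \<ge> k\<close> of the
  pairs \<open>(e, f)\<close> being singular. A non-singular vector \<open>v\<close> orthogonal to a singular pair \<open>(e, f)\<close>
  can be traded for the singular vectors \<open>v + e + c f\<close>, \<open>e\<close>, \<open>f\<close>. If \<open>(a, b)\<close> and \<open>(e, f)\<close> are orthogonal
  hyperbolic pairs of a form with \<open>B y x = \<epsilon> \<sigma>(B x y)\<close>, then \<open>(a + x e) \<and> (f - \<sigma>(x) b)\<close> and \<open>(a + f) \<and> (e - \<epsilon> b)\<close> put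
  \<open>x (e \<and> f) - \<sigma>(x) (a \<and> b)\<close> and \<open>e \<and> f + \<epsilon> (a \<and> b)\<close> into the span, up to terms with fewer hyperbolic
  pairs. Unless \<open>\<sigma> = id\<close> and \<open>\<epsilon> = -1\<close>, this puts \<open>a \<and> b\<close> itself into the span, and
  as there are enough singular pairs, all basis monomials follow.

  In the remaining symplectic case only the differences \<open>a \<and> b - e \<and> f\<close> are in the span. A set of
  \<open>N choose (k - 2)\<close> basis monomials, defined by recursion on the hyperbolic pairs, spans a
  complement: together with products of such differences these monomials generate the exterior power, while forms divisible by
  a divided power of the symplectic 2-form vanish on isotropic lists and take arbitrary values on
  these monomials. Divided powers make this work in every characteristic.
\<close>

section \<open>Lists of basis vectors\<close>

text \<open>Multiplication by the symplectic 2-form \<omega> does not give enough forms in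
  characteristic p: it can have a kernel, as \<omega> \<and> \<omega>^(p-1) = p \<omega>^(p) = 0.

  Let \<omega> = \<omega>' + t, where t is the product of the two functionals dual to a hyperbolic
  pair (e, f). Then \<omega>^(s) = \<omega>'^(s) + t \<and> \<omega>'^(s-1), so an induction over
  the pairs cannot stay at s = 1: the index becomes s - 1, s or s + 1 on monomials containing both,
  one or neither of e and f. Pascal's rule applied twice matches the counts.

  A quadratic form in characteristic 2 can have isotropic vectors that are not singular, so the
  singular monomials could span less than the isotropic ones. The generators of the isotropic span
  are therefore shown to lie in the smaller span already; every subspace between the two then has
  the same dimension.\<close>

primrec flat :: "('a \<times> 'a) list \<Rightarrow> 'a list" where
  "flat [] = []"
| "flat (p # ps) = fst p # snd p # flat ps"

lemma flat_append [simp]: "flat (ps @ qs) = flat ps @ flat qs"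
  by (induction ps) auto

lemma length_flat [simp]: "length (flat ps) = 2 * length ps"
  by (induction ps) auto

lemma set_flat: "set (flat ps) = fst ` set ps \<union> snd ` set ps"
  by (induction ps) auto

lemma sorted_wrtI: "(\<And>x y. x \<in> set xs \<Longrightarrow> y \<in> set xs \<Longrightarrow> P x y) \<Longrightarrow> sorted_wrt P xs"
  by (induction xs) auto

lemma subseqs_Cons_set: "set (subseqs (x # xs)) = Cons x ` set (subseqs xs) \<union> set (subseqs xs)"
  by (simp add: Let_def)

lemma subseqs_subset: "d \<in> set (subseqs L) \<Longrightarrow> set d \<subseteq> set L"
  by (metis PowD image_eqI subseqs_powset)

lemma Collect_length_Cons:
  "{d \<in> Cons x ` S. length d = k} = (if k = 0 then {} else Cons x ` {d \<in> S. length d = k - 1})"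
  by (cases k) auto

lemma card_length_Cons:
  "card {d \<in> Cons x ` S. length d = k} = (if k = 0 then 0 else card {d \<in> S. length d = k - 1})"
  by (simp add: Collect_length_Cons card_image)

lemma card_subseqs_length:
  "distinct L \<Longrightarrow> card {d \<in> set (subseqs L). length d = k} = length L choose k"
proof (induction L arbitrary: k)
  case Nil
  have "{d. d = [] \<and> length d = k} = (if k = 0 then {[]} else {})" by auto
  then show ?case by (cases k) auto
next
  case (Cons x L)
  have "{d \<in> set (subseqs (x # L)). length d = k} =
      {d \<in> Cons x ` set (subseqs L). length d = k} \<union> {d \<in> set (subseqs L). length d = k}"
    unfolding subseqs_Cons_set by auto
  also have "card \<dots> = card {d \<in> Cons x ` set (subseqs L). length d = k}
      + card {d \<in> set (subseqs L). length d = k}"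
  proof (rule card_Un_disjoint)
    show "{d \<in> Cons x ` set (subseqs L). length d = k} \<inter> {d \<in> set (subseqs L). length d = k} = {}"
      using Cons.prems subseqs_subset[of _ L] by fastforce
  qed auto
  also have "\<dots> = (if k = 0 then 0 else length L choose (k - 1)) + (length L choose k)"
    using Cons unfolding card_length_Cons by simp
  finally show ?case by (cases k) simp_all
qed

text \<open>For \<open>r = 1\<close> these monomials span a complement of the span of the isotropic ones. The recursion needs
  all \<open>r\<close>: there lists with fewer than \<open>r\<close> hyperbolic pairs play the role of the isotropic ones.
  The length is not fixed.\<close>

fun complement_lists :: "'a list \<Rightarrow> ('a \<times> 'a) list \<Rightarrow> nat \<Rightarrow> 'a list set" where
  "complement_lists R ps 0 = set (subseqs (flat ps @ R))"
| "complement_lists R [] (Suc r) = {}"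
| "complement_lists R (p # ps) (Suc r) = complement_lists R ps (Suc (Suc r))
     \<union> Cons (fst p) ` complement_lists R ps (Suc r) \<union> Cons (snd p) ` complement_lists R ps (Suc r)
     \<union> Cons (fst p) ` Cons (snd p) ` complement_lists R ps r"

lemma complement_lists_subseqs: "complement_lists R ps r \<subseteq> set (subseqs (flat ps @ R))"
proof (induction R ps r rule: complement_lists.induct)
  case (3 R p ps r)
  then show ?case unfolding complement_lists.simps flat.simps append_Cons subseqs_Cons_set
    by (intro Un_least) (auto dest!: subsetD)
qed auto

lemma finite_complement_lists: "finite (complement_lists R ps r)"
  by (rule finite_subset[OF complement_lists_subseqs]) simp

lemma complement_lists_subset: "d \<in> complement_lists R ps r \<Longrightarrow> set d \<subseteq> set (flat ps @ R)"
  using complement_lists_subseqs subseqs_subset by blast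

text \<open>Pascal's rule applied twice: C(M+2, j) = C(M, j-2) + 2 C(M, j-1) + C(M, j), where j = k
  - 2r. The bound on \<open>k\<close> is passed on to all three recursive calls, and it makes the
  empty base case correct: without pairs, k \<le> r < 2r for positive r.\<close>

lemma card_complement_lists:
  assumes "distinct (flat ps @ R)" "k \<le> length ps + r"
  shows "card {d \<in> complement_lists R ps r. length d = k} =
    (if 2 * r \<le> k then length (flat ps @ R) choose (k - 2 * r) else 0)"
  using assms
proof (induction R ps r arbitrary: k rule: complement_lists.induct)
  case (1 R ps)
  then show ?case using card_subseqs_length[of "flat ps @ R"] by simp
next
  case (2 R r)
  then show ?case by auto
next
  case (3 R p ps r)
  obtain e f where p: "p = (e, f)" by fastforce
  let ?D = "complement_lists R ps" and ?N = "length (flat ps @ R)"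
  let ?l = "\<lambda>S. {d \<in> S. length d = k}"
  have notin: "e \<notin> set d" "f \<notin> set d" if "d \<in> ?D s" for d s
    using complement_lists_subset[OF that] "3.prems"(1) p by auto
  have ef: "e \<noteq> f" using "3.prems" p by auto
  have fin: "finite (?D s)" for s by (rule finite_complement_lists)
  have "card (?l (complement_lists R (p # ps) (Suc r))) = card (?l (?D (Suc (Suc r)))) + card (?l (Cons e ` ?D (Suc r)))
      + card (?l (Cons f ` ?D (Suc r))) + card (?l (Cons e ` Cons f ` ?D r))"
  proof -
    have "Cons e ` A \<inter> Cons f ` B = {}" for A B using ef by auto
    moreover have "?D s \<inter> Cons e ` A = {}" "?D s \<inter> Cons f ` A = {}" "Cons e ` ?D s \<inter> Cons e ` Cons f ` A = {}" for s A
      using notin by force+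
    moreover have "Cons f ` B \<inter> Cons e ` A = {}" for A B using ef by auto
    ultimately have 1: "?D (Suc (Suc r)) \<inter> Cons e ` ?D (Suc r) = {}"
      and 2: "(?D (Suc (Suc r)) \<union> Cons e ` ?D (Suc r)) \<inter> Cons f ` ?D (Suc r) = {}"
      and 3: "(?D (Suc (Suc r)) \<union> Cons e ` ?D (Suc r) \<union> Cons f ` ?D (Suc r)) \<inter> Cons e ` Cons f ` ?D r = {}"
      by (simp_all add: Int_Un_distrib2)
    have cU: "card (?l (A \<union> B)) = card (?l A) + card (?l B)" if "A \<inter> B = {}" "finite A" "finite B" for A B
    proof -
      have "?l (A \<union> B) = ?l A \<union> ?l B" by auto
      then show ?thesis using that by (simp add: card_Un_disjoint disjoint_iff)
    qed
    show ?thesis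
      unfolding complement_lists.simps p fst_conv snd_conv
      using cU[OF 1] cU[OF 2] cU[OF 3] fin by simp
  qed
  also have "\<dots> = card {d \<in> ?D (Suc (Suc r)). length d = k}
      + (if k = 0 then 0 else 2 * card {d \<in> ?D (Suc r). length d = k - 1})
      + (if k \<le> 1 then 0 else card {d \<in> ?D r. length d = k - 2})"
    unfolding card_length_Cons by (auto simp: numeral_2_eq_2)
  also have "\<dots> = (if 2 * Suc r \<le> k then length (flat (p # ps) @ R) choose (k - 2 * Suc r) else 0)"
  proof -
    have dist: "distinct (flat ps @ R)" using "3.prems" by simp
    have le: "k \<le> length ps + Suc (Suc r)" using "3.prems" by simp
    have c1: "card {d \<in> ?D (Suc (Suc r)). length d = k} = (if 2 * Suc (Suc r) \<le> k then ?N choose (k - 2 * Suc (Suc r)) else 0)"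
      using "3.IH"(1)[OF dist, of k] le by simp
    have c2: "card {d \<in> ?D (Suc r). length d = k - 1} = (if 2 * Suc r \<le> k - 1 then ?N choose (k - 1 - 2 * Suc r) else 0)"
      using "3.IH"(2)[OF dist, of "k - 1"] le by simp
    have c3: "card {d \<in> ?D r. length d = k - 2} = (if 2 * r \<le> k - 2 then ?N choose (k - 2 - 2 * r) else 0)"
      using "3.IH"(4)[OF dist, of "k - 2"] le by simp
    have N: "length (flat (p # ps) @ R) = Suc (Suc ?N)" by simp
    show ?thesis
    proof (cases "2 * Suc r \<le> k")
      case True
      then obtain j where k: "k = 2 * Suc r + j" using le_Suc_ex by blast
      \<comment> \<open>The summands with lower index j - 2 and j - 1 drop out when that index is
        negative, which truncated subtraction does not express.\<close>
      consider "j = 0" | "j = 1" | i where "j = Suc (Suc i)"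
        by (metis One_nat_def not0_implies_Suc)
      then show ?thesis
        unfolding c1 c2 c3 N unfolding k by cases simp_all
    next
      case False
      then show ?thesis unfolding c1 c2 c3 by auto
    qed
  qed
  finally show ?case .
qed

section \<open>Wedging with linear functionals and divided powers of a 2-form\<close>

text \<open>The exterior product \<theta> \<and> A, defined through the antiderivation rule of the
  contraction by the first vector: i_x(\<theta> \<and> A) = \<theta>(x) A - \<theta> \<and> i_x A.
  This replaces signed sums over positions by inductions on the list.\<close>

fun fwedge :: "('v \<Rightarrow> 'f::field) \<Rightarrow> ('v list \<Rightarrow> 'f) \<Rightarrow> 'v list \<Rightarrow> 'f" where
  "fwedge \<theta> A [] = 0"
| "fwedge \<theta> A (x # xs) = \<theta> x * A xs - fwedge \<theta> (\<lambda>ys. A (x # ys)) xs"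

lemma fwedge_zero_left: "(\<And>x. x \<in> set xs \<Longrightarrow> \<theta> x = 0) \<Longrightarrow> fwedge \<theta> A xs = 0"
  by (induction xs arbitrary: A) auto

lemma fwedge_0 [simp]: "fwedge \<theta> (\<lambda>_. 0) xs = 0"
  by (induction xs) auto

lemma fwedge_add: "fwedge \<theta> (\<lambda>ys. A ys + C ys) xs = fwedge \<theta> A xs + fwedge \<theta> C xs"
  by (induction xs arbitrary: A C) (auto simp: algebra_simps)

lemma fwedge_diff: "fwedge \<theta> (\<lambda>ys. A ys - C ys) xs = fwedge \<theta> A xs - fwedge \<theta> C xs"
  by (induction xs arbitrary: A C) (auto simp: algebra_simps)

lemma fwedge_scale: "fwedge \<theta> (\<lambda>ys. c * A ys) xs = c * fwedge \<theta> A xs"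
  by (induction xs arbitrary: A) (auto simp: algebra_simps)

lemma fwedge_left_add: "fwedge (\<lambda>x. \<theta> x + \<phi> x) A xs = fwedge \<theta> A xs + fwedge \<phi> A xs"
  by (induction xs arbitrary: A) (auto simp: algebra_simps)

lemma fwedge_left_scale: "fwedge (\<lambda>x. c * \<theta> x) A xs = c * fwedge \<theta> A xs"
  by (induction xs arbitrary: A) (auto simp: algebra_simps)

lemma fwedge_self: "fwedge \<theta> (fwedge \<theta> A) xs = 0"
  by (induction xs arbitrary: A) (auto simp: fwedge_diff fwedge_scale)

lemma fwedge_anticommute: "fwedge \<theta> (fwedge \<phi> A) xs = - fwedge \<phi> (fwedge \<theta> A) xs"
  by (induction xs arbitrary: A) (auto simp: fwedge_diff fwedge_scale)

abbreviation form2 :: "('v \<Rightarrow> 'f::field) \<times> ('v \<Rightarrow> 'f) \<Rightarrow> ('v list \<Rightarrow> 'f) \<Rightarrow> 'v list \<Rightarrow> 'f" where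
  "form2 t A \<equiv> fwedge (fst t) (fwedge (snd t) A)"

lemma fwedge_neg: "fwedge \<theta> (\<lambda>ys. - A ys) xs = - fwedge \<theta> A xs"
  using fwedge_scale[of \<theta> "-1" A xs] by simp

lemma fwedge_form2: "fwedge \<theta> (form2 t A) = form2 t (fwedge \<theta> A)"
proof
  fix xs
  have "fwedge \<theta> (form2 t A) xs = - fwedge (fst t) (fwedge \<theta> (fwedge (snd t) A)) xs"
    by (rule fwedge_anticommute)
  also have "fwedge \<theta> (fwedge (snd t) A) = (\<lambda>ys. - fwedge (snd t) (fwedge \<theta> A) ys)"
    by (rule ext) (rule fwedge_anticommute)
  finally show "fwedge \<theta> (form2 t A) xs = form2 t (fwedge \<theta> A) xs" by (simp add: fwedge_neg)
qed

lemma fwedge_self_fun: "fwedge \<theta> (fwedge \<theta> A) = (\<lambda>_. 0)"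
  by (rule ext) (rule fwedge_self)

lemma fwedge_0_fun [simp]: "fwedge \<theta> (\<lambda>_. 0) = (\<lambda>_. 0)"
  by (rule ext) (rule fwedge_0)

lemma form2_self:
  "fwedge (fst t) (form2 t A) = (\<lambda>_. 0)" "fwedge (snd t) (form2 t A) = (\<lambda>_. 0)"
  "form2 t (fwedge (fst t) A) = (\<lambda>_. 0)" "form2 t (fwedge (snd t) A) = (\<lambda>_. 0)"
  "form2 t (form2 t A) = (\<lambda>_. 0)"
proof -
  show *: "fwedge (fst t) (form2 t A) = (\<lambda>_. 0)" "fwedge (snd t) (form2 t A) = (\<lambda>_. 0)"
    by (simp_all only: fwedge_self_fun fwedge_form2 fwedge_0_fun)
  then show "form2 t (fwedge (fst t) A) = (\<lambda>_. 0)" "form2 t (fwedge (snd t) A) = (\<lambda>_. 0)"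
    by (simp_all only: fwedge_form2)
  show "form2 t (form2 t A) = (\<lambda>_. 0)" by (simp only: * fwedge_0_fun)
qed

text \<open>\<open>divpow i ts A\<close> is the product of \<open>A\<close> with the \<open>i\<close>-th divided power of the 2-form
  \<open>\<Sum>(\<phi>, \<psi>)\<leftarrow>ts. \<phi> \<and> \<psi>\<close>, which makes sense in every characteristic.\<close>

fun divpow :: "nat \<Rightarrow> (('v \<Rightarrow> 'f::field) \<times> ('v \<Rightarrow> 'f)) list \<Rightarrow> ('v list \<Rightarrow> 'f) \<Rightarrow> 'v list \<Rightarrow> 'f" where
  "divpow 0 ts A = A"
| "divpow (Suc i) [] A = (\<lambda>_. 0)"
| "divpow (Suc i) (t # ts) A = (\<lambda>xs. divpow (Suc i) ts A xs + form2 t (divpow i ts A) xs)"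

lemma divpow_0 [simp]: "divpow i ts (\<lambda>_. 0) = (\<lambda>_. 0)"
  by (induction i ts "\<lambda>_::'a list. 0::'b" rule: divpow.induct) auto

lemma fwedge_add_fun: "fwedge \<theta> (\<lambda>ys. A ys + C ys) = (\<lambda>xs. fwedge \<theta> A xs + fwedge \<theta> C xs)"
  by (rule ext) (rule fwedge_add)

lemma fwedge_scale_fun: "fwedge \<theta> (\<lambda>ys. c * A ys) = (\<lambda>xs. c * fwedge \<theta> A xs)"
  by (rule ext) (rule fwedge_scale)

lemma divpow_scale: "divpow i ts (\<lambda>ys. c * A ys) = (\<lambda>xs. c * divpow i ts A xs)"
  by (induction i ts A rule: divpow.induct) (auto simp: fwedge_scale_fun algebra_simps)

lemma fwedge_divpow: "fwedge \<theta> (divpow i ts A) = divpow i ts (fwedge \<theta> A)"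
proof (induction i ts A rule: divpow.induct)
  case (3 i t ts A)
  have "fwedge \<theta> (divpow (Suc i) (t # ts) A) =
      (\<lambda>xs. fwedge \<theta> (divpow (Suc i) ts A) xs + fwedge \<theta> (form2 t (divpow i ts A)) xs)"
    by (simp add: fwedge_add_fun)
  also have "\<dots> = divpow (Suc i) (t # ts) (fwedge \<theta> A)"
    unfolding fwedge_form2 3 by simp
  finally show ?case .
qed auto

lemma form2_divpow: "form2 t (divpow i ts A) = divpow i ts (form2 t A)"
  by (simp add: fwedge_divpow)

text \<open>The value at (x, y) of the 2-form \<omega> whose divided powers enter
  \<open>divpow\<close>. \<open>B_eq_pairing\<close> identifies it with the given alternating
  form.\<close>

fun pairing :: "(('v \<Rightarrow> 'f::field) \<times> ('v \<Rightarrow> 'f)) list \<Rightarrow> 'v \<Rightarrow> 'v \<Rightarrow> 'f" where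
  "pairing [] x y = 0"
| "pairing (t # ts) x y = pairing ts x y + (fst t x * snd t y - snd t x * fst t y)"

lemma form2_Cons:
  "form2 t A (x # xs) = fst t x * fwedge (snd t) A xs - snd t x * fwedge (fst t) A xs + form2 t (\<lambda>ys. A (x # ys)) xs"
  by (simp add: fwedge_diff fwedge_scale)

text \<open>The contraction of a divided power \<open>\<omega>\<^sup>(\<^sup>i\<^sup>+\<^sup>1\<^sup>)\<close> by \<open>x\<close> is \<open>\<omega>(x, -) \<and> \<omega>\<^sup>(\<^sup>i\<^sup>)\<close>.\<close>

lemma divpow_Cons:
  "divpow (Suc i) ts A (x # xs) = divpow (Suc i) ts (\<lambda>ys. A (x # ys)) xs + fwedge (pairing ts x) (divpow i ts A) xs"
proof (induction ts arbitrary: i xs)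
  case Nil
  then show ?case by (simp add: fwedge_zero_left)
next
  case (Cons t ts)
  have P: "fwedge (pairing (t # ts) x) C xs =
      fwedge (pairing ts x) C xs + (fst t x * fwedge (snd t) C xs - snd t x * fwedge (fst t) C xs)" for C
  proof -
    have "pairing (t # ts) x = (\<lambda>y. pairing ts x y + (fst t x * snd t y + (- snd t x) * fst t y))"
      by (simp add: fun_eq_iff)
    then show ?thesis by (simp only: fwedge_left_add fwedge_left_scale) simp
  qed
  show ?case
  proof (cases i)
    case 0
    then show ?thesis using Cons[of 0 xs] by (simp only: divpow.simps form2_Cons P) simp
  next
    case (Suc j)
    have IH: "(\<lambda>ys. divpow (Suc j) ts A (x # ys)) =
        (\<lambda>ys. divpow (Suc j) ts (\<lambda>ys. A (x # ys)) ys + fwedge (pairing ts x) (divpow j ts A) ys)"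
      by (rule ext) (rule Cons)
    have F: "form2 t (\<lambda>ys. divpow (Suc j) ts A (x # ys)) xs =
        form2 t (divpow (Suc j) ts (\<lambda>ys. A (x # ys))) xs + fwedge (pairing ts x) (form2 t (divpow j ts A)) xs"
      unfolding IH fwedge_form2 by (simp only: fwedge_add_fun)
    have W: "fwedge \<theta> (divpow (Suc j) (t # ts) A) xs =
        fwedge \<theta> (divpow (Suc j) ts A) xs + fwedge \<theta> (form2 t (divpow j ts A)) xs" for \<theta>
      by (simp add: fwedge_add)
    \<comment> \<open>When the product on the right is expanded, the terms in which
      \<open>fst t\<close> or \<open>snd t\<close> meets \<open>form2 t\<close> vanish.\<close>
    show ?thesis
      unfolding Suc P W form2_self
      using Cons[of "Suc j" xs] by (simp add: form2_Cons F del: fwedge.simps)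
  qed
qed

text \<open>Contraction by the first vector x leaves two terms: one has the factor \<omega>(x, -),
  which vanishes on the rest of the list, the other is the same divided power times a contracted
  form, on a shorter list.\<close>

lemma divpow_isotropic:
  assumes "\<And>x y. x \<in> set xs \<Longrightarrow> y \<in> set xs \<Longrightarrow> pairing ts x y = 0"
  shows "divpow (Suc i) ts A xs = 0"
  using assms
proof (induction xs arbitrary: A)
  case Nil
  show ?case by (induction ts) auto
next
  case (Cons x xs)
  have "fwedge (pairing ts x) (divpow i ts A) xs = 0"
    using Cons.prems by (intro fwedge_zero_left) auto
  then show ?case unfolding divpow_Cons using Cons by simp
qed

section \<open>Alternating forms and interpolation\<close>

definition alt_form :: "('f::field \<Rightarrow> 'v::ab_group_add \<Rightarrow> 'v) \<Rightarrow> ('v list \<Rightarrow> 'f) \<Rightarrow> bool" where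
  "alt_form scale A \<longleftrightarrow>
     (\<forall>us x y vs. A (us @ (x + y) # vs) = A (us @ x # vs) + A (us @ y # vs)) \<and>
     (\<forall>us c x vs. A (us @ scale c x # vs) = c * A (us @ x # vs)) \<and>
     (\<forall>vs. \<not> distinct vs \<longrightarrow> A vs = 0)"

lemma alt_formD:
  assumes "alt_form scale A"
  shows "A (us @ (x + y) # vs) = A (us @ x # vs) + A (us @ y # vs)"
    and "A (us @ scale c x # vs) = c * A (us @ x # vs)"
    and "\<not> distinct vs \<Longrightarrow> A vs = 0"
  using assms unfolding alt_form_def by blast+

lemma alt_form_wedge: "alt_form scale A \<Longrightarrow> wedge scale vs A = A vs"
  unfolding wedge_def alt_form_def alternating_map_def by (simp add: ext_scale_def)

lemma alt_form_0: "alt_form scale (\<lambda>_. 0)"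
  by (simp add: alt_form_def)

lemma alt_form_add: "alt_form scale A \<Longrightarrow> alt_form scale C \<Longrightarrow> alt_form scale (\<lambda>xs. A xs + C xs)"
  by (simp add: alt_form_def algebra_simps)

lemma alt_form_scale: "alt_form scale A \<Longrightarrow> alt_form scale (\<lambda>xs. c * A xs)"
  by (simp add: alt_form_def algebra_simps)

definition functional :: "('f::field \<Rightarrow> 'v::ab_group_add \<Rightarrow> 'v) \<Rightarrow> ('v \<Rightarrow> 'f) \<Rightarrow> bool" where
  "functional scale \<theta> \<longleftrightarrow> (\<forall>x y. \<theta> (x + y) = \<theta> x + \<theta> y) \<and> (\<forall>c x. \<theta> (scale c x) = c * \<theta> x)"

text \<open>Only the summand in which \<theta> is evaluated at \<open>x\<close> survives, with the
  sign of moving past \<open>us\<close>.\<close>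

lemma fwedge_insert:
  assumes "\<And>xs. x \<in> set xs \<Longrightarrow> C xs = 0"
  shows "fwedge \<theta> C (us @ x # vs) = (- 1) ^ length us * \<theta> x * C (us @ vs)"
  using assms
proof (induction us arbitrary: C)
  case Nil
  have "fwedge \<theta> (\<lambda>ys. C (x # ys)) vs = 0" using Nil by (simp add: fwedge_0)
  then show ?case by simp
next
  case (Cons u us)
  have "fwedge \<theta> (\<lambda>ys. C (u # ys)) (us @ x # vs) = (- 1) ^ length us * \<theta> x * C (u # us @ vs)"
    using Cons.prems by (intro Cons.IH) auto
  then show ?case using Cons.prems by simp
qed

lemma alt_form_move:
  assumes "alt_form scale A"
  shows "A (us @ x # vs) = (- 1) ^ length us * A (x # us @ vs)"
proof (induction us arbitrary: vs rule: rev_induct)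
  case (snoc u us)
  have "wedge scale (us @ u # x # vs) A = - wedge scale (us @ x # u # vs) A"
    by (subst wedge_swap) simp
  then show ?case using snoc[of "u # vs"] alt_form_wedge[OF assms] by simp
qed simp

lemma alt_form_fwedge:
  assumes A: "alt_form scale A" and \<theta>: "functional scale \<theta>"
  shows "alt_form scale (fwedge \<theta> A)"
  unfolding alt_form_def
proof (intro conjI allI impI)
  fix us x y vs
  show "fwedge \<theta> A (us @ (x + y) # vs) = fwedge \<theta> A (us @ x # vs) + fwedge \<theta> A (us @ y # vs)"
    using alt_formD(1)[OF A]
  proof (induction us arbitrary: A)
    case Nil
    have "(\<lambda>ys. A ((x + y) # ys)) = (\<lambda>ys. A (x # ys) + A (y # ys))"
      using Nil[of "[]"] by (intro ext) simp
    then show ?case using \<theta> by (simp add: fwedge_add functional_def algebra_simps)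
  next
    case (Cons u us)
    have "fwedge \<theta> (\<lambda>ys. A (u # ys)) (us @ (x + y) # vs) =
        fwedge \<theta> (\<lambda>ys. A (u # ys)) (us @ x # vs) + fwedge \<theta> (\<lambda>ys. A (u # ys)) (us @ y # vs)"
      by (rule Cons.IH) (use Cons.prems[of "u # _"] in simp)
    then show ?case using Cons.prems by (simp add: algebra_simps)
  qed
next
  fix us c x vs
  show "fwedge \<theta> A (us @ scale c x # vs) = c * fwedge \<theta> A (us @ x # vs)"
    using alt_formD(2)[OF A]
  proof (induction us arbitrary: A)
    case Nil
    have "(\<lambda>ys. A (scale c x # ys)) = (\<lambda>ys. c * A (x # ys))"
      using Nil[of "[]"] by (intro ext) simp
    then show ?case using \<theta> by (simp add: fwedge_scale functional_def algebra_simps)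
  next
    case (Cons u us)
    have "fwedge \<theta> (\<lambda>ys. A (u # ys)) (us @ scale c x # vs) = c * fwedge \<theta> (\<lambda>ys. A (u # ys)) (us @ x # vs)"
      by (rule Cons.IH) (use Cons.prems[of "u # _"] in simp)
    then show ?case using Cons.prems by (simp add: algebra_simps)
  qed
next
  fix vs :: "'b list" assume "\<not> distinct vs"
  then obtain as x bs cs where vs: "vs = as @ [x] @ bs @ [x] @ cs"
    using not_distinct_decomp by blast
  have "fwedge \<theta> A (as @ x # bs @ x # cs) = 0" using A
  proof (induction as arbitrary: A)
    case Nil
    \<comment> \<open>Two summands remain, with \<theta> evaluated at either occurrence of
      \<open>x\<close>. Moving the other occurrence to the front gives them opposite signs.\<close>
    have "fwedge \<theta> (\<lambda>ys. A (x # ys)) (bs @ x # cs) = (- 1) ^ length bs * \<theta> x * A (x # bs @ cs)"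
      by (rule fwedge_insert) (simp add: alt_formD(3)[OF Nil])
    then show ?case using alt_form_move[OF Nil, of bs x cs] by simp
  next
    case (Cons a as)
    have "alt_form scale (\<lambda>ys. A (a # ys))"
      using alt_formD(1)[OF Cons.prems, of "a # _"] alt_formD(2)[OF Cons.prems, of "a # _"]
        alt_formD(3)[OF Cons.prems]
      unfolding alt_form_def by simp
    then have "fwedge \<theta> (\<lambda>ys. A (a # ys)) (as @ x # bs @ x # cs) = 0" by (rule Cons.IH)
    then show ?case using alt_formD(3)[OF Cons.prems] by simp
  qed
  then show "fwedge \<theta> A vs = 0" using vs by simp
qed

lemma alt_form_divpow:
  assumes "alt_form scale A" "\<And>t. t \<in> set ts \<Longrightarrow> functional scale (fst t) \<and> functional scale (snd t)"
  shows "alt_form scale (divpow i ts A)"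
  using assms
proof (induction i ts A rule: divpow.induct)
  case (3 i t ts A)
  then show ?case by (simp add: alt_form_add alt_form_fwedge)
qed (auto simp: alt_form_0)

section \<open>Ideals generated by divided powers of a 2-form\<close>

definition vanishes_on :: "'v set \<Rightarrow> ('v list \<Rightarrow> 'f::field) \<Rightarrow> bool" where
  "vanishes_on Z A \<longleftrightarrow> (\<forall>xs. set xs \<inter> Z \<noteq> {} \<longrightarrow> A xs = 0)"

lemma vanishes_on_fwedge:
  assumes "vanishes_on Z A" "\<And>z. z \<in> Z \<Longrightarrow> \<theta> z = 0"
  shows "vanishes_on Z (fwedge \<theta> A)"
  unfolding vanishes_on_def
proof (intro allI impI)
  fix xs assume "set xs \<inter> Z \<noteq> {}"
  then show "fwedge \<theta> A xs = 0" using assms(1)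
  proof (induction xs arbitrary: A)
    case (Cons x xs)
    show ?case
    proof (cases "x \<in> Z")
      case True
      then have "(\<lambda>ys. A (x # ys)) = (\<lambda>_. 0)" using Cons.prems by (auto simp: vanishes_on_def)
      then show ?thesis using True assms(2) by simp
    next
      case False
      then have "set xs \<inter> Z \<noteq> {}" using Cons.prems by auto
      moreover from this have "fwedge \<theta> (\<lambda>ys. A (x # ys)) xs = 0"
        using Cons.prems(2) by (intro Cons.IH) (auto simp: vanishes_on_def)
      ultimately show ?thesis using Cons.prems(2) by (simp add: vanishes_on_def)
    qed
  qed simp
qed

lemma vanishes_on_add: "vanishes_on Z A \<Longrightarrow> vanishes_on Z C \<Longrightarrow> vanishes_on Z (\<lambda>xs. A xs + C xs)"
  by (simp add: vanishes_on_def)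

lemma vanishes_on_0: "vanishes_on Z (\<lambda>_. 0)"
  by (simp add: vanishes_on_def)

lemma vanishes_on_subset: "vanishes_on Z A \<Longrightarrow> Y \<subseteq> Z \<Longrightarrow> vanishes_on Y A"
  unfolding vanishes_on_def by blast

lemma vanishes_on_Cons: "vanishes_on Z A \<Longrightarrow> x \<in> Z \<Longrightarrow> (\<lambda>ys. A (x # ys)) = (\<lambda>_. 0)"
  unfolding vanishes_on_def by auto

lemma vanishes_on_divpow:
  assumes "vanishes_on Z A" "\<And>t z. t \<in> set ts \<Longrightarrow> z \<in> Z \<Longrightarrow> fst t z = 0 \<and> snd t z = 0"
  shows "vanishes_on Z (divpow i ts A)"
  using assms
proof (induction i ts A rule: divpow.induct)
  case (3 i t ts A)
  then show ?case by (simp add: vanishes_on_add vanishes_on_fwedge)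
qed (auto simp: vanishes_on_0)

inductive_set power_ideal for scale :: "'f::field \<Rightarrow> 'v::ab_group_add \<Rightarrow> 'v" and ts Z r where
  zero: "(\<lambda>_. 0) \<in> power_ideal scale ts Z r"
| step: "X \<in> power_ideal scale ts Z r \<Longrightarrow> r \<le> i \<Longrightarrow> alt_form scale A \<Longrightarrow> vanishes_on Z A \<Longrightarrow>
    (\<lambda>xs. X xs + divpow i ts A xs) \<in> power_ideal scale ts Z r"

lemma power_ideal_divpow:
  "r \<le> i \<Longrightarrow> alt_form scale A \<Longrightarrow> vanishes_on Z A \<Longrightarrow> divpow i ts A \<in> power_ideal scale ts Z r"
  using power_ideal.step[OF power_ideal.zero] by simp

lemma power_ideal_add:
  assumes "X \<in> power_ideal scale ts Z r" "Y \<in> power_ideal scale ts Z r"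
  shows "(\<lambda>xs. X xs + Y xs) \<in> power_ideal scale ts Z r"
  using assms(2)
proof induction
  case zero
  then show ?case using assms(1) by simp
next
  case (step Y i A)
  have "(\<lambda>xs. (X xs + Y xs) + divpow i ts A xs) \<in> power_ideal scale ts Z r"
    using step by (intro power_ideal.step)
  then show ?case by (simp add: add.assoc)
qed

lemma power_ideal_alt_form:
  assumes "X \<in> power_ideal scale ts Z r"
    and "\<And>t. t \<in> set ts \<Longrightarrow> functional scale (fst t) \<and> functional scale (snd t)"
  shows "alt_form scale X"
  using assms(1)
proof induction
  case (step X i A)
  then show ?case using assms(2) by (intro alt_form_add alt_form_divpow)
qed (rule alt_form_0)

lemma power_ideal_vanishes_on:
  assumes "X \<in> power_ideal scale ts Z r"
    and "\<And>t z. t \<in> set ts \<Longrightarrow> z \<in> Z \<Longrightarrow> fst t z = 0 \<and> snd t z = 0"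
  shows "vanishes_on Z X"
  using assms(1)
proof induction
  case (step X i A)
  then show ?case using assms(2) by (intro vanishes_on_add vanishes_on_divpow)
qed (rule vanishes_on_0)

lemma power_ideal_isotropic:
  assumes "X \<in> power_ideal scale ts Z (Suc r)"
    and "\<And>x y. x \<in> set xs \<Longrightarrow> y \<in> set xs \<Longrightarrow> pairing ts x y = 0"
  shows "X xs = 0"
  using assms
proof induction
  case (step X i A)
  then obtain j where "i = Suc j" by (cases i) auto
  then show ?case using step divpow_isotropic[of xs ts j A] by simp
qed simp

lemma divpow_Cons_form2_0:
  assumes "form2 t A = (\<lambda>_. 0)"
  shows "divpow i (t # ts) A = divpow i ts A"
  by (cases i) (simp_all add: form2_divpow assms)

text \<open>A factor of t annihilates t, so \<omega>' and \<omega>' + t have the same divided powers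
  on multiples of \<theta>, and the index is kept.\<close>

lemma power_ideal_fwedge:
  assumes "X \<in> power_ideal scale ts Z' r" "Z \<subseteq> Z'" "\<theta> = fst t \<or> \<theta> = snd t"
    and "functional scale \<theta>" "\<And>z. z \<in> Z \<Longrightarrow> \<theta> z = 0"
  shows "fwedge \<theta> X \<in> power_ideal scale (t # ts) Z r"
  using assms(1)
proof induction
  case zero
  show ?case by (simp add: power_ideal.zero)
next
  case (step X i A)
  have "form2 t (fwedge \<theta> A) = (\<lambda>_. 0)" using assms(3) form2_self(3,4) by blast
  then have "fwedge \<theta> (divpow i ts A) = divpow i (t # ts) (fwedge \<theta> A)"
    by (simp add: fwedge_divpow divpow_Cons_form2_0)
  moreover have "(\<lambda>xs. fwedge \<theta> X xs + divpow i (t # ts) (fwedge \<theta> A) xs) \<in> power_ideal scale (t # ts) Z r"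
    by (rule power_ideal.step[OF step.IH step.hyps(2) alt_form_fwedge[OF step.hyps(3) assms(4)]])
      (rule vanishes_on_fwedge[OF vanishes_on_subset[OF step.hyps(4) assms(2)] assms(5)])
  ultimately show ?case by (simp add: fwedge_add_fun)
qed

text \<open>Since t \<and> t = 0, \<omega>'^(i) \<and> A = \<omega>^(i) \<and> A - \<omega>^(i-1)
  \<and> t \<and> A for \<omega> = \<omega>' + t. Passing to the larger 2-form costs one index. This
  is why \<open>complement_lists\<close> raises its index for monomials that avoid the pair.\<close>

lemma power_ideal_Suc:
  assumes "X \<in> power_ideal scale ts Z' (Suc r)" "Z \<subseteq> Z'"
    and "functional scale (fst t)" "functional scale (snd t)"
    and "\<And>z. z \<in> Z \<Longrightarrow> fst t z = 0 \<and> snd t z = 0"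
  shows "X \<in> power_ideal scale (t # ts) Z r"
  using assms(1)
proof induction
  case zero
  show ?case by (rule power_ideal.zero)
next
  case (step X i A)
  then obtain j where j: "i = Suc j" by (cases i) auto
  have A: "vanishes_on Z A" using step assms(2) vanishes_on_subset by blast
  let ?C = "\<lambda>xs. (- 1) * form2 t A xs"
  have C: "alt_form scale ?C"
    by (intro alt_form_scale alt_form_fwedge step.hyps assms(3,4))
  have "vanishes_on Z (form2 t A)" using A assms(5) by (intro vanishes_on_fwedge) auto
  then have vC: "vanishes_on Z ?C" by (simp add: vanishes_on_def)
  have "form2 t ?C = (\<lambda>_. 0)" by (simp only: fwedge_scale_fun form2_self) simp
  then have "divpow j (t # ts) ?C = divpow j ts ?C" by (rule divpow_Cons_form2_0)
  also have "\<dots> = (\<lambda>xs. (- 1) * form2 t (divpow j ts A) xs)"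
    unfolding divpow_scale form2_divpow ..
  finally have *: "divpow i ts A = (\<lambda>xs. divpow i (t # ts) A xs + divpow j (t # ts) ?C xs)"
    unfolding j by (simp add: fun_eq_iff)
  show ?case
    unfolding * using step j A C vC by (intro power_ideal_add power_ideal_divpow) auto
qed

text \<open>From \<omega>^(i+1) \<and> A = \<omega>'^(i+1) \<and> A + t \<and> \<omega>'^(i) \<and>
  A: multiplication by t gains one index, at the price of a summand \<open>Y\<close> in the inner
  coordinates.\<close>

lemma power_ideal_form2:
  assumes "X \<in> power_ideal scale ts Z' r" "Z \<subseteq> Z'"
    and "\<And>s z. s \<in> set ts \<Longrightarrow> z \<in> Z' \<Longrightarrow> fst s z = 0 \<and> snd s z = 0"
  shows "\<exists>Y. vanishes_on Z' Y \<and> (\<lambda>xs. Y xs + form2 t X xs) \<in> power_ideal scale (t # ts) Z (Suc r)"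
  using assms(1)
proof induction
  case zero
  show ?case by (rule exI[of _ "\<lambda>_. 0"]) (simp add: power_ideal.zero vanishes_on_0)
next
  case (step X i A)
  then obtain Y where Y: "vanishes_on Z' Y" "(\<lambda>xs. Y xs + form2 t X xs) \<in> power_ideal scale (t # ts) Z (Suc r)"
    by blast
  have "vanishes_on Z' (\<lambda>xs. Y xs + divpow (Suc i) ts A xs)"
    using Y step assms(3) by (intro vanishes_on_add vanishes_on_divpow) auto
  moreover have "(\<lambda>xs. (Y xs + form2 t X xs) + divpow (Suc i) (t # ts) A xs) \<in> power_ideal scale (t # ts) Z (Suc r)"
    using step.hyps(2)
    by (intro power_ideal.step[OF Y(2) _ step.hyps(3) vanishes_on_subset[OF step.hyps(4) assms(2)]]) simp
  ultimately show ?case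
    by (intro exI[of _ "\<lambda>xs. Y xs + divpow (Suc i) ts A xs"]) (simp add: fwedge_add_fun algebra_simps)
qed

section \<open>Forms with prescribed values on basis monomials\<close>

lemma interpolate_subseqs:
  fixes \<theta> :: "'v::ab_group_add \<Rightarrow> 'v \<Rightarrow> 'f::field"
  assumes "\<And>v. functional scale (\<theta> v)" "distinct L"
    and "\<And>v w. v \<in> set L \<Longrightarrow> w \<in> set L \<Longrightarrow> \<theta> v w = (if v = w then 1 else 0)"
    and "\<And>v z. v \<in> set L \<Longrightarrow> z \<in> Z \<Longrightarrow> \<theta> v z = 0"
  shows "\<exists>A. alt_form scale A \<and> vanishes_on Z A \<and> (\<forall>d \<in> set (subseqs L). A d = c d)"
  using assms(2-)
proof (induction L arbitrary: Z c)
  case Nil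
  define A :: "'v list \<Rightarrow> 'f" where "A = (\<lambda>xs. if xs = [] then c [] else 0)"
  have "alt_form scale A" by (simp add: alt_form_def A_def)
  moreover have "vanishes_on Z A" by (auto simp: vanishes_on_def A_def)
  ultimately show ?case by (intro exI[of _ A]) (simp add: A_def)
next
  case (Cons x L)
  let ?Z = "insert x Z"
  have IH: "\<exists>A. alt_form scale A \<and> vanishes_on ?Z A \<and> (\<forall>d \<in> set (subseqs L). A d = c' d)" for c'
    using Cons.prems by (intro Cons.IH) auto
  obtain A where A: "alt_form scale A" "vanishes_on ?Z A" "\<forall>d \<in> set (subseqs L). A d = c d"
    using IH by blast
  obtain C where C: "alt_form scale C" "vanishes_on ?Z C" "\<forall>d \<in> set (subseqs L). C d = c (x # d)"
    using IH[of "\<lambda>d. c (x # d)"] by blast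
  let ?X = "\<lambda>xs. A xs + fwedge (\<theta> x) C xs"
  have "alt_form scale ?X" by (intro alt_form_add A alt_form_fwedge C assms(1))
  moreover have "vanishes_on Z ?X"
    using A(2) C(2) Cons.prems
    by (intro vanishes_on_add vanishes_on_fwedge) (auto intro: vanishes_on_subset)
  moreover have "?X d = c d" if "d \<in> set (subseqs L)" for d
  proof -
    have "fwedge (\<theta> x) C d = 0"
      using subseqs_subset[OF that] Cons.prems by (intro fwedge_zero_left) auto
    then show ?thesis using A(3) that by simp
  qed
  moreover have "?X (x # d) = c (x # d)" if "d \<in> set (subseqs L)" for d
  proof -
    have "A (x # d) = 0" using A(2) by (simp add: vanishes_on_def)
    then show ?thesis
      using C(3) that Cons.prems(2)[of x x] by (simp add: vanishes_on_Cons[OF C(2)])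
  qed
  ultimately show ?case by (intro exI[of _ ?X]) (auto simp: subseqs_Cons_set simp del: subseqs.simps(2))
qed

abbreviation dual_pairs :: "('v \<Rightarrow> 'v \<Rightarrow> 'f) \<Rightarrow> ('v \<times> 'v) list \<Rightarrow> (('v \<Rightarrow> 'f) \<times> ('v \<Rightarrow> 'f)) list" where
  "dual_pairs \<theta> ps \<equiv> map (\<lambda>p. (\<theta> (fst p), \<theta> (snd p))) ps"

text \<open>The four summands of \<open>?X\<close> below match the four kinds of lists in
  \<open>complement_lists\<close>: without e and f, with e, with f, with both. The three ideal
  lemmas above dictate the index at which each summand is taken.\<close>

lemma interpolate_complement_lists:
  fixes \<theta> :: "'v::ab_group_add \<Rightarrow> 'v \<Rightarrow> 'f::field"
  assumes lin: "\<And>v. functional scale (\<theta> v)" and "distinct (flat ps @ R)"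
    and "\<And>v w. v \<in> set (flat ps @ R) \<Longrightarrow> w \<in> set (flat ps @ R) \<Longrightarrow> \<theta> v w = (if v = w then 1 else 0)"
    and "\<And>v z. v \<in> set (flat ps @ R) \<Longrightarrow> z \<in> Z \<Longrightarrow> \<theta> v z = 0"
  shows "\<exists>X \<in> power_ideal scale (dual_pairs \<theta> ps) Z r. \<forall>d \<in> complement_lists R ps r. X d = c d"
  using assms(2-)
proof (induction R ps r arbitrary: Z c rule: complement_lists.induct)
  case (1 R ps)
  obtain A where A: "alt_form scale A" "vanishes_on Z A" "\<forall>d \<in> set (subseqs (flat ps @ R)). A d = c d"
    using interpolate_subseqs[OF lin 1, of Z c] by blast
  then have "divpow 0 (dual_pairs \<theta> ps) A \<in> power_ideal scale (dual_pairs \<theta> ps) Z 0"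
    by (intro power_ideal_divpow) auto
  then show ?case using A(3) by (intro bexI[of _ A]) auto
next
  case (2 R r)
  show ?case by (rule bexI[OF _ power_ideal.zero]) simp
next
  case (3 R p ps r)
  obtain e f where p: "p = (e, f)" by fastforce
  let ?Z = "insert e (insert f Z)" and ?ts = "dual_pairs \<theta> ps" and ?t = "(\<theta> e, \<theta> f)"
  have ef: "e \<noteq> f" and inner: "\<And>v. v \<in> set (flat ps @ R) \<Longrightarrow> v \<noteq> e \<and> v \<noteq> f"
    and dist: "distinct (flat ps @ R)"
    using "3.prems"(1) p by auto
  have dual: "\<theta> v w = (if v = w then 1 else 0)"
    if "v \<in> insert e (insert f (set (flat ps @ R)))" "w \<in> insert e (insert f (set (flat ps @ R)))" for v w
    using "3.prems"(2)[of v w] that p by auto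
  have orthZ: "\<theta> v z = 0" if "v \<in> insert e (insert f (set (flat ps @ R)))" "z \<in> Z" for v z
    using "3.prems"(3)[of v z] that p by auto
  have orthZ': "\<theta> v z = 0" if "v \<in> set (flat ps @ R)" "z \<in> ?Z" for v z
    using that orthZ dual inner by auto
  note IH = "3.IH"[OF dist dual[OF insertI2[OF insertI2] insertI2[OF insertI2]] orthZ']
  have ts: "fst s z = 0 \<and> snd s z = 0" if s: "s \<in> set ?ts" and z: "z \<in> ?Z" for s z
  proof -
    obtain q where q: "q \<in> set ps" "s = (\<theta> (fst q), \<theta> (snd q))"
      using s by auto
    then have "fst q \<in> set (flat ps @ R)" "snd q \<in> set (flat ps @ R)" by (auto simp: set_flat)
    then show ?thesis using orthZ'[OF _ z] q(2) by simp
  qed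
  obtain X1 where X1: "X1 \<in> power_ideal scale ?ts ?Z (Suc r)"
      "\<forall>d \<in> complement_lists R ps (Suc r). X1 d = c (e # d)"
    using IH(2)[of ?Z "\<lambda>d. c (e # d)"] by auto
  obtain X2 where X2: "X2 \<in> power_ideal scale ?ts ?Z (Suc r)"
      "\<forall>d \<in> complement_lists R ps (Suc r). X2 d = c (f # d)"
    using IH(2)[of ?Z "\<lambda>d. c (f # d)"] by auto
  obtain X3 where X3: "X3 \<in> power_ideal scale ?ts ?Z r"
      "\<forall>d \<in> complement_lists R ps r. X3 d = c (e # f # d)"
    using IH(4)[of ?Z "\<lambda>d. c (e # f # d)"] by auto
  obtain Y where Y: "vanishes_on ?Z Y" "(\<lambda>xs. Y xs + form2 ?t X3 xs) \<in> power_ideal scale (?t # ?ts) Z (Suc r)"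
    using power_ideal_form2[OF X3(1), of Z ?t] ts by blast
  \<comment> \<open>The correction \<open>Y\<close> that accompanies \<open>X3\<close> also
    contributes on lists without e and f, so it is subtracted from the values prescribed for
    \<open>X4\<close>. On the other lists it vanishes.\<close>
  obtain X4 where X4: "X4 \<in> power_ideal scale ?ts ?Z (Suc (Suc r))"
      "\<forall>d \<in> complement_lists R ps (Suc (Suc r)). X4 d = c d - Y d"
    using IH(1)[of ?Z "\<lambda>d. c d - Y d"] by auto
  let ?X = "\<lambda>xs. ((X4 xs + fwedge (\<theta> e) X1 xs) + fwedge (\<theta> f) X2 xs) + (Y xs + form2 ?t X3 xs)"
  have "?X \<in> power_ideal scale (?t # ?ts) Z (Suc r)"
    using lin orthZ
    by (intro power_ideal_add[OF power_ideal_add[OF power_ideal_add] Y(2)]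
        power_ideal_fwedge[OF X1(1)] power_ideal_fwedge[OF X2(1)] power_ideal_Suc[OF X4(1)]) auto
  moreover have "?X d = c d" if "d \<in> complement_lists R ps (Suc (Suc r))" for d
  proof -
    have "\<theta> v x = 0" if "v = e \<or> v = f" "x \<in> set d" for v x
      using that complement_lists_subset[OF \<open>d \<in> _\<close>] dual inner[of x] by auto
    then show ?thesis using X4(2) that by (simp add: fwedge_zero_left)
  qed
  moreover have van: "A (e # d) = 0 \<and> A (f # d) = 0 \<and> A (e # f # d) = 0" if "vanishes_on ?Z A" for A :: "'v list \<Rightarrow> 'f" and d
    using that by (auto simp: vanishes_on_def)
  have vX: "vanishes_on ?Z X1" "vanishes_on ?Z X2" "vanishes_on ?Z X3" "vanishes_on ?Z X4"
    using X1(1) X2(1) X3(1) X4(1) ts by (auto intro!: power_ideal_vanishes_on)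
  note c0 = vX[THEN vanishes_on_Cons, of e] vX[THEN vanishes_on_Cons, of f]
  have \<theta>ef: "\<theta> e e = 1" "\<theta> e f = 0" "\<theta> f e = 0" "\<theta> f f = 1"
    using dual ef by auto
  moreover have "?X (e # d) = c (e # d)" "?X (f # d) = c (f # d)" if "d \<in> complement_lists R ps (Suc r)" for d
  proof -
    have "\<theta> v x = 0" if "v = e \<or> v = f" "x \<in> set d" for v x
      using that complement_lists_subset[OF \<open>d \<in> _\<close>] dual inner[of x] by auto
    then have "fwedge (\<theta> v) A d = 0" if "v = e \<or> v = f" for v A
      using that by (intro fwedge_zero_left) auto
    then show "?X (e # d) = c (e # d)" "?X (f # d) = c (f # d)"
      using X1(2) X2(2) that van[OF vX(4)] van[OF Y(1)] \<theta>ef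
      by (simp_all add: c0)
  qed
  moreover have "?X (e # f # d) = c (e # f # d)" if "d \<in> complement_lists R ps r" for d
    using X3(2) that van[OF vX(1), of d] van[OF vX(4), of d] van[OF Y(1), of d] \<theta>ef
    by (simp add: c0)
  ultimately show ?case unfolding p by (intro bexI[of _ ?X]) auto
qed

section \<open>Spans of wedge products\<close>

lemma wedge_perm_mem:
  assumes "ext.subspace Y" "wedge scale ys \<in> Y" "mset xs = mset ys"
  shows "wedge scale xs \<in> Y"
proof -
  have "wedge scale xs \<in> ext.span {wedge scale ys}"
    using wedge_perm[OF assms(3), of scale "[]"] by simp
  moreover have "ext.span {wedge scale ys} \<subseteq> Y" using assms by (intro ext.span_minimal) auto
  ultimately show ?thesis by blast
qed

context vector_space
begin

lemma wedge_dependent: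
  assumes "dependent (set xs)"
  shows "wedge scale xs = 0"
proof (cases "distinct xs")
  case True
  obtain a where a: "a \<in> set xs" "a \<in> span (set xs - {a})" using assms unfolding dependent_def by blast
  define ys where "ys = remove1 a xs"
  have ys: "mset xs = mset (ys @ [a])" "set ys = set xs - {a}"
    using a(1) True by (simp_all add: ys_def)
  have "wedge scale (ys @ [a]) \<in> ext.span {wedge scale (ys @ xs) | xs. length xs = length [a] \<and> set xs \<subseteq> set ys}"
    using a(2) ys(2) by (intro wedge_expand vector_space_axioms) auto
  also have "\<dots> \<subseteq> {0}"
  proof (rule ext.span_minimal[OF _ ext.subspace_single_0], safe)
    fix zs assume "length zs = length [a]" "set zs \<subseteq> set ys"
    then obtain z where "zs = [z]" "z \<in> set ys" by (auto simp: length_Suc_conv)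
    then show "wedge scale (ys @ zs) = 0" by (simp add: wedge_not_distinct)
  qed
  finally have "wedge scale (ys @ [a]) = 0" by simp
  then have "wedge scale xs \<in> {0}"
    using wedge_perm_mem[OF ext.subspace_single_0 _ ys(1)] by simp
  then show ?thesis by simp
qed (rule wedge_not_distinct)

text \<open>Multilinear expansion reduces membership to monomials in the order of \<open>L\<close>.
  The prefix \<open>pre\<close> stays untouched: it holds the vectors split off earlier in an
  induction.\<close>

lemma wedge_span_mem:
  assumes Y: "ext.subspace Y" and L: "distinct L"
    and "\<And>d. d \<in> set (subseqs L) \<Longrightarrow> length d = length ws \<Longrightarrow> wedge scale (pre @ d) \<in> Y"
    and ws: "set ws \<subseteq> span (set L)"
  shows "wedge scale (pre @ ws) \<in> Y"
proof -
  have "{wedge scale (pre @ xs) | xs. length xs = length ws \<and> set xs \<subseteq> set L} \<subseteq> Y"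
  proof safe
    fix xs assume xs: "length xs = length ws" "set xs \<subseteq> set L"
    show "wedge scale (pre @ xs) \<in> Y"
    proof (cases "distinct xs")
      case True
      obtain d where d: "d \<in> set (subseqs L)" "set d = set xs"
        using subset_subseqs[OF xs(2)] by (metis imageE)
      then have "mset xs = mset d"
        using True L subseqs_distinctD set_eq_iff_mset_eq_distinct by blast
      moreover from this have "wedge scale (pre @ d) \<in> Y"
        using assms(3)[OF d(1)] xs(1) mset_eq_length by metis
      ultimately show ?thesis using wedge_perm_mem[OF Y, of scale "pre @ d" "pre @ xs"] by simp
    next
      case False
      then have "wedge scale (pre @ xs) = 0" by (intro wedge_not_distinct) auto
      then show ?thesis using ext.subspace_0[OF Y] by simp
    qed
  qed
  then have "ext.span {wedge scale (pre @ xs) | xs. length xs = length ws \<and> set xs \<subseteq> set L} \<subseteq> Y"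
    using Y by (rule ext.span_minimal)
  then show ?thesis using wedge_expand[OF vector_space_axioms ws, of pre] by blast
qed

end

text \<open>The pair \<open>(qs, us)\<close> stands for the monomial \<open>flat qs @ us\<close>, with \<open>us\<close> isotropic. The rule \<open>exchange\<close>
  replaces a hyperbolic pair \<open>(x, y)\<close> by a totally isotropic plane whose wedge product is
  \<open>x \<and> y - e \<and> f\<close> up to terms containing exactly one of \<open>x\<close>, \<open>y\<close>. The coefficient \<open>\<gamma>\<close> is free,
  so that \<open>x + f + \<gamma> e\<close> can be made singular for a quadratic form.\<close>

inductive isotropic_gen :: "('f::field \<Rightarrow> 'v::ab_group_add \<Rightarrow> 'v) \<Rightarrow> ('v \<Rightarrow> 'v \<Rightarrow> 'f) \<Rightarrow> 'v list \<Rightarrow>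
    ('v \<times> 'v) list \<Rightarrow> ('v \<times> 'v) list \<Rightarrow> 'v list \<Rightarrow> bool"
  for scale \<gamma> R where
  Nil: "us \<in> set (subseqs R) \<Longrightarrow> isotropic_gen scale \<gamma> R [] [] us"
| skip: "isotropic_gen scale \<gamma> R ps qs us \<Longrightarrow> isotropic_gen scale \<gamma> R (p # ps) qs us"
| left: "isotropic_gen scale \<gamma> R ps qs us \<Longrightarrow> isotropic_gen scale \<gamma> R (p # ps) qs (fst p # us)"
| right: "isotropic_gen scale \<gamma> R ps qs us \<Longrightarrow> isotropic_gen scale \<gamma> R (p # ps) qs (snd p # us)"
| pair: "isotropic_gen scale \<gamma> R ps qs us \<Longrightarrow> isotropic_gen scale \<gamma> R (p # ps) (p # qs) us"
| exchange: "isotropic_gen scale \<gamma> R ps (q # qs) us \<Longrightarrow>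
    isotropic_gen scale \<gamma> R (p # ps) qs
      ((fst q + snd p + scale (\<gamma> (fst q + snd p) (fst p)) (fst p)) # (snd q + fst p) # us)"

context vector_space
begin

lemma isotropic_gen_span:
  assumes "isotropic_gen scale \<gamma> R ps qs us"
  shows "set (flat qs @ us) \<subseteq> span (set (flat ps @ R))"
proof -
  have V: "x \<in> span (set (flat ps @ R)) \<Longrightarrow> x \<in> span (set (flat (p # ps) @ R))"
    "fst p \<in> span (set (flat (p # ps) @ R))" "snd p \<in> span (set (flat (p # ps) @ R))" for ps p x
    by (auto intro: span_base subsetD[OF span_mono, rotated])
  show ?thesis
    using assms
  proof induction
    case (Nil us)
    then show ?case using subseqs_subset[of us R] span_superset by fastforce
  next
    case (exchange ps q qs us p)
    then show ?case by (auto intro!: span_add span_scale intro: V[simplified])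
  qed (auto intro: V[simplified])
qed

text \<open>The spanning counterpart of \<open>interpolate_complement_lists\<close>. Monomials
  containing e or f follow by induction with these vectors moved into \<open>pre\<close>. For the
  remaining ones the induction hypothesis has a higher index and asks for generators with one
  hyperbolic pair too many; the exchange rule turns that pair into monomials containing e or f,
  which are already known to lie in \<open>Y\<close>.\<close>

lemma wedge_mem_of_isotropic_gen:
  assumes Y: "ext.subspace Y" and "distinct (flat ps @ R)"
    and "\<And>qs us. isotropic_gen scale \<gamma> R ps qs us \<Longrightarrow> length qs < r \<Longrightarrow> length (flat qs @ us) = k \<Longrightarrow>
      wedge scale (pre @ flat qs @ us) \<in> Y"
    and "\<And>d. d \<in> complement_lists R ps r \<Longrightarrow> length d = k \<Longrightarrow> wedge scale (pre @ d) \<in> Y"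
    and "set ws \<subseteq> span (set (flat ps @ R))" "length ws = k"
  shows "wedge scale (pre @ ws) \<in> Y"
  using assms(2-)
proof (induction R ps r arbitrary: k pre ws rule: complement_lists.induct)
  case (1 R ps)
  show ?case
    using "1.prems"(3)[unfolded complement_lists.simps] "1.prems"(4,5) wedge_span_mem[OF Y "1.prems"(1)] by blast
next
  case (2 R r)
  have "wedge scale (pre @ d) \<in> Y" if "d \<in> set (subseqs (flat [] @ R))" "length d = k" for d
    using "2.prems"(2)[of "[]" d] isotropic_gen.Nil[of d R scale \<gamma>] that by simp
  then show ?case using "2.prems"(4,5) wedge_span_mem[OF Y "2.prems"(1)] by blast
next
  case (3 R p ps r)
  obtain e f where p: "p = (e, f)" by fastforce
  let ?V = "span (set (flat ps @ R))"
  have dist: "distinct (flat ps @ R)" using "3.prems"(1) by simp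
  note gens = "3.prems"(2) and cl = "3.prems"(3)
  have E: "wedge scale (pre @ e # us) \<in> Y" if "set us \<subseteq> ?V" "Suc (length us) = k" for us
  proof -
    have "wedge scale ((pre @ [e]) @ flat qs @ us) \<in> Y"
      if "isotropic_gen scale \<gamma> R ps qs us" "length qs < Suc r" "length (flat qs @ us) = k - 1" for qs us
    proof -
      have "wedge scale (pre @ flat qs @ (e # us)) \<in> Y"
        using gens[OF isotropic_gen.left[OF that(1), of p]] that \<open>Suc _ = k\<close> p by simp
      then show ?thesis by (rule wedge_perm_mem[OF Y]) simp
    qed
    moreover have "wedge scale ((pre @ [e]) @ d) \<in> Y" if "d \<in> complement_lists R ps (Suc r)" "length d = k - 1" for d
      using cl[of "e # d"] that \<open>Suc _ = k\<close> p by auto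
    moreover have "length us = k - 1" using that by simp
    ultimately have "wedge scale ((pre @ [e]) @ us) \<in> Y"
      using "3.IH"(2)[OF dist _ _ \<open>set us \<subseteq> _\<close>] by blast
    then show ?thesis by simp
  qed
  have F: "wedge scale (pre @ f # us) \<in> Y" if "set us \<subseteq> ?V" "Suc (length us) = k" for us
  proof -
    have "wedge scale ((pre @ [f]) @ flat qs @ us) \<in> Y"
      if "isotropic_gen scale \<gamma> R ps qs us" "length qs < Suc r" "length (flat qs @ us) = k - 1" for qs us
    proof -
      have "wedge scale (pre @ flat qs @ (f # us)) \<in> Y"
        using gens[OF isotropic_gen.right[OF that(1), of p]] that \<open>Suc _ = k\<close> p by simp
      then show ?thesis by (rule wedge_perm_mem[OF Y]) simp
    qed
    moreover have "wedge scale ((pre @ [f]) @ d) \<in> Y" if "d \<in> complement_lists R ps (Suc r)" "length d = k - 1" for d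
      using cl[of "f # d"] that \<open>Suc _ = k\<close> p by auto
    moreover have "length us = k - 1" using that by simp
    ultimately have "wedge scale ((pre @ [f]) @ us) \<in> Y"
      using "3.IH"(2)[OF dist _ _ \<open>set us \<subseteq> _\<close>] by blast
    then show ?thesis by simp
  qed
  have EF: "wedge scale (pre @ e # f # us) \<in> Y" if "set us \<subseteq> ?V" "Suc (Suc (length us)) = k" for us
  proof -
    have "wedge scale ((pre @ [e, f]) @ flat qs @ us) \<in> Y"
      if "isotropic_gen scale \<gamma> R ps qs us" "length qs < r" "length (flat qs @ us) = k - 2" for qs us
      using gens[OF isotropic_gen.pair[OF that(1), of p]] that \<open>Suc _ = k\<close> p by simp
    moreover have "wedge scale ((pre @ [e, f]) @ d) \<in> Y" if "d \<in> complement_lists R ps (r)" "length d = k - 2" for d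
      using cl[of "e # f # d"] that \<open>Suc _ = k\<close> p by auto
    moreover have "length us = k - 2" using that by simp
    ultimately have "wedge scale ((pre @ [e, f]) @ us) \<in> Y"
      using "3.IH"(4)[OF dist _ _ \<open>set us \<subseteq> _\<close>] by blast
    then show ?thesis by simp
  qed
  have V: "wedge scale (pre @ us) \<in> Y" if "set us \<subseteq> ?V" "length us = k" for us
  proof (rule "3.IH"(1)[OF dist _ _ that])
    show "wedge scale (pre @ d) \<in> Y" if "d \<in> complement_lists R ps (Suc (Suc r))" "length d = k" for d
      using cl[of d] that by simp
    fix qs us assume g: "isotropic_gen scale \<gamma> R ps qs us" "length qs < Suc (Suc r)" "length (flat qs @ us) = k"
    show "wedge scale (pre @ flat qs @ us) \<in> Y"
    proof (cases "length qs < Suc r")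
      case True
      then show ?thesis using gens[OF isotropic_gen.skip[OF g(1)]] g(3) by simp
    next
      case False
      \<comment> \<open>Exactly \<open>Suc r\<close> pairs remain. Exchanging \<open>q\<close>
        leaves r of them, so the assumption on generators applies, and every term of the expansion
        other than x \<and> y contains e or f.\<close>
      then obtain q qs' where qs: "qs = q # qs'" "length qs' = r" using g(2) by (cases qs) auto
      obtain x y where q: "q = (x, y)" by fastforce
      define Z where "Z = flat qs' @ us"
      define c where "c = \<gamma> (x + f) e"
      define w where "w u v = wedge scale (pre @ u # v # Z)" for u v
      have add1: "w (u + u') v = w u v + w u' v" for u u' v by (simp add: w_def wedge_add)
      have add2: "w u (v + v') = w u v + w u v'" for u v v'
        using wedge_add[of scale "pre @ [u]" v v' Z] by (simp add: w_def)
      have sc: "w (scale a u) v = ext_scale a (w u v)" for a u v by (simp add: w_def wedge_scale)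
      have sub: "set (x # y # Z) \<subseteq> ?V" using isotropic_gen_span[OF g(1)] by (simp add: qs q Z_def)
      have len: "Suc (Suc (length Z)) = k" using g(3) by (simp add: qs Z_def)
      have "w (x + f + scale c e) (y + e) \<in> Y"
        unfolding w_def
      proof (rule wedge_perm_mem[OF Y])
        show "wedge scale (pre @ flat qs' @ ((x + f + scale c e) # (y + e) # us)) \<in> Y"
          using gens[OF isotropic_gen.exchange[of scale \<gamma> R ps q qs' us p]] g(1,3) qs by (simp add: p q c_def)
      qed (simp add: Z_def)
      moreover have "w (x + f + scale c e) (y + e) = w x y + (w x e + w f y + w f e + ext_scale c (w e y))"
      proof -
        have "w e e = 0" unfolding w_def by (rule wedge_not_distinct) simp
        then show ?thesis by (simp add: add1 add2 sc)
      qed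
      moreover have "w x e \<in> Y"
        unfolding w_def by (rule wedge_perm_mem[OF Y E[of "x # Z"]]) (use sub len in auto)
      moreover have "w f y \<in> Y" "w e y \<in> Y"
        unfolding w_def using E[of "y # Z"] F[of "y # Z"] sub len by auto
      moreover have "w f e \<in> Y"
        unfolding w_def by (rule wedge_perm_mem[OF Y EF[of Z]]) (use sub len in auto)
      ultimately have "w x y + (w x e + w f y + w f e + ext_scale c (w e y)) \<in> Y"
          "w x e + w f y + w f e + ext_scale c (w e y) \<in> Y"
        using Y by (auto intro!: ext.subspace_add ext.subspace_scale)
      then have "w x y \<in> Y" using ext.subspace_diff[OF Y] by fastforce
      then show ?thesis by (simp add: w_def qs q Z_def)
    qed
  qed
  have "wedge scale (pre @ d) \<in> Y" if d: "d \<in> set (subseqs (flat (p # ps) @ R))" "length d = length ws" for d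
  proof -
    have sub: "d' \<in> set (subseqs (flat ps @ R)) \<Longrightarrow> set d' \<subseteq> ?V" for d'
      using subseqs_subset span_superset by blast
    consider d' where "d = d'" "d' \<in> set (subseqs (flat ps @ R))"
      | d' where "d = e # d'" "d' \<in> set (subseqs (flat ps @ R))"
      | d' where "d = f # d'" "d' \<in> set (subseqs (flat ps @ R))"
      | d' where "d = e # f # d'" "d' \<in> set (subseqs (flat ps @ R))"
      using d(1) unfolding p flat.simps append_Cons subseqs_Cons_set by auto
    then show ?thesis
      using d(2) "3.prems"(5) V E F EF sub by cases auto
  qed
  then show ?case using "3.prems"(4) wedge_span_mem[OF Y "3.prems"(1)] by blast
qed

end

section \<open>Dimension count for the isotropic span\<close>

text \<open>Evaluation at the dual forms \<open>A\<close> annihilates the span of \<open>S\<close>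
  and separates the vectors \<open>w d\<close>.\<close>

lemma independent_Un_image:
  fixes w :: "'a \<Rightarrow> ('v list \<Rightarrow> 'f::field) \<Rightarrow> 'f"
  assumes "finite D" "ext.independent S"
    and dual: "\<And>d. d \<in> D \<Longrightarrow> \<exists>A. (\<forall>b \<in> S. b A = 0) \<and> (\<forall>d' \<in> D. w d' A = (if d' = d then 1 else 0))"
  shows "ext.independent (S \<union> w ` D)" "inj_on w D" "S \<inter> w ` D = {}"
proof -
  show "inj_on w D"
  proof (rule inj_onI)
    fix d d' assume "d \<in> D" "d' \<in> D" "w d = w d'"
    moreover obtain A where "\<forall>d' \<in> D. w d' A = (if d' = d then 1 else 0)"
      using dual[OF \<open>d \<in> D\<close>] by blast
    ultimately show "d = d'" by (metis zero_neq_one)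
  qed
  show "S \<inter> w ` D = {}"
  proof (rule ccontr)
    assume "S \<inter> w ` D \<noteq> {}"
    then obtain d where d: "d \<in> D" "w d \<in> S" by blast
    then show False using dual[OF d(1)] by auto
  qed
  have "ext.independent (S \<union> w ` D')" if "D' \<subseteq> D" for D'
    using finite_subset[OF that assms(1)] that
  proof (induction D' rule: finite_induct)
    case (insert d D')
    then obtain A where A: "\<forall>b \<in> S. b A = 0" "\<forall>d' \<in> D. w d' A = (if d' = d then 1 else 0)"
      using dual[of d] by auto
    have "ext.subspace {u. u A = 0}"
      by (rule ext.subspaceI) (auto simp: ext_scale_def)
    moreover have "S \<union> w ` D' \<subseteq> {u. u A = 0}" using A insert by auto
    ultimately have "ext.span (S \<union> w ` D') \<subseteq> {u. u A = 0}" by (intro ext.span_minimal)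
    moreover have "w d A = 1" using A insert.prems by auto
    ultimately have "w d \<notin> ext.span (S \<union> w ` D')" by auto
    then show ?case using insert ext.independent_insertI[of "w d" "S \<union> w ` D'"] by simp
  qed (use assms(2) in simp)
  then show "ext.independent (S \<union> w ` D)" by blast
qed

definition coord :: "('f::field \<Rightarrow> 'v::ab_group_add \<Rightarrow> 'v) \<Rightarrow> 'v list \<Rightarrow> 'v \<Rightarrow> 'v \<Rightarrow> 'f" where
  "coord scale L v x = module.representation scale (set L) x v"

definition isotropic_span :: "('f::field \<Rightarrow> 'v::ab_group_add \<Rightarrow> 'v) \<Rightarrow> ('v \<Rightarrow> 'v \<Rightarrow> 'f) \<Rightarrow> nat \<Rightarrow>
    (('v list \<Rightarrow> 'f) \<Rightarrow> 'f) set" where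
  "isotropic_span scale B k =
     ext.span {wedge scale us | us. length us = k \<and> (\<forall>x \<in> set us. \<forall>y \<in> set us. B x y = 0)}"

context vector_space
begin

lemma functional_coord:
  assumes "independent (set L)" "span (set L) = UNIV"
  shows "functional scale (coord scale L v)"
  using assms representation_add[OF assms(1)] representation_scale[OF assms(1)]
  unfolding functional_def coord_def by (auto simp: fun_eq_iff)

lemma coord_basis:
  assumes "independent (set L)" "v \<in> set L" "w \<in> set L"
  shows "coord scale L v w = (if v = w then 1 else 0)"
  using representation_basis[OF assms(1,3)] by (simp add: coord_def)

lemma independent_wedge_subseqs:
  assumes L: "distinct L" "independent (set L)" "span (set L) = UNIV"
  shows "ext.independent (wedge scale ` {d \<in> set (subseqs L). length d = k})"
    and "inj_on (wedge scale) {d \<in> set (subseqs L). length d = k}"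
proof -
  let ?D = "{d \<in> set (subseqs L). length d = k}"
  have "\<exists>A. (\<forall>b \<in> {}. b A = 0) \<and> (\<forall>d' \<in> ?D. wedge scale d' A = (if d' = d then 1 else 0))" for d
  proof -
    obtain A where "alt_form scale A" "\<forall>d' \<in> set (subseqs L). A d' = (if d' = d then 1 else 0)"
      using interpolate_subseqs[of scale "coord scale L" L "{}" "\<lambda>d'. if d' = d then 1 else 0"]
        functional_coord[OF L(2,3)] coord_basis[OF L(2)] L(1) by auto
    then show ?thesis using alt_form_wedge[of scale A] by (intro exI[of _ A]) simp
  qed
  from independent_Un_image[of ?D "{}" "wedge scale", OF _ ext.independent_empty this]
  show "ext.independent (wedge scale ` ?D)" "inj_on (wedge scale) ?D" by auto
qed

lemma ext_power_subset:
  assumes "ext.subspace Y" "distinct L" "span (set L) = UNIV"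
    and "\<And>d. d \<in> set (subseqs L) \<Longrightarrow> length d = k \<Longrightarrow> wedge scale d \<in> Y"
  shows "ext_power scale k \<subseteq> Y"
  unfolding ext_power_def
proof (rule ext.span_minimal[OF _ assms(1)], safe)
  fix vs :: "'b list" assume "k = length vs"
  then show "wedge scale vs \<in> Y"
    using wedge_span_mem[OF assms(1,2), of vs "[]"] assms(3,4) by simp
qed

lemma ext_power_eq_span:
  assumes "distinct L" "span (set L) = UNIV"
  shows "ext_power scale k = ext.span (wedge scale ` {d \<in> set (subseqs L). length d = k})"
proof
  show "ext_power scale k \<subseteq> ext.span (wedge scale ` {d \<in> set (subseqs L). length d = k})"
    using assms by (intro ext_power_subset) (auto intro: ext.span_base)
  show "ext.span (wedge scale ` {d \<in> set (subseqs L). length d = k}) \<subseteq> ext_power scale k"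
    unfolding ext_power_def by (intro ext.span_mono) auto
qed

lemma dim_ext_power:
  assumes L: "distinct L" "independent (set L)" "span (set L) = UNIV"
  shows "ext.dim (ext_power scale k) = length L choose k"
  unfolding ext_power_eq_span[OF L(1,3)]
  using ext.dim_span_eq_card_independent[OF independent_wedge_subseqs(1)[OF L]]
    card_image[OF independent_wedge_subseqs(2)[OF L]] card_subseqs_length[OF L(1)] by simp

text \<open>A basis of \<open>S\<close> together with the complement monomials is a basis of the
  exterior power. Independence: forms in the ideal of positive divided powers vanish on isotropic
  lists, hence on \<open>S\<close>, and interpolate on the monomials. Spanning:
  \<open>wedge_mem_of_isotropic_gen\<close> with index 1. The subspace \<open>S\<close> is variable
  so that the count applies both to the singular and to the isotropic span.\<close>

lemma isotropic_span_complement: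
  assumes L: "distinct (flat ps @ R)" "independent (set (flat ps @ R))" "span (set (flat ps @ R)) = UNIV"
    and B: "\<And>x y. B x y = pairing (dual_pairs (coord scale (flat ps @ R)) ps) x y"
    and k: "k \<le> Suc (length ps)"
    and S: "ext.subspace S" "S \<subseteq> isotropic_span scale B k"
    and gens: "\<And>us. isotropic_gen scale \<gamma> R ps [] us \<Longrightarrow> length us = k \<Longrightarrow> wedge scale us \<in> S"
  shows "ext.dim S + (if 2 \<le> k then length (flat ps @ R) choose (k - 2) else 0) = length (flat ps @ R) choose k"
proof -
  let ?L = "flat ps @ R"
  let ?D = "{d \<in> complement_lists R ps 1. length d = k}"
  have finD: "finite ?D" by (rule finite_subset[OF _ finite_complement_lists[of R ps 1]]) auto
  have cardD: "card ?D = (if 2 \<le> k then length ?L choose (k - 2) else 0)"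
    using card_complement_lists[OF L(1), of k 1] k by simp
  obtain C where C: "C \<subseteq> S" "ext.independent C" "S \<subseteq> ext.span C" "card C = ext.dim S"
    using ext.basis_exists by blast
  have "\<exists>A. (\<forall>b \<in> C. b A = 0) \<and> (\<forall>d' \<in> ?D. wedge scale d' A = (if d' = d then 1 else 0))" for d
  proof -
    have "coord scale ?L v w = (if v = w then 1 else 0)" if "v \<in> set ?L" "w \<in> set ?L" for v w
      using coord_basis[OF L(2) that] .
    then obtain A where A: "A \<in> power_ideal scale (dual_pairs (coord scale ?L) ps) {} 1"
        "\<forall>d' \<in> complement_lists R ps 1. A d' = (if d' = d then 1 else 0)"
      using interpolate_complement_lists[of scale "coord scale ?L" ps R "{}" 1 "\<lambda>d'. if d' = d then 1 else 0"]
        functional_coord[OF L(2,3)] L(1) by auto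
    have alt: "alt_form scale A"
      by (rule power_ideal_alt_form[OF A(1)]) (auto simp: functional_coord[OF L(2,3)])
    have "ext.subspace {u. u A = 0}"
      by (rule ext.subspaceI) (auto simp: ext_scale_def)
    moreover have "A us = 0" if "\<forall>x \<in> set us. \<forall>y \<in> set us. B x y = 0" for us
      using A(1) that B unfolding One_nat_def by (intro power_ideal_isotropic[of A scale _ _ 0 us]) auto
    ultimately have "isotropic_span scale B k \<subseteq> {u. u A = 0}"
      unfolding isotropic_span_def by (intro ext.span_minimal) (auto simp: alt_form_wedge[OF alt])
    then have "\<forall>b \<in> C. b A = 0" using C(1) S(2) by blast
    then show ?thesis using A(2) alt_form_wedge[OF alt] by auto
  qed
  note ind = independent_Un_image[of ?D C "wedge scale", OF finD C(2) this]
  have iso: "isotropic_span scale B k \<subseteq> ext_power scale k"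
    unfolding isotropic_span_def ext_power_def by (rule ext.span_mono) auto
  have span: "ext.span (C \<union> wedge scale ` ?D) = ext_power scale k"
  proof
    show "ext.span (C \<union> wedge scale ` ?D) \<subseteq> ext_power scale k"
    proof (rule ext.span_minimal)
      show "C \<union> wedge scale ` ?D \<subseteq> ext_power scale k"
        using C(1) S(2) iso unfolding ext_power_def by (auto intro: ext.span_base)
      show "ext.subspace (ext_power scale k)" unfolding ext_power_def by (rule ext.subspace_span)
    qed
    have SC: "S \<subseteq> ext.span (C \<union> wedge scale ` ?D)" using C(3) ext.span_mono[of C] by blast
    have "wedge scale ([] @ d) \<in> ext.span (C \<union> wedge scale ` ?D)" if "length d = k" for d
    proof (rule wedge_mem_of_isotropic_gen[OF ext.subspace_span L(1)])
      fix qs us assume g: "isotropic_gen scale \<gamma> R ps qs us" "length qs < 1" "length (flat qs @ us) = k"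
      then have "wedge scale us \<in> S" using gens by simp
      then show "wedge scale ([] @ flat qs @ us) \<in> ext.span (C \<union> wedge scale ` ?D)"
        using SC g(2) by auto
    next
      fix d assume "d \<in> complement_lists R ps 1" "length d = k"
      then show "wedge scale ([] @ d) \<in> ext.span (C \<union> wedge scale ` ?D)"
        by (intro ext.span_base) simp
    qed (simp_all only: L(3) subset_UNIV that)
    then show "ext_power scale k \<subseteq> ext.span (C \<union> wedge scale ` ?D)"
      by (intro ext_power_subset[OF ext.subspace_span L(1,3)]) simp
  qed
  have "card (C \<union> wedge scale ` ?D) = length ?L choose k"
    using ext.dim_span_eq_card_independent[OF ind(1)] dim_ext_power[OF L] unfolding span by simp
  moreover have "finite (C \<union> wedge scale ` ?D)"
  proof -
    let ?M = "wedge scale ` {d \<in> set (subseqs ?L). length d = k}"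
    have "C \<union> wedge scale ` ?D \<subseteq> ext.span ?M"
      using span ext.span_superset ext_power_eq_span[OF L(1,3)] by metis
    then show ?thesis using ext.independent_span_bound[of ?M, OF _ ind(1)] by simp
  qed
  ultimately show ?thesis
    using C(4) cardD ind(2,3) finD by (simp add: card_Un_disjoint card_image)
qed

text \<open>\<open>S\<close> and the isotropic span itself both satisfy the assumptions of
  \<open>isotropic_span_complement\<close>. So they have the same finite dimension, and one contains
  the other.\<close>

lemma isotropic_span_eqI:
  assumes L: "distinct (flat ps @ R)" "independent (set (flat ps @ R))" "span (set (flat ps @ R)) = UNIV"
    and B: "\<And>x y. B x y = pairing (dual_pairs (coord scale (flat ps @ R)) ps) x y"
    and k: "k \<le> Suc (length ps)"
    and S: "ext.subspace S" "S \<subseteq> isotropic_span scale B k"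
    and gens: "\<And>us. isotropic_gen scale \<gamma> R ps [] us \<Longrightarrow> length us = k \<Longrightarrow> wedge scale us \<in> S"
  shows "S = isotropic_span scale B k"
proof
  show "isotropic_span scale B k \<subseteq> S"
  proof
    fix u assume u: "u \<in> isotropic_span scale B k"
    obtain C where C: "C \<subseteq> S" "ext.independent C" "S \<subseteq> ext.span C" "card C = ext.dim S"
      using ext.basis_exists by blast
    let ?M = "wedge scale ` {d \<in> set (subseqs (flat ps @ R)). length d = k}"
    obtain T where T: "T \<subseteq> isotropic_span scale B k" "ext.independent T" "isotropic_span scale B k \<subseteq> ext.span T"
        "card T = ext.dim (isotropic_span scale B k)"
      using ext.basis_exists by blast
    have "isotropic_span scale B k \<subseteq> ext_power scale k"
      unfolding isotropic_span_def ext_power_def by (rule ext.span_mono) auto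
    then have M: "isotropic_span scale B k \<subseteq> ext.span ?M" using ext_power_eq_span[OF L(1,3)] by metis
    have finT: "finite T"
      using ext.independent_span_bound[of ?M T] T M by auto
    have subsp: "ext.subspace (isotropic_span scale B k)" unfolding isotropic_span_def by (rule ext.subspace_span)
    have S_dim: "ext.dim S + (if 2 \<le> k then length (flat ps @ R) choose (k - 2) else 0) = length (flat ps @ R) choose k"
      by (rule isotropic_span_complement[OF L B k S]) (rule gens)
    have mem: "wedge scale us \<in> isotropic_span scale B k"
      if "isotropic_gen scale \<gamma> R ps [] us" "length us = k" for us
      using gens[OF that] S(2) by blast
    have "ext.dim (isotropic_span scale B k)
        + (if 2 \<le> k then length (flat ps @ R) choose (k - 2) else 0) = length (flat ps @ R) choose k"
      by (rule isotropic_span_complement[OF L B k subsp order_refl]) (rule mem)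
    then have "ext.dim (isotropic_span scale B k) = ext.dim S"
      using S_dim by linarith
    then have card: "card T = card C" using T(4) C(4) by simp
    have "u \<in> ext.span C"
    proof (rule ccontr)
      assume nu: "u \<notin> ext.span C"
      then have "ext.independent (insert u C)" using C(2) by (rule ext.independent_insertI)
      moreover have "insert u C \<subseteq> ext.span T"
        using subset_trans[OF subset_trans[OF C(1) S(2)] T(3)] subsetD[OF T(3) u] by simp
      ultimately have "finite (insert u C) \<and> card (insert u C) \<le> card T"
        by (rule ext.independent_span_bound[OF finT])
      moreover have "u \<notin> C" using nu ext.span_base by metis
      ultimately show False using card by auto
    qed
    then show "u \<in> S" using ext.span_minimal[OF C(1) S(1)] by blast
  qed
qed (rule S(2))

end

section \<open>Hyperbolic decompositions\<close>

text \<open>\<open>sing\<close> is the set of singular vectors. It is all of the isotropic vectors except for quadratic forms in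
  characteristic 2, where \<open>B\<close> is the bilinearization.\<close>

locale polar_form = finite_dimensional_vector_space scale Basis
  for scale :: "'f::field \<Rightarrow> 'v::ab_group_add \<Rightarrow> 'v" (infixr "*s" 75) and Basis :: "'v set" +
  fixes \<sigma> :: "'f \<Rightarrow> 'f" and \<epsilon> :: 'f and B :: "'v \<Rightarrow> 'v \<Rightarrow> 'f" and sing :: "'v \<Rightarrow> bool"
  assumes \<sigma>_add: "\<sigma> (a + b) = \<sigma> a + \<sigma> b" and \<sigma>_mult: "\<sigma> (a * b) = \<sigma> a * \<sigma> b"
    and \<sigma>_\<sigma> [simp]: "\<sigma> (\<sigma> a) = a"
    and B_add_left: "B (x + y) z = B x z + B y z" and B_scale_left: "B (c *s x) z = c * B x z"
    and B_swap: "B y x = \<epsilon> * \<sigma> (B x y)"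
    and sing_isotropic: "sing x \<Longrightarrow> B x x = 0"
    and sing_0: "sing 0" and sing_add: "sing x \<Longrightarrow> sing y \<Longrightarrow> B x y = 0 \<Longrightarrow> sing (x + y)"
    and sing_scale: "sing x \<Longrightarrow> sing (c *s x)"
    and sing_adjust: "sing e \<Longrightarrow> B e x \<noteq> 0 \<Longrightarrow> \<exists>c. sing (x + c *s e)"
begin

lemma \<sigma>_0 [simp]: "\<sigma> 0 = 0"
  using \<sigma>_add[of 0 0] by (metis add.right_neutral add_left_cancel)

lemma \<sigma>_1 [simp]: "\<sigma> 1 = 1"
proof -
  have "\<sigma> 1 * \<sigma> 1 = \<sigma> 1" using \<sigma>_mult[of 1 1] by simp
  moreover have "\<sigma> 1 \<noteq> 0" using \<sigma>_\<sigma>[of 1] \<sigma>_0 by (metis zero_neq_one)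
  ultimately show ?thesis by simp
qed

lemma \<sigma>_neg: "\<sigma> (- a) = - \<sigma> a"
  using \<sigma>_add[of a "- a"] by (simp add: eq_neg_iff_add_eq_0 add.commute)

lemma B_add_right: "B x (y + z) = B x y + B x z"
  by (subst (1 2 3) B_swap) (simp add: B_add_left \<sigma>_add algebra_simps)

lemma B_scale_right: "B x (c *s y) = \<sigma> c * B x y"
  by (subst (1 2) B_swap) (simp add: B_scale_left \<sigma>_mult algebra_simps)

lemma B_0_left [simp]: "B 0 x = 0" and B_0_right [simp]: "B x 0 = 0"
  using B_scale_left[of 0 0 x] B_scale_right[of x 0 0] by auto

lemma B_diff_left: "B (x - y) z = B x z - B y z"
  using B_add_left[of "x - y" y z] by (simp add: algebra_simps)

lemma B_diff_right: "B z (x - y) = B z x - B z y"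
  using B_add_right[of z "x - y" y] by (simp add: algebra_simps)

lemmas B_simps = B_add_left B_add_right B_scale_left B_scale_right B_diff_left B_diff_right

lemma orth_sym: "B x y = 0 \<Longrightarrow> B y x = 0"
  by (simp add: B_swap[of y x])

lemma subspace_orth: "subspace {u. B u x = 0}" "subspace {u. B x u = 0}"
  by (auto intro!: subspaceI simp: B_simps)

lemma orth_span_right:
  assumes "y \<in> span S" "\<And>s. s \<in> S \<Longrightarrow> B x s = 0"
  shows "B x y = 0"
  using span_minimal[OF _ subspace_orth(2)[of x], of S] assms by auto

lemma orth_span_left:
  assumes "y \<in> span S" "\<And>s. s \<in> S \<Longrightarrow> B s x = 0"
  shows "B y x = 0"
  using span_minimal[OF _ subspace_orth(1)[of x], of S] assms by auto

lemma sing_add_scale: "sing x \<Longrightarrow> sing y \<Longrightarrow> B x y = 0 \<Longrightarrow> sing (x + c *s y)"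
  by (intro sing_add sing_scale) (simp_all add: B_scale_right)

lemma normalize_right: "B x y \<noteq> 0 \<Longrightarrow> \<exists>c. B x (c *s y) = 1"
  by (rule exI[of _ "\<sigma> (inverse (B x y))"]) (simp add: B_scale_right)

text \<open>The members of the pairs are isotropic for \<open>B\<close> but need not satisfy
  \<open>sing\<close>. The single vectors are mutually orthogonal with arbitrary
  \<open>B r r\<close>, so they include anisotropic vectors as well as vectors of the radical of
  \<open>B\<close>.\<close>

primrec hyperbolic_system :: "('v \<times> 'v) list \<Rightarrow> 'v list \<Rightarrow> bool" where
  "hyperbolic_system [] rs \<longleftrightarrow> sorted_wrt (\<lambda>x y. B x y = 0) rs"
| "hyperbolic_system (p # ps) rs \<longleftrightarrow> B (fst p) (fst p) = 0 \<and> B (snd p) (snd p) = 0 \<and> B (fst p) (snd p) = 1 \<and>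
     (\<forall>x \<in> set (flat ps @ rs). B (fst p) x = 0 \<and> B (snd p) x = 0) \<and> hyperbolic_system ps rs"

lemma hyperbolic_system_Cons_right:
  "hyperbolic_system ps (x # rs) \<longleftrightarrow> hyperbolic_system ps rs \<and> (\<forall>y \<in> set (flat ps @ rs). B x y = 0)"
  by (induction ps) (auto dest: orth_sym)

lemma hyperbolic_system_middle: "hyperbolic_system (qs @ p # fs) rs \<longleftrightarrow> hyperbolic_system (p # qs @ fs) rs"
  by (induction qs) (auto dest: orth_sym)

lemma hyperbolic_system_right:
  assumes "hyperbolic_system ps []" "sorted_wrt (\<lambda>x y. B x y = 0) rs"
    and "\<And>x r. x \<in> set (flat ps) \<Longrightarrow> r \<in> set rs \<Longrightarrow> B r x = 0"
  shows "hyperbolic_system ps rs"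
  using assms(2,3)
proof (induction rs)
  case Nil
  then show ?case using assms(1) by simp
next
  case (Cons r rs)
  then show ?case by (auto simp: hyperbolic_system_Cons_right)
qed

lemma hyperbolic_system_independent:
  assumes "hyperbolic_system ps rs" "distinct rs" "independent (set rs)"
  shows "distinct (flat ps @ rs) \<and> independent (set (flat ps @ rs))"
  using assms(1)
proof (induction ps)
  case Nil
  then show ?case using assms by simp
next
  case (Cons p ps)
  obtain e f where p: "p = (e, f)" by fastforce
  let ?S = "set (flat ps @ rs)"
  have ef: "B e e = 0" "B f f = 0" "B e f = 1" "\<And>x. x \<in> ?S \<Longrightarrow> B e x = 0 \<and> B f x = 0"
    and IH: "distinct (flat ps @ rs)" "independent ?S"
    using Cons p by auto
  have f: "f \<notin> span ?S" using orth_span_right[of f ?S e] ef by auto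
  have e: "e \<notin> span (insert f ?S)"
  proof
    assume "e \<in> span (insert f ?S)"
    then have "B f e = 0" using ef by (intro orth_span_right[of e "insert f ?S"]) auto
    then show False using orth_sym[of f e] ef by simp
  qed
  have "independent (insert e (insert f ?S))"
    using e f IH by (intro independent_insertI) auto
  moreover have "f \<notin> ?S" "e \<notin> insert f ?S" using e f span_base by metis+
  ultimately show ?case using IH by (simp add: p)
qed

lemma hyperbolic_projection:
  assumes "B e e = 0" "B f f = 0" "B e f = 1" "subspace U" "e \<in> U" "f \<in> U" "u \<in> U"
  shows "\<exists>a b u'. u = u' + a *s e + b *s f \<and> u' \<in> {u \<in> U. B u e = 0 \<and> B u f = 0}"
proof -
  have fe: "B f e \<noteq> 0" using orth_sym[of f e] assms(3) by auto
  let ?u = "u - B u f *s e - (B u e / B f e) *s f"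
  have "B ?u e = 0" "B ?u f = 0" using assms fe by (simp_all add: B_simps)
  moreover have "?u \<in> U" using assms by (intro subspace_diff subspace_scale)
  ultimately show ?thesis
    by (intro exI[of _ "B u f"] exI[of _ "B u e / B f e"] exI[of _ ?u]) (simp add: algebra_simps)
qed

lemma subspace_orth_pair:
  "subspace U \<Longrightarrow> subspace {u \<in> U. B u e = 0 \<and> B u f = 0}"
  by (auto intro!: subspaceI simp: B_simps subspace_0 subspace_add subspace_scale)

lemma hyperbolic_system_extend:
  assumes ef: "B e e = 0" "B f f = 0" "B e f = 1" and U: "subspace U" "e \<in> U" "f \<in> U"
    and "hyperbolic_system ps rs" "set (flat ps @ rs) \<subseteq> {u \<in> U. B u e = 0 \<and> B u f = 0}"
    and "{u \<in> U. B u e = 0 \<and> B u f = 0} \<subseteq> span (set (flat ps @ rs))"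
  shows "hyperbolic_system ((e, f) # ps) rs" "set (flat ((e, f) # ps) @ rs) \<subseteq> U"
    "U \<subseteq> span (set (flat ((e, f) # ps) @ rs))"
proof -
  show "hyperbolic_system ((e, f) # ps) rs" "set (flat ((e, f) # ps) @ rs) \<subseteq> U"
    using assms orth_sym by auto
  show "U \<subseteq> span (set (flat ((e, f) # ps) @ rs))"
  proof
    fix u assume "u \<in> U"
    then obtain a b u' where u: "u = u' + a *s e + b *s f" "u' \<in> {u \<in> U. B u e = 0 \<and> B u f = 0}"
      using hyperbolic_projection[OF ef U] by blast
    have "span (set (flat ps @ rs)) \<subseteq> span (set (flat ((e, f) # ps) @ rs))" by (rule span_mono) auto
    then have "u' \<in> span (set (flat ((e, f) # ps) @ rs))" using u(2) assms(9) by blast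
    then show "u \<in> span (set (flat ((e, f) # ps) @ rs))"
      unfolding u(1) by (intro span_add span_scale) (auto intro: span_base)
  qed
qed

text \<open>Induction on the dimension: a non-isotropic vector is split off as a single vector; if
  all vectors are isotropic, two non-orthogonal ones give a hyperbolic pair; if \<open>B\<close>
  vanishes on \<open>U\<close>, any basis serves. Independence is recorded for \<open>rs\<close>
  only, since the pairs add it automatically (\<open>hyperbolic_system_independent\<close>).\<close>

lemma exists_hyperbolic_system:
  "subspace U \<Longrightarrow> \<exists>ps rs. hyperbolic_system ps rs \<and> set (flat ps @ rs) \<subseteq> U \<and> U \<subseteq> span (set (flat ps @ rs)) \<and>
     distinct rs \<and> independent (set rs)"
proof (induction "dim U" arbitrary: U rule: less_induct)
  case less
  have smaller: "dim U' < dim U" if "subspace U'" "U' \<subseteq> U" "x \<in> U" "x \<notin> U'" for U' x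
    using that less.prems by (intro dim_psubset) (auto simp: span_eq_iff[THEN iffD2])
  consider x where "x \<in> U" "B x x \<noteq> 0"
    | x y where "\<forall>u \<in> U. B u u = 0" "x \<in> U" "y \<in> U" "B x y \<noteq> 0"
    | "\<forall>x \<in> U. \<forall>y \<in> U. B x y = 0" by blast
  then show ?case
  proof cases
    case 1
    let ?U = "{u \<in> U. B u x = 0}"
    have sub: "subspace ?U"
      using less.prems by (auto intro!: subspaceI simp: B_simps subspace_0 subspace_add subspace_scale)
    obtain ps rs where IH: "hyperbolic_system ps rs" "set (flat ps @ rs) \<subseteq> ?U" "?U \<subseteq> span (set (flat ps @ rs))"
        "distinct rs" "independent (set rs)"
      using less.hyps[OF smaller[OF sub _ 1(1)] sub] 1 by auto
    have "span (set rs) \<subseteq> ?U" using IH(2) sub by (intro span_minimal) auto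
    then have x: "x \<notin> span (set rs)" using 1 by auto
    have "U \<subseteq> span (set (flat ps @ x # rs))"
    proof
      fix u assume u: "u \<in> U"
      let ?c = "B u x / B x x"
      have "u - ?c *s x \<in> ?U"
        using u 1 less.prems by (auto simp: B_simps intro: subspace_diff subspace_scale)
      moreover have "span (set (flat ps @ rs)) \<subseteq> span (set (flat ps @ x # rs))" by (rule span_mono) auto
      ultimately have "u - ?c *s x \<in> span (set (flat ps @ x # rs))" using IH(3) by blast
      then have "(u - ?c *s x) + ?c *s x \<in> span (set (flat ps @ x # rs))"
        by (intro span_add span_scale) (auto intro: span_base)
      then show "u \<in> span (set (flat ps @ x # rs))" by simp
    qed
    moreover have "hyperbolic_system ps (x # rs)" using IH(1,2) orth_sym by (auto simp: hyperbolic_system_Cons_right)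
    moreover have "distinct (x # rs)" "independent (set (x # rs))"
      using IH(4) x independent_insertI[OF x IH(5)] by (auto intro: span_base)
    ultimately show ?thesis using IH(2) 1(1) by (intro exI[of _ ps] exI[of _ "x # rs"]) auto
  next
    case 2
    then obtain c where c: "B x (c *s y) = 1" using normalize_right by blast
    define f where "f = c *s y"
    have xf: "B x x = 0" "B f f = 0" "B x f = 1" "f \<in> U"
      using 2 c less.prems by (auto simp: f_def subspace_scale)
    let ?U = "{u \<in> U. B u x = 0 \<and> B u f = 0}"
    have sub: "subspace ?U" by (rule subspace_orth_pair[OF less.prems])
    obtain ps rs where IH: "hyperbolic_system ps rs" "set (flat ps @ rs) \<subseteq> ?U" "?U \<subseteq> span (set (flat ps @ rs))"
        "distinct rs" "independent (set rs)"
      using less.hyps[OF smaller[OF sub _ 2(2)] sub] xf by auto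
    show ?thesis
      by (rule exI[of _ "(x, f) # ps"], rule exI[of _ rs])
        (intro conjI IH(4,5) hyperbolic_system_extend[OF xf(1-3) less.prems 2(2) xf(4) IH(1-3)])
  next
    case 3
    obtain C where C: "C \<subseteq> U" "independent C" "U \<subseteq> span C" "card C = dim U"
      by (rule basis_exists[of U])
    obtain rs where rs: "set rs = C" "distinct rs"
      using finite_distinct_list finiteI_independent[OF C(2)] by blast
    have "sorted_wrt (\<lambda>x y. B x y = 0) rs"
      using 3 C(1) rs(1) by (intro sorted_wrtI) auto
    then show ?thesis using rs C by (intro exI[of _ "[]"] exI[of _ rs]) auto
  qed
qed

text \<open>A vector e of \<open>E\<close> outside \<open>T\<close> is not orthogonal to
  \<open>U\<close>, and a non-orthogonal partner can be made singular by adding a multiple of e.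
  Restricting \<open>E\<close> to the vectors orthogonal to this partner f lowers the dimension by
  at most one. The condition on \<open>T\<close> survives the restriction: vectors of the smaller
  \<open>E\<close> are orthogonal to e and f, so orthogonality to the smaller \<open>U\<close> means
  orthogonality to \<open>U\<close>. In the application \<open>T\<close> is the radical.\<close>

lemma exists_singular_hyperbolic_system:
  assumes "subspace U" "subspace E" "E \<subseteq> U" "\<And>x. x \<in> E \<Longrightarrow> sing x"
    and "\<And>x y. x \<in> E \<Longrightarrow> y \<in> E \<Longrightarrow> B x y = 0"
    and "\<And>x. x \<in> E \<Longrightarrow> (\<And>u. u \<in> U \<Longrightarrow> B x u = 0) \<Longrightarrow> x \<in> T"
    and "n + dim T \<le> dim E"
  shows "\<exists>ss ns rs. length ss = n \<and> (\<forall>p \<in> set ss. sing (fst p) \<and> sing (snd p)) \<and> hyperbolic_system (ss @ ns) rs \<and>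
    set (flat (ss @ ns) @ rs) \<subseteq> U \<and> U \<subseteq> span (set (flat (ss @ ns) @ rs)) \<and>
    distinct rs \<and> independent (set rs)"
  using assms
proof (induction n arbitrary: U E)
  case 0
  then obtain ps rs where "hyperbolic_system ps rs" "set (flat ps @ rs) \<subseteq> U" "U \<subseteq> span (set (flat ps @ rs))"
      "distinct rs" "independent (set rs)"
    using exists_hyperbolic_system by blast
  then show ?case by (intro exI[of _ "[]"] exI[of _ ps] exI[of _ rs]) auto
next
  case (Suc n)
  have "\<not> E \<subseteq> T" using dim_subset[of E T] Suc.prems(7) by auto
  then obtain e where e: "e \<in> E" "e \<notin> T" by blast
  then obtain u where u: "u \<in> U" "B e u \<noteq> 0" using Suc.prems(6) by blast
  obtain a where a: "B e (a *s u) = 1" using normalize_right[OF u(2)] by blast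
  obtain c where c: "sing (a *s u + c *s e)" using sing_adjust[of e "a *s u"] Suc.prems(4) e a by auto
  define f where "f = a *s u + c *s e"
  have eU: "e \<in> U" using e Suc.prems(3) by blast
  have ee: "B e e = 0" using Suc.prems(4) e sing_isotropic by blast
  have ef: "B e e = 0" "B f f = 0" "B e f = 1" "f \<in> U"
    using ee sing_isotropic[OF c] a Suc.prems(1) u eU
    by (simp_all add: f_def B_add_right[of e] B_scale_right[of e] subspace_add subspace_scale)
  let ?U = "{u \<in> U. B u e = 0 \<and> B u f = 0}" and ?E = "{x \<in> E. B x f = 0}"
  have "\<exists>ss ns rs. length ss = n \<and> (\<forall>p \<in> set ss. sing (fst p) \<and> sing (snd p)) \<and> hyperbolic_system (ss @ ns) rs \<and>
    set (flat (ss @ ns) @ rs) \<subseteq> ?U \<and> ?U \<subseteq> span (set (flat (ss @ ns) @ rs)) \<and>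
    distinct rs \<and> independent (set rs)"
  proof (rule Suc.IH)
    show "subspace ?U" by (rule subspace_orth_pair[OF Suc.prems(1)])
    show "subspace ?E"
      using Suc.prems(2) by (auto intro!: subspaceI simp: B_simps subspace_0 subspace_add subspace_scale)
    show "?E \<subseteq> ?U" using Suc.prems(3,5) e(1) by auto
    show "x \<in> T" if x: "x \<in> ?E" and orth: "\<And>u. u \<in> ?U \<Longrightarrow> B x u = 0" for x
    proof (rule Suc.prems(6))
      fix u assume "u \<in> U"
      then obtain a b u' where u: "u = u' + a *s e + b *s f" "u' \<in> ?U"
        using hyperbolic_projection[OF ef(1-3) Suc.prems(1) eU ef(4)] by blast
      have "B x e = 0" "B x f = 0" using x e(1) Suc.prems(5) by auto
      then show "B x u = 0" using orth[OF u(2)] by (simp add: u(1) B_simps)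
    qed (use x in simp)
    have "E \<subseteq> span (insert e ?E)"
    proof
      fix x assume x: "x \<in> E"
      have "x - B x f *s e \<in> ?E"
        using x e(1) ef Suc.prems(2) by (auto simp: B_simps intro: subspace_diff subspace_scale)
      then have "x - B x f *s e \<in> span ?E" by (rule span_base)
      then show "x \<in> span (insert e ?E)" unfolding span_breakdown_eq by (rule exI)
    qed
    then have "dim E \<le> dim ?E + 1"
      using dim_mono[of E "insert e ?E"] dim_insert[of e ?E] by (simp split: if_splits)
    then show "n + dim T \<le> dim ?E" using Suc.prems(7) by simp
  qed (use Suc.prems in auto)
  then obtain ss ns rs where IH: "length ss = n" "\<forall>p \<in> set ss. sing (fst p) \<and> sing (snd p)"
      "hyperbolic_system (ss @ ns) rs" "set (flat (ss @ ns) @ rs) \<subseteq> ?U" "?U \<subseteq> span (set (flat (ss @ ns) @ rs))"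
      "distinct rs" "independent (set rs)" by blast
  note ext = hyperbolic_system_extend[OF ef(1-3) Suc.prems(1) eU ef(4) IH(3-5)]
  show ?case
    using IH(1,2,6,7) ext c Suc.prems(4) e(1)
    by (intro exI[of _ "(e, f) # ss"] exI[of _ ns] exI[of _ rs]) (auto simp: f_def)
qed

section \<open>The span of singular monomials and the non-symplectic case\<close>

definition singular_span :: "nat \<Rightarrow> (('v list \<Rightarrow> 'f) \<Rightarrow> 'f) set" where
  "singular_span k = ext.span {wedge scale us | us. length us = k \<and>
     (\<forall>x \<in> set us. sing x \<and> (\<forall>y \<in> set us. B x y = 0))}"

lemma subspace_singular_span: "ext.subspace (singular_span k)"
  unfolding singular_span_def by (rule ext.subspace_span)

lemma wedge_mem_singular_span:
  "(\<And>x. x \<in> set us \<Longrightarrow> sing x) \<Longrightarrow> (\<And>x y. x \<in> set us \<Longrightarrow> y \<in> set us \<Longrightarrow> B x y = 0) \<Longrightarrow>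
     length us = k \<Longrightarrow> wedge scale us \<in> singular_span k"
  unfolding singular_span_def by (rule ext.span_base) blast

lemma singular_span_subset_ext_power: "singular_span k \<subseteq> ext_power scale k"
  unfolding singular_span_def ext_power_def by (rule ext.span_mono) auto

text \<open>Dependent lists have wedge product 0, so bases of totally singular subspaces may be
  replaced by arbitrary lists of mutually orthogonal singular vectors. The exchange arguments then
  never have to check independence.\<close>

lemma grassmann_span_eq:
  assumes ts: "\<And>X. subspace X \<Longrightarrow> totally_singular \<eta> X \<longleftrightarrow> (\<forall>x \<in> X. sing x \<and> (\<forall>y \<in> X. B x y = 0))"
  shows "grassmann_span scale \<eta> k = singular_span k"
proof
  show "grassmann_span scale \<eta> k \<subseteq> singular_span k"
    unfolding grassmann_span_def
  proof (rule ext.span_minimal[OF _ subspace_singular_span], rule UN_least)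
    fix X assume "X \<in> polar_grassmannian scale \<eta> k"
    then have X: "\<forall>x \<in> X. sing x \<and> (\<forall>y \<in> X. B x y = 0)"
      using ts[of X] unfolding polar_grassmannian_def by blast
    show "grassmann_embedding scale k X \<subseteq> singular_span k"
      unfolding grassmann_embedding_def
    proof (rule ext.span_minimal[OF _ subspace_singular_span], safe)
      fix vs assume vs: "k = length vs" "is_basis_list scale vs X"
      then have "set vs \<subseteq> X" using span_superset by (auto simp: is_basis_list_def)
      then show "wedge scale vs \<in> singular_span (length vs)"
        using X by (intro wedge_mem_singular_span) auto
    qed
  qed
  show "singular_span k \<subseteq> grassmann_span scale \<eta> k"
    unfolding singular_span_def
  proof (rule ext.span_minimal)
    show "ext.subspace (grassmann_span scale \<eta> k)"
      unfolding grassmann_span_def by (rule ext.subspace_span)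
    show "{wedge scale us | us. length us = k \<and> (\<forall>x \<in> set us. sing x \<and> (\<forall>y \<in> set us. B x y = 0))}
        \<subseteq> grassmann_span scale \<eta> k"
    proof safe
      fix us assume us: "k = length us" "\<forall>x \<in> set us. sing x \<and> (\<forall>y \<in> set us. B x y = 0)"
      show "wedge scale us \<in> grassmann_span scale \<eta> (length us)"
      proof (cases "distinct us \<and> independent (set us)")
        case True
        let ?X = "span (set us)"
        have orth: "B x y = 0" if "x \<in> ?X" "y \<in> ?X" for x y
        proof (rule orth_span_left[OF that(1)])
          fix s assume "s \<in> set us"
          then show "B s y = 0" using us(2) by (intro orth_span_right[OF that(2)]) auto
        qed
        have "x \<in> ?X \<and> sing x" if "x \<in> ?X" for x
          using that
        proof (induction rule: span_induct_alt)
          case base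
          show ?case by (simp add: sing_0 span_zero)
        next
          case (step c x y)
          have "sing (c *s x)" using step us(2) sing_scale by blast
          moreover have "c *s x \<in> ?X" using step by (intro span_scale span_base)
          ultimately show ?case using step orth by (auto intro: sing_add span_add)
        qed
        then have "?X \<in> polar_grassmannian scale \<eta> k"
          using ts[of ?X] orth us(1) True dim_span_eq_card_independent[of "set us"]
          by (auto simp: polar_grassmannian_def distinct_card)
        moreover have "wedge scale us \<in> grassmann_embedding scale k ?X"
          unfolding grassmann_embedding_def using True us(1)
          by (intro ext.span_base) (auto simp: is_basis_list_def)
        ultimately show ?thesis unfolding grassmann_span_def us(1) by (intro ext.span_base) auto
      next
        case False
        then have "wedge scale us = 0" using wedge_dependent wedge_not_distinct by blast
        then show ?thesis unfolding grassmann_span_def by (simp add: ext.span_zero)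
      qed
    qed
  qed
qed

text \<open>Every vector of \<open>vs\<close> needs a pair of its own: its singular replacement is
  not orthogonal to both e and f, but it is orthogonal to the remaining pairs and can therefore join
  \<open>us\<close>.\<close>

lemma wedge_mem_singular_span_free:
  assumes "hyperbolic_system fs vs" "\<And>p. p \<in> set fs \<Longrightarrow> sing (fst p) \<and> sing (snd p)" "length vs \<le> length fs"
    and "\<And>x. x \<in> set us \<Longrightarrow> sing x" "\<And>x y. x \<in> set us \<Longrightarrow> y \<in> set us \<Longrightarrow> B x y = 0"
    and "\<And>x y. x \<in> set us \<Longrightarrow> y \<in> set (flat fs @ vs) \<Longrightarrow> B x y = 0"
  shows "wedge scale (vs @ us) \<in> singular_span (length vs + length us)"
  using assms
proof (induction vs arbitrary: us fs)
  case Nil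
  then show ?case by (simp add: wedge_mem_singular_span)
next
  case (Cons v vs)
  then obtain e f fs' where fs: "fs = (e, f) # fs'" by (cases fs) auto
  let ?Y = "singular_span (length (v # vs) + length us)"
  have blk: "hyperbolic_system fs' vs" and v: "\<And>y. y \<in> set (flat fs @ vs) \<Longrightarrow> B v y = 0"
    using Cons.prems(1) by (auto simp: hyperbolic_system_Cons_right fs)
  have ef: "B e e = 0" "B f f = 0" "B e f = 1" "B f e \<noteq> 0" "sing e" "sing f"
    "\<And>y. y \<in> set (flat fs' @ v # vs) \<Longrightarrow> B e y = 0 \<and> B f y = 0"
    using Cons.prems(1) Cons.prems(2)[of "(e, f)"] orth_sym[of f e] by (auto simp: fs)
  \<comment> \<open>Adding e is what makes the vector non-orthogonal to f, so that a multiple of f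
    can correct it to a singular one.\<close>
  have "B f (v + e) \<noteq> 0" using ef by (simp add: B_simps)
  then obtain c where c: "sing (v + e + c *s f)" using sing_adjust[OF ef(6)] by blast
  define z where "z = v + e + c *s f"
  have step: "wedge scale (x # vs @ us) \<in> ?Y"
    if "sing x" "\<And>y. y \<in> set (flat fs' @ vs @ us) \<Longrightarrow> B x y = 0" for x
  proof (rule wedge_perm_mem[OF subspace_singular_span])
    have "wedge scale (vs @ x # us) \<in> singular_span (length vs + length (x # us))"
    proof (rule Cons.IH[OF blk])
      show "B x' y = 0" if "x' \<in> set (x # us)" "y \<in> set (x # us)" for x' y
        using that \<open>sing x\<close> sing_isotropic Cons.prems(5) \<open>\<And>y. y \<in> _ \<Longrightarrow> B x y = 0\<close>
        by (auto intro: orth_sym[of x])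
      show "B x' y = 0" if "x' \<in> set (x # us)" "y \<in> set (flat fs' @ vs)" for x' y
        using that Cons.prems(6) \<open>\<And>y. y \<in> _ \<Longrightarrow> B x y = 0\<close> by (auto simp: fs)
    qed (use Cons.prems \<open>sing x\<close> in \<open>auto simp: fs\<close>)
    then show "wedge scale (vs @ x # us) \<in> ?Y" by simp
  qed simp
  have us: "B v y = 0 \<and> B e y = 0 \<and> B f y = 0" if "y \<in> set us" for y
    using Cons.prems(6)[OF that] orth_sym by (simp add: fs)
  have "wedge scale (z # vs @ us) \<in> ?Y"
    using c v ef(7) us by (intro step) (auto simp: z_def B_simps fs)
  moreover have "wedge scale (e # vs @ us) \<in> ?Y" "wedge scale (f # vs @ us) \<in> ?Y"
    using ef us by (intro step; auto)+
  moreover have "wedge scale (z # vs @ us) =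
      wedge scale (v # vs @ us) + (wedge scale (e # vs @ us) + ext_scale c (wedge scale (f # vs @ us)))"
    using wedge_add[of scale "[]" _ _ "vs @ us"] wedge_scale[of scale "[]" _ _ "vs @ us"] by (simp add: z_def)
  ultimately have "wedge scale (v # vs @ us) + (wedge scale (e # vs @ us) + ext_scale c (wedge scale (f # vs @ us))) \<in> ?Y"
    "wedge scale (e # vs @ us) + ext_scale c (wedge scale (f # vs @ us)) \<in> ?Y"
    by (auto intro!: ext.subspace_add ext.subspace_scale subspace_singular_span)
  then have "wedge scale (v # vs @ us) \<in> ?Y"
    using ext.subspace_diff[OF subspace_singular_span] by fastforce
  then show ?case by simp
qed

text \<open>Each pair (a, b) of \<open>qs\<close> is removed with the help of one free singular pair
  (e, f). By induction all wedges of two orthogonal singular vectors from the span of a, b, e, f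
  give elements of the singular span, and the relations among them isolate a \<and> b. The free pair
  is used up, so \<open>fs\<close> has to cover \<open>qs\<close> and \<open>vs\<close>
  together.\<close>

lemma wedge_pair_mem_singular_span:
  assumes nsymp: "\<sigma> \<noteq> id \<or> \<epsilon> \<noteq> - 1"
    and "hyperbolic_system (qs @ fs) vs" "\<And>p. p \<in> set (qs @ fs) \<Longrightarrow> sing (fst p) \<and> sing (snd p)"
    and "length qs + length vs \<le> length fs"
    and "\<And>x. x \<in> set us \<Longrightarrow> sing x" "\<And>x y. x \<in> set us \<Longrightarrow> y \<in> set us \<Longrightarrow> B x y = 0"
    and "\<And>x y. x \<in> set us \<Longrightarrow> y \<in> set (flat (qs @ fs) @ vs) \<Longrightarrow> B x y = 0"
  shows "wedge scale (flat qs @ vs @ us) \<in> singular_span (length (flat qs @ vs @ us))"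
  using assms(2-)
proof (induction qs arbitrary: us fs)
  case Nil
  then show ?case using wedge_mem_singular_span_free[of fs vs us] by simp
next
  case (Cons q qs)
  obtain a b where q: "q = (a, b)" by fastforce
  obtain e f fs' where fs: "fs = (e, f) # fs'" using Cons.prems(3) by (cases fs) auto
  let ?Z = "flat qs @ vs @ us"
  let ?Y = "singular_span (Suc (Suc (length ?Z)))"
  have "hyperbolic_system ((e, f) # qs @ fs') vs"
    using Cons.prems(1) by (simp add: fs hyperbolic_system_middle del: hyperbolic_system.simps(2)) (simp add: hyperbolic_system_middle)
  then have blk: "hyperbolic_system (qs @ fs') vs" and ef: "B e e = 0" "B f f = 0" "B e f = 1"
    "\<And>y. y \<in> set (flat (qs @ fs') @ vs) \<Longrightarrow> B e y = 0 \<and> B f y = 0"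
    by auto
  have ab: "B a a = 0" "B b b = 0" "B a b = 1"
    "\<And>y. y \<in> set (flat (qs @ fs') @ vs) \<union> {e, f} \<Longrightarrow> B a y = 0 \<and> B b y = 0"
    using Cons.prems(1) by (auto simp: q fs)
  have s: "sing a" "sing b" "sing e" "sing f"
    using Cons.prems(2)[of q] Cons.prems(2)[of "(e, f)"] by (auto simp: q fs)
  have us: "B a y = 0 \<and> B b y = 0 \<and> B e y = 0 \<and> B f y = 0" if "y \<in> set us" for y
    using Cons.prems(6)[OF that] orth_sym by (simp add: q fs)
  have x0: "B e a = 0" "B f a = 0" "B e b = 0" "B f b = 0" using ab(4) orth_sym by auto
  have fe: "B f e = \<epsilon>" "B b a = \<epsilon>" using B_swap[of f e] B_swap[of b a] ef ab by simp_all
  define w where "w x y = wedge scale (x # y # ?Z)" for x y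
  have add1: "w (x + x') y = w x y + w x' y" for x x' y
    using wedge_add[of scale "[]" x x' "y # ?Z"] by (simp add: w_def)
  have add2: "w x (y + y') = w x y + w x y'" for x y y'
    using wedge_add[of scale "[x]" y y' ?Z] by (simp add: w_def)
  have sc1: "w (c *s x) y = ext_scale c (w x y)" for c x y
    using wedge_scale[of scale "[]" c x "y # ?Z"] by (simp add: w_def)
  have sc2: "w x (c *s y) = ext_scale c (w x y)" for c x y
    using wedge_scale[of scale "[x]" c y ?Z] by (simp add: w_def)
  have swap: "w y x = - w x y" for x y
    using wedge_swap[of scale "[]" y x ?Z] by (simp add: w_def)
  have step: "w x y \<in> ?Y"
    if "x \<in> span {a, b, e, f}" "y \<in> span {a, b, e, f}" "sing x" "sing y" "B x y = 0" for x y
    unfolding w_def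
  proof (rule wedge_perm_mem[OF subspace_singular_span])
    have o: "B z y = 0" if "z \<in> span {a, b, e, f}" "y \<in> set (flat (qs @ fs') @ vs @ us)" for z y
      using that ab ef us by (intro orth_span_left[OF that(1)]) auto
    have "wedge scale (flat qs @ vs @ x # y # us) \<in> singular_span (length (flat qs @ vs @ x # y # us))"
    proof (rule Cons.IH[OF blk])
      show "B x' y' = 0" if "x' \<in> set (x # y # us)" "y' \<in> set (x # y # us)" for x' y'
        using that \<open>sing x\<close> \<open>sing y\<close> \<open>B x y = 0\<close> sing_isotropic Cons.prems(5) o[OF \<open>x \<in> _\<close>] o[OF \<open>y \<in> _\<close>]
        by (auto intro: orth_sym[of x] orth_sym[of y])
      show "B x' y' = 0" if "x' \<in> set (x # y # us)" "y' \<in> set (flat (qs @ fs') @ vs)" for x' y'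
        using that Cons.prems(6) o[OF \<open>x \<in> _\<close>] o[OF \<open>y \<in> _\<close>] by (auto simp: fs)
    qed (use Cons.prems \<open>sing x\<close> \<open>sing y\<close> in \<open>auto simp: fs\<close>)
    then show "wedge scale (flat qs @ vs @ x # y # us) \<in> ?Y" by simp
  qed simp
  have sp: "a \<in> span {a, b, e, f}" "b \<in> span {a, b, e, f}" "e \<in> span {a, b, e, f}" "f \<in> span {a, b, e, f}"
    by (auto intro: span_base)
  have "ext.subspace ?Y" by (rule subspace_singular_span)
  note Yadd = ext.subspace_add[OF this] and Ydiff = ext.subspace_diff[OF this]
    and Yscale = ext.subspace_scale[OF this] and Yneg = ext.subspace_neg[OF this]
  have rel: "ext_scale x (w e f) - ext_scale (\<sigma> x) (w a b) \<in> ?Y" for x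
  proof -
    \<comment> \<open>The coefficient -\<sigma>(x) makes the vectors orthogonal: B e f contributes x
      and B a b contributes -\<sigma>(\<sigma>(x)) = -x.\<close>
    have "w (a + x *s e) (f + (- \<sigma> x) *s b) \<in> ?Y"
    proof (rule step)
      show "sing (a + x *s e)" "sing (f + (- \<sigma> x) *s b)"
        using s ab(4) x0 by (intro sing_add_scale; simp)+
      show "B (a + x *s e) (f + (- \<sigma> x) *s b) = 0"
        using ab ef x0 by (simp add: B_simps \<sigma>_neg)
    qed (intro span_add span_scale sp)+
    moreover have "w a f \<in> ?Y" "w e b \<in> ?Y" using s ab(4) x0 sp by (intro step; simp)+
    moreover have "ext_scale x (w e f) - ext_scale (\<sigma> x) (w a b) =
        w (a + x *s e) (f + (- \<sigma> x) *s b) - (w a f + ext_scale (- x * \<sigma> x) (w e b))"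
      unfolding add1 add2 sc1 sc2 by (simp add: ext.scale_right_distrib ext.scale_minus_left)
    ultimately show ?thesis using Yadd Ydiff Yscale by metis
  qed
  have rel1: "w e f - w a b \<in> ?Y" using rel[of 1] by simp
  have "w a b \<in> ?Y"
  proof -
    have "\<exists>c. c \<noteq> 0 \<and> ext_scale c (w a b) \<in> ?Y"
    proof (cases "\<sigma> = id")
      case False
      then obtain x where x: "\<sigma> x \<noteq> x" by (metis eq_id_iff)
      have "(ext_scale x (w e f) - ext_scale (\<sigma> x) (w a b)) - ext_scale x (w e f - w a b) \<in> ?Y"
        by (intro Ydiff Yscale rel rel1)
      moreover have "(ext_scale x (w e f) - ext_scale (\<sigma> x) (w a b)) - ext_scale x (w e f - w a b)
          = ext_scale (x - \<sigma> x) (w a b)"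
        by (simp add: ext.scale_right_diff_distrib ext.scale_left_diff_distrib)
      ultimately show ?thesis using x by (intro exI[of _ "x - \<sigma> x"]) simp
    next
      case True
      then have eps: "\<epsilon> \<noteq> - 1" using nsymp by simp
      have "w (a + f) (e + (- \<epsilon>) *s b) \<in> ?Y"
      proof (rule step)
        show "sing (a + f)" "sing (e + (- \<epsilon>) *s b)"
          using s ab(4) x0 sing_add[of a f] sing_add_scale[of e b "- \<epsilon>"] by simp_all
        show "B (a + f) (e + (- \<epsilon>) *s b) = 0"
          using ab ef x0 fe True by (simp add: B_simps)
      qed (intro span_add span_scale sp)+
      moreover have "w a e \<in> ?Y" "w f b \<in> ?Y" using s ab(4) x0 sp by (intro step; simp)+
      \<comment> \<open>The new relation e \<and> f + \<epsilon> (a \<and> b) and the relation e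
        \<and> f - a \<and> b differ by (1 + \<epsilon>) (a \<and> b).\<close>
      moreover have "ext_scale (1 + \<epsilon>) (w a b) =
          (w a e + ext_scale (- \<epsilon>) (w f b)) - w (a + f) (e + (- \<epsilon>) *s b) - (w e f - w a b)"
        unfolding add1 add2 sc1 sc2 swap[of f e]
        by (simp add: ext.scale_left_distrib ext.scale_right_distrib ext.scale_minus_left)
      ultimately have "ext_scale (1 + \<epsilon>) (w a b) \<in> ?Y" using Yadd Ydiff Yscale rel1 by metis
      moreover have "1 + \<epsilon> \<noteq> 0" using eps by (metis add.commute eq_neg_iff_add_eq_0)
      ultimately show ?thesis by blast
    qed
    then obtain c where "c \<noteq> 0" "ext_scale c (w a b) \<in> ?Y" by blast
    then show ?thesis using Yscale[of "ext_scale c (w a b)" "inverse c"] by simp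
  qed
  then show ?case by (simp add: w_def q)
qed

text \<open>A basis monomial is sorted by how it meets the hyperbolic pairs: \<open>qs\<close> are
  the pairs it contains, \<open>us\<close> the members of pairs met once, \<open>fs\<close> the
  pairs it avoids and \<open>vs\<close> its single vectors. The length equation supplies the number
  of free pairs.\<close>

lemma subseqs_split:
  assumes "hyperbolic_system ps R" "d \<in> set (subseqs (flat ps @ R))"
  shows "\<exists>qs fs vs us. mset d = mset (flat qs @ vs @ us) \<and> hyperbolic_system (qs @ fs) vs \<and>
    set (qs @ fs) \<subseteq> set ps \<and> set us \<subseteq> set (flat ps) \<and> set vs \<subseteq> set R \<and> length ps = length qs + length fs + length us \<and>
    (\<forall>x \<in> set us. \<forall>y \<in> set us \<union> set (flat (qs @ fs) @ vs). B x y = 0)"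
  using assms
proof (induction ps arbitrary: d)
  case Nil
  have "sorted_wrt (\<lambda>x y. B x y = 0) d" if "sorted_wrt (\<lambda>x y. B x y = 0) R" "d \<in> set (subseqs R)" for d R
    using that
  proof (induction R arbitrary: d)
    case (Cons r R)
    then show ?case using subseqs_subset[of _ R] by (fastforce simp: Let_def)
  qed simp
  then show ?case
    using Nil subseqs_subset[of d R] by (intro exI[of _ "[]"] exI[of _ d]) auto
next
  case (Cons p ps)
  obtain e f where p: "p = (e, f)" by fastforce
  have ef: "B e e = 0" "B f f = 0" "B e f = 1" "\<And>y. y \<in> set (flat ps @ R) \<Longrightarrow> B e y = 0 \<and> B f y = 0"
    and blk: "hyperbolic_system ps R" using Cons.prems(1) by (auto simp: p)
  have "d \<in> set (subseqs (e # f # flat ps @ R))" using Cons.prems(2) by (simp add: p)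
  then have "\<exists>pre \<in> {[], [e], [f], [e, f]}. \<exists>d' \<in> set (subseqs (flat ps @ R)). d = pre @ d'"
    unfolding subseqs_Cons_set by auto
  then obtain d' pre where d: "d = pre @ d'" "pre \<in> {[], [e], [f], [e, f]}" "d' \<in> set (subseqs (flat ps @ R))"
    by blast
  obtain qs fs vs us where IH: "mset d' = mset (flat qs @ vs @ us)" "hyperbolic_system (qs @ fs) vs"
      "set (qs @ fs) \<subseteq> set ps" "set us \<subseteq> set (flat ps)" "set vs \<subseteq> set R" "length ps = length qs + length fs + length us"
      "\<forall>x \<in> set us. \<forall>y \<in> set us \<union> set (flat (qs @ fs) @ vs). B x y = 0"
    using Cons.IH[OF blk d(3)] by blast
  have inner: "set us \<union> set (flat (qs @ fs) @ vs) \<subseteq> set (flat ps @ R)"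
    using IH(3,4,5) by (auto simp: set_flat)
  have blk': "hyperbolic_system (p # qs @ fs) vs" using IH(2) ef inner by (auto simp: p)
  have orth: "B x e = 0 \<and> B x f = 0" if "x \<in> set us" for x
    using that ef(4)[of x] inner orth_sym by auto
  have ef': "B e y = 0 \<and> B f y = 0" if "y \<in> set us \<union> set (flat (qs @ fs) @ vs)" for y
    using that inner ef(4) by blast
  have orth': "\<forall>x \<in> set (z # us). \<forall>y \<in> set (z # us) \<union> set (flat (qs @ fs) @ vs). B x y = 0"
    if "z = e \<or> z = f" for z
    using that IH(7) orth ef(1,2) ef' by auto
  from d(2) consider "pre = []" | "pre = [e]" | "pre = [f]" | "pre = [e, f]" by blast
  then show ?case
  proof cases
    case 1
    then show ?thesis
      using IH d orth blk' by (intro exI[of _ qs] exI[of _ "p # fs"] exI[of _ vs] exI[of _ us])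
        (auto simp: hyperbolic_system_middle p simp del: hyperbolic_system.simps)
  next
    case 2
    have "mset d = mset (flat qs @ vs @ e # us)" "set (e # us) \<subseteq> set (flat (p # ps))"
      "length (p # ps) = length qs + length fs + length (e # us)" "set (qs @ fs) \<subseteq> set (p # ps)"
      using IH(1,3,4,6) d(1) 2 by (auto simp: p)
    then show ?thesis using IH(2,5) orth'[of e] by blast
  next
    case 3
    have "mset d = mset (flat qs @ vs @ f # us)" "set (f # us) \<subseteq> set (flat (p # ps))"
      "length (p # ps) = length qs + length fs + length (f # us)" "set (qs @ fs) \<subseteq> set (p # ps)"
      using IH(1,3,4,6) d(1) 3 by (auto simp: p)
    then show ?thesis using IH(2,5) orth'[of f] by blast
  next
    case 4
    then show ?thesis
      using IH d orth blk' by (intro exI[of _ "p # qs"] exI[of _ fs] exI[of _ vs] exI[of _ us])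
        (auto simp: p simp del: hyperbolic_system.simps)
  qed
qed

text \<open>Isotropic vectors are singular here, so all pairs of the system are singular. From 2|qs|
  + |vs| + |us| = k \<le> |ps| = |qs| + |fs| + |us| follows |qs| + |vs| \<le> |fs|, enough free
  pairs for \<open>wedge_pair_mem_singular_span\<close>.\<close>

lemma singular_span_eq_ext_power:
  assumes "\<sigma> \<noteq> id \<or> \<epsilon> \<noteq> - 1" "\<And>x. B x x = 0 \<Longrightarrow> sing x"
    and "hyperbolic_system ps R" "distinct (flat ps @ R)" "span (set (flat ps @ R)) = UNIV" "k \<le> length ps"
  shows "singular_span k = ext_power scale k"
proof
  show "ext_power scale k \<subseteq> singular_span k"
  proof (rule ext_power_subset[OF subspace_singular_span assms(4,5)])
    fix d assume d: "d \<in> set (subseqs (flat ps @ R))" "length d = k"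
    obtain qs fs vs us where *: "mset d = mset (flat qs @ vs @ us)" "hyperbolic_system (qs @ fs) vs"
        "set (qs @ fs) \<subseteq> set ps" "set us \<subseteq> set (flat ps)" "length ps = length qs + length fs + length us"
        "\<forall>x \<in> set us. \<forall>y \<in> set us \<union> set (flat (qs @ fs) @ vs). B x y = 0"
      using subseqs_split[OF assms(3) d(1)] by blast
    have len: "length (flat qs @ vs @ us) = k" using *(1) d(2) mset_eq_length by metis
    have "B (fst p) (fst p) = 0 \<and> B (snd p) (snd p) = 0" if "p \<in> set ps" for p
      using assms(3) that by (induction ps) auto
    then have sg: "sing (fst p) \<and> sing (snd p)" if "p \<in> set ps" for p
      using that assms(2) by blast
    have "wedge scale (flat qs @ vs @ us) \<in> singular_span (length (flat qs @ vs @ us))"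
    proof (rule wedge_pair_mem_singular_span[OF assms(1) *(2)])
      show "length qs + length vs \<le> length fs" using len *(5) assms(6) by simp
      show "sing x" if "x \<in> set us" for x using that *(4) sg by (auto simp: set_flat)
    qed (use * sg in auto)
    then show "wedge scale d \<in> singular_span k"
      using len wedge_perm_mem[OF subspace_singular_span _ *(1)] by simp
  qed
qed (rule singular_span_subset_ext_power)

end

section \<open>The symplectic case\<close>

text \<open>Covers alternating forms, where every vector is singular, and bilinearizations of
  quadratic forms in characteristic 2, where \<epsilon> = 1 = -1 and \<open>sing\<close> can be
  smaller than the set of isotropic vectors.\<close>

locale alternating_polar_form = polar_form +
  assumes \<sigma>_id: "\<sigma> = id" and B_self: "B x x = 0"
begin

lemma B_antisym: "B y x = - B x y"
proof -
  have "B x y + B y x = 0" using B_self[of "x + y"] B_self[of x] B_self[of y]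
    by (simp add: B_add_left B_add_right add.commute)
  then show ?thesis by (simp add: eq_neg_iff_add_eq_0 add.commute)
qed

lemma pairing_outside:
  assumes "\<And>t. t \<in> set ts \<Longrightarrow> fst t x = 0 \<and> snd t x = 0"
  shows "pairing ts x y = 0" "pairing ts y x = 0"
  using assms by (induction ts) auto

lemma pairing_linear:
  assumes "\<And>t. t \<in> set ts \<Longrightarrow> functional scale (fst t) \<and> functional scale (snd t)"
  shows "pairing ts (x + y) z = pairing ts x z + pairing ts y z" "pairing ts (c *s x) z = c * pairing ts x z"
    "pairing ts z (x + y) = pairing ts z x + pairing ts z y" "pairing ts z (c *s x) = c * pairing ts z x"
  using assms by (induction ts) (auto simp: functional_def algebra_simps)

text \<open>Both sides are bilinear and agree on the basis: as \<open>B\<close> is alternating, the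
  vectors of \<open>R\<close> are orthogonal to all basis vectors including themselves, and only the
  hyperbolic pairs contribute.\<close>

lemma B_eq_pairing:
  assumes "hyperbolic_system ps R" "independent (set (flat ps @ R))" "span (set (flat ps @ R)) = UNIV" "distinct (flat ps @ R)"
  shows "B x y = pairing (dual_pairs (coord scale (flat ps @ R)) ps) x y"
proof -
  let ?\<theta> = "coord scale (flat ps @ R)"
  have basis: "B x y = pairing (dual_pairs \<theta> ps) x y"
    if "hyperbolic_system ps R" "distinct (flat ps @ R)" "x \<in> set (flat ps @ R)" "y \<in> set (flat ps @ R)"
      "\<And>v w. v \<in> set (flat ps @ R) \<Longrightarrow> w \<in> set (flat ps @ R) \<Longrightarrow> \<theta> v w = (if v = w then 1 else 0)"
    for \<theta> ps x y
    using that
  proof (induction ps arbitrary: x y)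
    case Nil
    then show ?case
    proof (induction R)
      case (Cons r R)
      then show ?case using B_self orth_sym by auto
    qed simp
  next
    case (Cons p ps)
    obtain e f where p: "p = (e, f)" by fastforce
    have dist: "e \<noteq> f" "e \<notin> set (flat ps @ R)" "f \<notin> set (flat ps @ R)" using Cons.prems(2) by (auto simp: p)
    have ef: "B e f = 1" "B f e = - 1" "\<And>y. y \<in> set (flat ps @ R) \<Longrightarrow> B e y = 0 \<and> B f y = 0 \<and> B y e = 0 \<and> B y f = 0"
      using Cons.prems(1) orth_sym B_antisym[of f e] by (auto simp: p)
    have \<theta>: "\<theta> v w = (if v = w then 1 else 0)" if "v \<in> insert e (insert f (set (flat ps @ R)))" "w \<in> insert e (insert f (set (flat ps @ R)))" for v w
      using Cons.prems(5)[of v w] that by (auto simp: p)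
    have out: "fst t z = 0 \<and> snd t z = 0" if t: "t \<in> set (dual_pairs \<theta> ps)" and z: "z = e \<or> z = f" for t z
    proof -
      obtain q where q: "q \<in> set ps" "t = (\<theta> (fst q), \<theta> (snd q))" using t by auto
      then have "fst q \<in> set (flat ps @ R)" "snd q \<in> set (flat ps @ R)" by (auto simp: set_flat)
      then show ?thesis using \<theta>[of "fst q" z] \<theta>[of "snd q" z] q(2) dist z by auto
    qed
    note pe = pairing_outside[of "dual_pairs \<theta> ps" e, OF out] and pf = pairing_outside[of "dual_pairs \<theta> ps" f, OF out]
    have inner: "\<theta> e z = 0 \<and> \<theta> f z = 0" if "z \<in> set (flat ps @ R)" for z
      using \<theta>[of e z] \<theta>[of f z] that dist by auto
    have diag: "\<theta> e e = 1" "\<theta> e f = 0" "\<theta> f e = 0" "\<theta> f f = 1" using \<theta> dist by auto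
    have IH: "B x y = pairing (dual_pairs \<theta> ps) x y" if "x \<in> set (flat ps @ R)" "y \<in> set (flat ps @ R)" for x y
      using Cons.prems \<theta> that by (intro Cons.IH) auto
    have "x \<in> {e, f} \<or> x \<in> set (flat ps @ R)" "y \<in> {e, f} \<or> y \<in> set (flat ps @ R)"
      using Cons.prems(3,4) by (auto simp: p)
    then show ?case
      using IH inner ef diag pe pf B_self by (auto simp: p)
  qed
  have lin: "functional scale (fst t) \<and> functional scale (snd t)" if "t \<in> set (dual_pairs ?\<theta> ps)" for t
    using that functional_coord[OF assms(2,3)] by auto
  let ?P = "pairing (dual_pairs ?\<theta> ps)"
  have P: "?P (v + w) z = ?P v z + ?P w z" "?P (c *s v) z = c * ?P v z"
    "?P z (v + w) = ?P z v + ?P z w" "?P z (c *s v) = c * ?P z v" for v w z c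
    by (rule pairing_linear; rule lin; assumption)+
  have sp: "v \<in> span (set (flat ps @ R))" for v using assms(3) by simp
  have P0: "pairing (dual_pairs ?\<theta> ps) v 0 = 0" "pairing (dual_pairs ?\<theta> ps) 0 v = 0" for v
    using P(4)[of v 0 0] P(2)[of 0 0 v] by (simp_all only: scale_zero_left mult_zero_left)
  have *: "B v w = pairing (dual_pairs ?\<theta> ps) v w" if v: "v \<in> set (flat ps @ R)" for v w
    using sp[of w]
  proof (induction rule: span_induct_alt)
    case base
    then show ?case by (simp add: P0)
  next
    case (step c x y)
    then show ?case
      using basis[OF assms(1,4) v, of x ?\<theta>] coord_basis[OF assms(2)] by (simp add: P B_simps \<sigma>_id)
  qed
  show ?thesis using sp[of x]
  proof (induction rule: span_induct_alt)
    case base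
    then show ?case by (simp add: P0)
  next
    case (step c v w)
    then show ?case using *[of v y] by (simp add: P B_simps)
  qed
qed

text \<open>The choice for the free coefficient of \<open>isotropic_gen\<close>. It is an arbitrary
  scalar if none makes the vector singular, as can happen when e is not singular; the isotropy of
  the generators does not depend on it.\<close>

definition sing_coeff :: "'b \<Rightarrow> 'b \<Rightarrow> 'a" where
  "sing_coeff x e = (SOME c. sing (x + c *s e))"

lemma isotropic_gen_orth_pair:
  assumes "isotropic_gen scale \<gamma> R ps qs us" "hyperbolic_system (p # ps) R" "y \<in> set (flat qs @ us)"
  shows "B (fst p) y = 0 \<and> B (snd p) y = 0 \<and> B y (fst p) = 0 \<and> B y (snd p) = 0"
proof -
  have "y \<in> span (set (flat ps @ R))" using isotropic_gen_span[OF assms(1)] assms(3) by blast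
  then have "B (fst p) y = 0" "B (snd p) y = 0"
    using assms(2) by (auto intro: orth_span_right)
  then show ?thesis using orth_sym by blast
qed

lemma isotropic_gen_orth:
  assumes "isotropic_gen scale \<gamma> R ps qs us" "hyperbolic_system ps R"
  shows "hyperbolic_system qs [] \<and> (\<forall>x \<in> set us. \<forall>y \<in> set us \<union> set (flat qs). B x y = 0)"
  using assms
proof induction
  case (Nil us)
  have "B x y = 0" if "sorted_wrt (\<lambda>x y. B x y = 0) R" "x \<in> set R" "y \<in> set R" for x y R
    using that by (induction R) (auto simp: B_self dest: orth_sym)
  then show ?case using Nil subseqs_subset[of us R] by auto
next
  case (skip ps qs us p)
  then show ?case by simp
next
  case (left ps qs us p)
  have p: "B (fst p) y = 0 \<and> B (snd p) y = 0 \<and> B y (fst p) = 0 \<and> B y (snd p) = 0"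
    if "y \<in> set (flat qs @ us)" for y
    using isotropic_gen_orth_pair[OF left.hyps left.prems that] .
  then show ?case using left by (auto simp: B_self)
next
  case (right ps qs us p)
  have p: "B (fst p) y = 0 \<and> B (snd p) y = 0 \<and> B y (fst p) = 0 \<and> B y (snd p) = 0"
    if "y \<in> set (flat qs @ us)" for y
    using isotropic_gen_orth_pair[OF right.hyps right.prems that] .
  then show ?case using right by (auto simp: B_self)
next
  case (pair ps qs us p)
  have p: "B (fst p) y = 0 \<and> B (snd p) y = 0 \<and> B y (fst p) = 0 \<and> B y (snd p) = 0"
    if "y \<in> set (flat qs @ us)" for y
    using isotropic_gen_orth_pair[OF pair.hyps pair.prems that] .
  then show ?case using pair by (auto simp: B_self)
next
  case (exchange ps q qs us p)
  obtain x y e f where q: "q = (x, y)" and p: "p = (e, f)" by fastforce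
  let ?x = "x + f + \<gamma> (x + f) e *s e" and ?y = "y + e"
  have ef: "B e z = 0 \<and> B f z = 0 \<and> B z e = 0 \<and> B z f = 0" if "z \<in> set (flat (q # qs) @ us)" for z
    using isotropic_gen_orth_pair[OF exchange.hyps exchange.prems, of z] that by (auto simp: p)
  have IH: "hyperbolic_system (q # qs) []" "\<forall>z \<in> set us. \<forall>w \<in> set us \<union> set (flat (q # qs)). B z w = 0"
    using exchange by auto
  have B1: "B e f = 1" "B f e = - 1" using exchange.prems B_antisym[of f e] by (auto simp: p)
  \<comment> \<open>The contributions B x y = 1 and B f e = -1 cancel.\<close>
  have "B ?x ?y = 0" using IH(1) B1 ef[of x] ef[of y] by (simp add: q B_simps B_self)
  then have "B ?x ?y = 0" "B ?y ?x = 0" using orth_sym by blast+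
  moreover have "B ?x z = 0 \<and> B ?y z = 0 \<and> B z ?x = 0 \<and> B z ?y = 0" if "z \<in> set us" for z
  proof -
    have "B ?x z = 0" "B ?y z = 0" using IH(2) that ef[of z] orth_sym by (auto simp: q B_simps)
    then show ?thesis using orth_sym by blast
  qed
  moreover have "B ?x z = 0 \<and> B ?y z = 0" if "z \<in> set (flat qs)" for z
    using IH(1) that ef[of z] by (auto simp: q B_simps)
  ultimately show ?case using IH by (auto simp: q p B_self)
qed

text \<open>A count of the singular pairs in \<open>ss\<close> that remain free, so that every non-singular vector of
  \<open>us\<close> can be assigned one. A pair is used up by each singular vector and each singular pair.\<close>

lemma isotropic_gen_free:
  assumes "isotropic_gen scale sing_coeff R (ss @ ns) qs us" "hyperbolic_system (ss @ ns) R"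
    and "\<And>p. p \<in> set ss \<Longrightarrow> sing (fst p) \<and> sing (snd p)"
  shows "\<exists>fs. hyperbolic_system fs [] \<and> set fs \<subseteq> set ss \<and> (\<forall>z \<in> set (flat fs). \<forall>x \<in> set (flat qs @ us). B z x = 0) \<and>
    length ss \<le> length fs + length (filter sing us) + length (filter (\<lambda>q. sing (fst q) \<and> sing (snd q)) qs)"
  using assms
proof (induction ss arbitrary: qs us)
  case Nil
  then show ?case by (intro exI[of _ "[]"]) auto
next
  case (Cons p ss)
  obtain e f where p: "p = (e, f)" by fastforce
  have s: "sing e" "sing f" and B1: "B e f = 1" "B f e = - 1" and blk: "hyperbolic_system (ss @ ns) R"
    using Cons.prems(2) Cons.prems(3)[of p] B_antisym[of f e] by (auto simp: p)
  have out: "B e z = 0 \<and> B f z = 0 \<and> B z e = 0 \<and> B z f = 0" if "z \<in> span (set (flat (ss @ ns) @ R))" for z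
    using Cons.prems(2) orth_span_right[OF that] orth_sym by (auto simp: p)
  let ?g = "isotropic_gen scale sing_coeff R (ss @ ns)"
  have IH: "\<exists>fs. hyperbolic_system fs [] \<and> set fs \<subseteq> set ss \<and> (\<forall>z \<in> set (flat fs). \<forall>x \<in> set (flat qs @ us). B z x = 0) \<and>
      (\<forall>z \<in> set (flat fs). B e z = 0 \<and> B f z = 0 \<and> B z e = 0 \<and> B z f = 0) \<and>
      length ss \<le> length fs + length (filter sing us) + length (filter (\<lambda>q. sing (fst q) \<and> sing (snd q)) qs)"
    if g: "?g qs us" for qs us
  proof -
    obtain fs where fs: "hyperbolic_system fs []" "set fs \<subseteq> set ss" "\<forall>z \<in> set (flat fs). \<forall>x \<in> set (flat qs @ us). B z x = 0"
      "length ss \<le> length fs + length (filter sing us) + length (filter (\<lambda>q. sing (fst q) \<and> sing (snd q)) qs)"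
      using Cons.IH[OF g blk] Cons.prems(3) by auto
    have "z \<in> span (set (flat (ss @ ns) @ R))" if "z \<in> set (flat fs)" for z
      using that fs(2) by (intro span_base) (auto simp: set_flat)
    then show ?thesis using fs out by blast
  qed
  have mem: "z \<in> span (set (flat (ss @ ns) @ R))" if "?g qs us" "z \<in> set (flat qs @ us)" for qs us z
    using isotropic_gen_span[OF that(1)] that(2) by blast
  from Cons.prems(1) have "isotropic_gen scale sing_coeff R (p # ss @ ns) qs us" by simp
  then show ?case
  proof cases
    case skip
    then obtain fs where fs: "hyperbolic_system fs []" "set fs \<subseteq> set ss"
      "\<forall>z \<in> set (flat fs). \<forall>x \<in> set (flat qs @ us). B z x = 0"
      "\<forall>z \<in> set (flat fs). B e z = 0 \<and> B f z = 0 \<and> B z e = 0 \<and> B z f = 0"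
      "length ss \<le> length fs + length (filter sing us) + length (filter (\<lambda>q. sing (fst q) \<and> sing (snd q)) qs)"
      using IH by blast
    then show ?thesis
      using out mem[OF skip] B1 by (intro exI[of _ "p # fs"]) (auto simp: p B_self)
  next
    case (left us')
    then obtain fs where "hyperbolic_system fs []" "set fs \<subseteq> set ss"
      "\<forall>z \<in> set (flat fs). \<forall>x \<in> set (flat qs @ us'). B z x = 0"
      "\<forall>z \<in> set (flat fs). B e z = 0 \<and> B f z = 0 \<and> B z e = 0 \<and> B z f = 0"
      "length ss \<le> length fs + length (filter sing us') + length (filter (\<lambda>q. sing (fst q) \<and> sing (snd q)) qs)"
      using IH by blast
    then show ?thesis using left s by (intro exI[of _ fs]) (auto simp: p)
  next
    case (right us')
    then obtain fs where "hyperbolic_system fs []" "set fs \<subseteq> set ss"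
      "\<forall>z \<in> set (flat fs). \<forall>x \<in> set (flat qs @ us'). B z x = 0"
      "\<forall>z \<in> set (flat fs). B e z = 0 \<and> B f z = 0 \<and> B z e = 0 \<and> B z f = 0"
      "length ss \<le> length fs + length (filter sing us') + length (filter (\<lambda>q. sing (fst q) \<and> sing (snd q)) qs)"
      using IH by blast
    then show ?thesis using right s by (intro exI[of _ fs]) (auto simp: p)
  next
    case (pair qs')
    then obtain fs where "hyperbolic_system fs []" "set fs \<subseteq> set ss"
      "\<forall>z \<in> set (flat fs). \<forall>x \<in> set (flat qs' @ us). B z x = 0"
      "\<forall>z \<in> set (flat fs). B e z = 0 \<and> B f z = 0 \<and> B z e = 0 \<and> B z f = 0"
      "length ss \<le> length fs + length (filter sing us) + length (filter (\<lambda>q. sing (fst q) \<and> sing (snd q)) qs')"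
      using IH by blast
    then show ?thesis using pair s by (intro exI[of _ fs]) (auto simp: p)
  next
    case (exchange q us')
    obtain x y where q: "q = (x, y)" by fastforce
    obtain fs where fs: "hyperbolic_system fs []" "set fs \<subseteq> set ss"
      "\<forall>z \<in> set (flat fs). \<forall>x \<in> set (flat (q # qs) @ us'). B z x = 0"
      "\<forall>z \<in> set (flat fs). B e z = 0 \<and> B f z = 0 \<and> B z e = 0 \<and> B z f = 0"
      "length ss \<le> length fs + length (filter sing us') + length (filter (\<lambda>q. sing (fst q) \<and> sing (snd q)) (q # qs))"
      using IH[OF exchange(2)] by blast
    have xy: "B e x = 0" "B y e = 0" using out mem[OF exchange(2)] by (auto simp: q)
    have "B e (x + f) \<noteq> 0" using xy B1 by (simp add: B_simps)
    then have "sing (x + f + sing_coeff (x + f) e *s e)"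
      unfolding sing_coeff_def by (rule someI_ex[OF sing_adjust[OF s(1)]])
    \<comment> \<open>The pair \<open>p\<close> is paid for by x + f + c e, which is singular in
      every case. If \<open>q\<close> was a singular pair, its loss from the count is made up by y +
      e.\<close>
    moreover have "sing (y + e)" if "sing y" using sing_add[OF that s(1)] xy by blast
    ultimately show ?thesis
      using fs exchange(1) by (intro exI[of _ fs]) (auto simp: p q B_simps split: if_splits)
  qed
qed

text \<open>With no hyperbolic pairs left in the monomial, the count of
  \<open>isotropic_gen_free\<close> and |us| \<le> |ss| show that the non-singular entries of
  \<open>us\<close> are at most as many as the free singular pairs.\<close>

lemma wedge_isotropic_gen_mem_singular_span:
  assumes "isotropic_gen scale sing_coeff R (ss @ ns) [] us" "hyperbolic_system (ss @ ns) R"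
    and "\<And>p. p \<in> set ss \<Longrightarrow> sing (fst p) \<and> sing (snd p)" "length us \<le> length ss"
  shows "wedge scale us \<in> singular_span (length us)"
proof -
  obtain fs where fs: "hyperbolic_system fs []" "set fs \<subseteq> set ss" "\<forall>z \<in> set (flat fs). \<forall>x \<in> set us. B z x = 0"
    "length ss \<le> length fs + length (filter sing us)"
    using isotropic_gen_free[OF assms(1-3)] by auto
  have iso: "\<forall>x \<in> set us. \<forall>y \<in> set us. B x y = 0" using isotropic_gen_orth[OF assms(1,2)] by auto
  have sym: "B x z = 0" if "z \<in> set (flat fs)" "x \<in> set us" for x z
    using fs(3) that orth_sym by blast
  let ?vs = "filter (\<lambda>x. \<not> sing x) us" and ?ws = "filter sing us"
  have len: "length ?vs + length ?ws = length us"
    using sum_length_filter_compl[of sing us] by simp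
  have "wedge scale (?vs @ ?ws) \<in> singular_span (length ?vs + length ?ws)"
  proof (rule wedge_mem_singular_span_free)
    show "hyperbolic_system fs ?vs"
    proof (rule hyperbolic_system_right[OF fs(1)])
      show "sorted_wrt (\<lambda>x y. B x y = 0) ?vs" by (rule sorted_wrtI) (simp add: iso)
      show "B r x = 0" if "x \<in> set (flat fs)" "r \<in> set ?vs" for x r
        using sym[OF that(1)] that(2) by simp
    qed
    show "length ?vs \<le> length fs" using len fs(4) assms(4) by linarith
    show "B x y = 0" if "x \<in> set ?ws" "y \<in> set (flat fs @ ?vs)" for x y
      using that iso sym by auto
    show "sing (fst p) \<and> sing (snd p)" if "p \<in> set fs" for p
      using assms(3) fs(2) that by blast
  qed (simp_all add: iso)
  moreover have "mset us = mset (?vs @ ?ws)" by (simp add: union_commute flip: multiset_partition)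
  ultimately show ?thesis using wedge_perm_mem[OF subspace_singular_span] len by metis
qed

lemma singular_span_symplectic:
  assumes "hyperbolic_system (ss @ ns) R" "distinct R" "independent (set R)" "span (set (flat (ss @ ns) @ R)) = UNIV"
    and "\<And>p. p \<in> set ss \<Longrightarrow> sing (fst p) \<and> sing (snd p)" "k \<le> length ss"
  shows "singular_span k = isotropic_span scale B k"
    and "ext.dim (singular_span k) + (if 2 \<le> k then dim UNIV choose (k - 2) else 0) = dim UNIV choose k"
proof -
  let ?ps = "ss @ ns"
  have L: "distinct (flat ?ps @ R)" "independent (set (flat ?ps @ R))"
    using hyperbolic_system_independent[OF assms(1-3)] by auto
  have N: "dim UNIV = length (flat ?ps @ R)"
    using dim_span_eq_card_independent[OF L(2)] distinct_card[OF L(1)] unfolding assms(4) by simp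
  have B: "B x y = pairing (dual_pairs (coord scale (flat ?ps @ R)) ?ps) x y" for x y
    by (rule B_eq_pairing[OF assms(1) L(2) assms(4) L(1)])
  have k: "k \<le> Suc (length ?ps)" using assms(6) by simp
  have sub: "singular_span k \<subseteq> isotropic_span scale B k"
    unfolding singular_span_def isotropic_span_def by (rule ext.span_mono) auto
  have gens: "wedge scale us \<in> singular_span k" if "isotropic_gen scale sing_coeff R ?ps [] us" "length us = k" for us
    using wedge_isotropic_gen_mem_singular_span[OF that(1) assms(1,5)] that(2) assms(6) by simp
  show "singular_span k = isotropic_span scale B k"
    by (rule isotropic_span_eqI[OF L assms(4) B k subspace_singular_span sub]) (rule gens)
  show "ext.dim (singular_span k) + (if 2 \<le> k then dim UNIV choose (k - 2) else 0) = dim UNIV choose k"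
    unfolding N
    by (rule isotropic_span_complement[OF L assms(4) B k subspace_singular_span sub]) (rule gens)
qed

end

section \<open>Hermitian, alternating and quadratic forms\<close>

context polar_form
begin

text \<open>A subspace \<open>X\<close> attaining the maximum serves as the totally singular space
  from which singular pairs are split off. The radical itself shows that the maximum is taken over a
  non-empty set.\<close>

lemma exists_singular_hyperbolic_system_of_witt:
  assumes ts: "\<And>X. subspace X \<Longrightarrow> totally_singular \<eta> X \<longleftrightarrow> (\<forall>x \<in> X. sing x \<and> (\<forall>y \<in> X. B x y = 0))"
    and rad: "radical \<eta> = {v. (\<forall>x. B v x = 0) \<and> sing v}"
    and n: "reduced_witt_index scale \<eta> = n"
  shows "\<exists>ss ns rs. length ss = n \<and> (\<forall>p \<in> set ss. sing (fst p) \<and> sing (snd p)) \<and> hyperbolic_system (ss @ ns) rs \<and>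
    span (set (flat (ss @ ns) @ rs)) = UNIV \<and> distinct rs \<and> independent (set rs)"
proof -
  let ?M = "{dim X - dim (radical \<eta>) | X. subspace X \<and> radical \<eta> \<subseteq> X \<and> totally_singular \<eta> X}"
  have "subspace (radical \<eta>)"
    unfolding rad by (rule subspaceI) (auto simp: B_simps sing_0 sing_add sing_scale)
  then have "dim (radical \<eta>) - dim (radical \<eta>) \<in> ?M" using ts[of "radical \<eta>"] rad by blast
  moreover have "?M \<subseteq> {..dim UNIV}"
    using dim_subset[OF subset_UNIV] by (auto intro: order_trans[OF diff_le_self])
  ultimately have "Max ?M \<in> ?M" using finite_subset[of ?M] by (intro Max_in) auto
  then obtain X where X: "n = dim X - dim (radical \<eta>)" "subspace X" "radical \<eta> \<subseteq> X" "totally_singular \<eta> X"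
    using n unfolding reduced_witt_index_def by auto
  have "dim (radical \<eta>) \<le> dim X" using X(3) by (rule dim_subset)
  then have "n + dim (radical \<eta>) \<le> dim X" using X(1) by simp
  then have "\<exists>ss ns rs. length ss = n \<and> (\<forall>p \<in> set ss. sing (fst p) \<and> sing (snd p)) \<and> hyperbolic_system (ss @ ns) rs \<and>
      set (flat (ss @ ns) @ rs) \<subseteq> UNIV \<and> UNIV \<subseteq> span (set (flat (ss @ ns) @ rs)) \<and>
      distinct rs \<and> independent (set rs)"
    using X(2,4) ts[OF X(2)] rad by (intro exists_singular_hyperbolic_system[where E = X]) auto
  then show ?thesis by blast
qed

end

section \<open>The three kinds of forms as polar forms, and the theorem\<close>

lemma hermitian_polar_form:
  assumes "finite_dimensional_vector_space scale Basis" "hermitian_form scale \<sigma> h"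
  shows "polar_form scale Basis \<sigma> 1 h (\<lambda>x. h x x = 0)"
proof -
  interpret finite_dimensional_vector_space scale Basis by fact
  have \<sigma>: "order_2_automorphism \<sigma>" using assms(2) by (simp add: hermitian_form_def)
  then have add: "\<sigma> (a + b) = \<sigma> a + \<sigma> b" and mult: "\<sigma> (a * b) = \<sigma> a * \<sigma> b"
    and "\<sigma> \<noteq> id" "\<sigma> 1 = 1" and "\<sigma> \<circ> \<sigma> = id" for a b
    unfolding order_2_automorphism_def by blast+
  then have inv: "\<sigma> (\<sigma> a) = a" for a by (metis comp_apply id_apply)
  have lin: "Vector_Spaces.linear scale (*) (\<lambda>x. h x z)" and h': "h x (y + z) = h x y + h x z"
    "h x (scale c y) = \<sigma> c * h x y" "h y x = \<sigma> (h x y)" for x y z c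
    using assms(2) unfolding hermitian_form_def by blast+
  have h: "h (x + y) z = h x z + h y z" "h (scale c x) z = c * h x z" "h x (y + z) = h x y + h x z"
    "h x (scale c y) = \<sigma> c * h x y" "h y x = \<sigma> (h x y)" for x y z c
    using lin[of z] by (simp_all only: Vector_Spaces.linear_iff h'(1,2)) (rule h'(3))
  have s0: "\<sigma> 0 = 0" using add[of 0 0] by (metis add.right_neutral add_left_cancel)
  \<comment> \<open>An element of non-zero trace: 1 if 2 is invertible; otherwise any element moved
    by \<sigma>, since then a + \<sigma>(a) = 0 would force \<sigma>(a) = a.\<close>
  obtain a where a: "a + \<sigma> a \<noteq> 0"
  proof (cases "(2::'a) = 0")
    case True
    obtain a where "\<sigma> a \<noteq> a" using \<open>\<sigma> \<noteq> id\<close> by (auto simp: fun_eq_iff)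
    moreover have "a + a = 0" using True mult_2[of a] by simp
    ultimately have "a + \<sigma> a \<noteq> 0" by (metis add_left_cancel)
    then show ?thesis using that by blast
  next
    case False
    then show ?thesis using that[of 1] \<open>\<sigma> 1 = 1\<close> by simp
  qed
  show ?thesis
  proof
    fix e x assume e: "h e e = 0" "h e x \<noteq> 0"
    define s r m where "s = a + \<sigma> a" and "r = h x x" and "m = h e x"
    have sr: "\<sigma> s = s" "\<sigma> r = r" "s \<noteq> 0" "m \<noteq> 0"
      using a e h(5)[of x x] by (simp_all add: s_def r_def m_def add inv add.commute)
    define t where "t = inverse s"
    have "\<sigma> t * s = 1" using mult[of t s] sr \<open>\<sigma> 1 = 1\<close> by (simp add: t_def)
    then have t: "\<sigma> t = t" using sr by (simp add: t_def field_simps)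
    \<comment> \<open>Adding c e changes h x x by the trace of c m, which has to be -r. The
      \<sigma>-invariant factor \<open>t\<close> normalizes the trace of \<open>a\<close> to
      1.\<close>
    define c where "c = - (r * a * t) * inverse m"
    have neg: "\<sigma> (- u) = - \<sigma> u" for u using add[of u "- u"] s0 by (simp add: eq_neg_iff_add_eq_0 add.commute)
    have cm: "c * m = - (r * a * t)" using sr by (simp add: c_def)
    have "h (x + scale c e) (x + scale c e) = r + (c * m + \<sigma> (c * m))"
      using e(1) h(5)[of x e] by (simp add: h(1-4) r_def m_def mult algebra_simps)
    also have "\<dots> = r - r * t * s" unfolding cm by (simp add: neg mult sr t s_def algebra_simps)
    also have "\<dots> = 0" using sr by (simp add: t_def)
    finally show "\<exists>c. h (x + scale c e) (x + scale c e) = 0" by blast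
  next
    fix x y assume "h x x = 0" "h y y = 0" "h x y = 0"
    then show "h (x + y) (x + y) = 0" using h(5)[of y x] s0 by (simp add: h(1,3))
  next
    show "h 0 0 = 0" using h(2)[of 0 0 0] by simp
  qed (simp_all add: add mult inv h(1-4) h(5)[symmetric])
qed

lemma alternating_polar_formI:
  assumes "finite_dimensional_vector_space scale Basis" "alternating_form scale s"
  shows "alternating_polar_form scale Basis id (- 1) s (\<lambda>_. True)"
proof -
  interpret finite_dimensional_vector_space scale Basis by fact
  have s: "s (x + y) z = s x z + s y z" "s (scale c x) z = c * s x z" "s z (x + y) = s z x + s z y"
    "s x x = 0" for x y z c
  proof -
    have lin: "Vector_Spaces.linear scale (*) (\<lambda>x. s x z)" "Vector_Spaces.linear scale (*) (s z)"
      using assms(2) unfolding alternating_form_def bilinear_form_def by blast+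
    show "s (x + y) z = s x z + s y z" "s (scale c x) z = c * s x z" "s z (x + y) = s z x + s z y"
      using lin by (simp_all only: Vector_Spaces.linear_iff)
    show "s x x = 0" using assms(2) unfolding alternating_form_def by blast
  qed
  have anti: "s y x = - s x y" for x y
  proof -
    have "s x y + s y x = 0" using s(4)[of "x + y"] unfolding s(1) s(3) unfolding s(4)
      by (simp add: add.commute)
    then show ?thesis by (metis add.commute eq_neg_iff_add_eq_0)
  qed
  show ?thesis
    by unfold_locales (simp_all add: s(1,2,4), rule anti)
qed

lemma quadratic_polar_form:
  assumes "finite_dimensional_vector_space scale Basis" "quadratic_form scale q"
  shows "polar_form scale Basis id 1 (bilinearization q) (\<lambda>x. q x = 0)"
    and "bilinearization q x x = 2 * q x"
proof -
  interpret finite_dimensional_vector_space scale Basis by fact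
  have q: "q (scale c x) = c\<^sup>2 * q x" for c x
    using assms(2) by (auto simp: quadratic_form_def)
  have b: "bilinearization q (x + y) z = bilinearization q x z + bilinearization q y z"
    "bilinearization q (scale c x) z = c * bilinearization q x z"
    "bilinearization q z (scale c x) = c * bilinearization q z x" for x y z c
  proof -
    have lin: "Vector_Spaces.linear scale (*) (\<lambda>x. bilinearization q x z)"
        "Vector_Spaces.linear scale (*) (bilinearization q z)"
      using assms(2) unfolding quadratic_form_def bilinear_form_def by blast+
    show "bilinearization q (x + y) z = bilinearization q x z + bilinearization q y z"
      "bilinearization q (scale c x) z = c * bilinearization q x z"
      "bilinearization q z (scale c x) = c * bilinearization q z x"
      using lin by (simp_all only: Vector_Spaces.linear_iff)
  qed
  have sym: "bilinearization q x y = bilinearization q y x" for x y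
    by (simp add: bilinearization_def add.commute algebra_simps)
  have add: "q (x + y) = q x + q y + bilinearization q x y" for x y
    by (simp add: bilinearization_def)
  have self: "bilinearization q x x = 2 * q x" for x
  proof -
    have "x + x = scale 2 x" using scale_left_distrib[of 1 1 x] by simp
    then show ?thesis by (simp add: bilinearization_def q)
  qed
  show "polar_form scale Basis id 1 (bilinearization q) (\<lambda>x. q x = 0)"
  proof
    show "q 0 = 0" using q[of 0 0] by simp
    fix e x assume e: "q e = 0" "bilinearization q e x \<noteq> 0"
    have "q (x + scale c e) = q x + c * bilinearization q e x" for c
      using e(1) by (simp add: add q b sym[of x e])
    then have "q (x + scale (- q x / bilinearization q e x) e) = 0" using e(2) by (simp only:) simp
    then show "\<exists>c. q (x + scale c e) = 0" by blast
  qed (simp_all add: b add q self, rule sym)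
  show "bilinearization q x x = 2 * q x" by (rule self)
qed

lemma two_eq_0_iff_CHAR: "(2::'f::field) = 0 \<longleftrightarrow> CHAR('f) = 2"
proof
  assume "(2::'f) = 0"
  then have "of_nat 2 = (0::'f)" by simp
  then have "CHAR('f) dvd 2" by (simp only: of_nat_eq_0_iff_char_dvd)
  moreover from this have "CHAR('f) \<le> 2" by (rule dvd_imp_le) simp
  moreover have "CHAR('f) \<noteq> 0" using \<open>CHAR('f) dvd 2\<close> by (metis dvd_0_left zero_neq_numeral)
  moreover have "CHAR('f) \<noteq> Suc 0" by (rule CHAR_not_1)
  ultimately show "CHAR('f) = 2" by linarith
next
  assume "CHAR('f) = 2"
  then show "(2::'f) = 0" using of_nat_CHAR[where 'a = 'f] by simp
qed

lemma int_binomial_diff: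
  assumes "m + (if 2 \<le> k then N choose (k - 2) else 0) = N choose k"
  shows "int m = int_binomial N (int k) - int_binomial N (int k - 2)"
  using arg_cong[OF assms, of int] by (auto simp: int_binomial_def nat_diff_distrib)

theorem theorem1:
  fixes scale :: "'f::field \<Rightarrow> 'v::ab_group_add \<Rightarrow> 'v"
    and \<eta> :: "('f, 'v) form"
    and N n d\<^sub>0 d k :: nat
  assumes "vector_space scale"
    and "\<exists>B. finite B \<and> module.span scale B = UNIV"
    and "vector_space.dim scale UNIV = N" and "N > 1"
    and "n > 1" and "2 * n + d\<^sub>0 + d = N"
    and "is_form scale \<eta>"
    and "reduced_witt_index scale \<eta> = n"
    and "anisotropic_defect scale \<eta> = d\<^sub>0"
    and "singular_defect scale \<eta> = d"
    and "1 \<le> k" and "k \<le> n"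
  shows
    "(\<forall>\<sigma> h. \<eta> = Hermitian \<sigma> h \<longrightarrow>
        grassmann_dim scale \<eta> k = N choose k \<and>
        grassmann_span scale \<eta> k = ext_power scale k) \<and>
     (\<forall>s. \<eta> = Alternating s \<longrightarrow>
        int (grassmann_dim scale \<eta> k) = int_binomial N (int k) - int_binomial N (int k - 2)) \<and>
     (\<forall>q. \<eta> = Quadratic q \<longrightarrow>
        (CHAR('f) \<noteq> 2 \<longrightarrow> grassmann_dim scale \<eta> k = N choose k) \<and>
        (CHAR('f) = 2 \<longrightarrow>
           int (grassmann_dim scale \<eta> k) = int_binomial N (int k) - int_binomial N (int k - 2)) \<and>
        (CHAR('f) \<noteq> 2 \<or> k = 1 \<longrightarrow>
           grassmann_span scale \<eta> k = ext_power scale k) \<and>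
        (\<not> (CHAR('f) \<noteq> 2 \<or> k = 1) \<longrightarrow>
           grassmann_span scale \<eta> k =
           grassmann_span scale (Alternating (bilinearization q)) k))"
proof -
  interpret vector_space scale by fact
  obtain S where S: "finite S" "span S = UNIV" using assms(2) by blast
  obtain Basis where "Basis \<subseteq> S" "independent Basis" "S \<subseteq> span Basis"
    by (rule maximal_independent_subset[of S])
  then have fd: "finite_dimensional_vector_space scale Basis"
    using S by unfold_locales (auto intro: finite_subset span_minimal simp: set_eq_iff, metis span_mono span_span subsetD UNIV_I)
  \<comment> \<open>Used for Hermitian forms and for quadratic forms in characteristic other than 2;
    \<open>symp\<close> below serves alternating forms and quadratic forms in characteristic
    2.\<close>
  have full: "grassmann_dim scale \<eta> k = N choose k \<and> grassmann_span scale \<eta> k = ext_power scale k"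
    if pf: "polar_form scale Basis \<sigma> \<epsilon> B sing"
      and ts: "\<And>X. subspace X \<Longrightarrow> totally_singular \<eta> X \<longleftrightarrow> (\<forall>x \<in> X. sing x \<and> (\<forall>y \<in> X. B x y = 0))"
      and rad: "radical \<eta> = {v. (\<forall>x. B v x = 0) \<and> sing v}"
      and nsymp: "\<sigma> \<noteq> id \<or> \<epsilon> \<noteq> - 1" and iso: "\<And>x. B x x = 0 \<Longrightarrow> sing x" for \<sigma> \<epsilon> B sing
  proof -
    interpret polar_form scale Basis \<sigma> \<epsilon> B sing by fact
    obtain ss ns rs where *: "length ss = n" "hyperbolic_system (ss @ ns) rs" "span (set (flat (ss @ ns) @ rs)) = UNIV"
        "distinct rs" "independent (set rs)"
      using exists_singular_hyperbolic_system_of_witt[OF ts rad assms(8)] by blast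
    have L: "distinct (flat (ss @ ns) @ rs)" "independent (set (flat (ss @ ns) @ rs))"
      using hyperbolic_system_independent[OF *(2,4,5)] by auto
    have "singular_span k = ext_power scale k"
      using *(1) assms(12) by (intro singular_span_eq_ext_power[OF nsymp iso *(2) L(1) *(3)]) auto
    moreover have "ext.dim (ext_power scale k) = N choose k"
      using dim_ext_power[OF L *(3)] dim_span_eq_card_independent[OF L(2)] distinct_card[OF L(1)] assms(3)
      unfolding *(3) by simp
    ultimately show ?thesis
      using grassmann_span_eq[OF ts] by (simp add: grassmann_dim_def)
  qed
  have symp: "int (grassmann_dim scale \<eta> k) = int_binomial N (int k) - int_binomial N (int k - 2) \<and>
      grassmann_span scale \<eta> k = isotropic_span scale B k"
    if apf: "alternating_polar_form scale Basis \<sigma> \<epsilon> B sing"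
      and ts: "\<And>X. subspace X \<Longrightarrow> totally_singular \<eta> X \<longleftrightarrow> (\<forall>x \<in> X. sing x \<and> (\<forall>y \<in> X. B x y = 0))"
      and rad: "radical \<eta> = {v. (\<forall>x. B v x = 0) \<and> sing v}" for \<sigma> \<epsilon> B sing
  proof -
    interpret alternating_polar_form scale Basis \<sigma> \<epsilon> B sing by fact
    obtain ss ns rs where *: "length ss = n" "\<forall>p \<in> set ss. sing (fst p) \<and> sing (snd p)" "hyperbolic_system (ss @ ns) rs"
        "span (set (flat (ss @ ns) @ rs)) = UNIV" "distinct rs" "independent (set rs)"
      using exists_singular_hyperbolic_system_of_witt[OF ts rad assms(8)] by blast
    have k: "k \<le> length ss" using *(1) assms(12) by simp
    have m1: "singular_span k = isotropic_span scale B k"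
      and m2: "ext.dim (singular_span k) + (if 2 \<le> k then dim UNIV choose (k - 2) else 0) = dim UNIV choose k"
      by (rule singular_span_symplectic[OF *(3,5,6,4) _ k]; use *(2) in blast)+
    have "grassmann_span scale \<eta> k = singular_span k" by (rule grassmann_span_eq) (rule ts)
    then show ?thesis
      using int_binomial_diff[OF m2] m1 unfolding grassmann_dim_def assms(3) by simp
  qed
  show ?thesis
  proof (intro conjI allI impI)
    fix \<sigma> h assume \<eta>: "\<eta> = Hermitian \<sigma> h"
    then have h: "hermitian_form scale \<sigma> h" using assms(7) by simp
    have "grassmann_dim scale \<eta> k = N choose k \<and> grassmann_span scale \<eta> k = ext_power scale k"
    proof (rule full[OF hermitian_polar_form[OF fd h]])
      show "\<sigma> \<noteq> id \<or> (1::'f) \<noteq> - 1"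
        using h unfolding hermitian_form_def order_2_automorphism_def by blast
    qed (auto simp: \<eta> radical_def perp_def)
    then show "grassmann_dim scale \<eta> k = N choose k" "grassmann_span scale \<eta> k = ext_power scale k"
      by blast+
  next
    fix s assume \<eta>: "\<eta> = Alternating s"
    then have s: "alternating_form scale s" using assms(7) by simp
    have "int (grassmann_dim scale \<eta> k) = int_binomial N (int k) - int_binomial N (int k - 2) \<and>
        grassmann_span scale \<eta> k = isotropic_span scale s k"
      by (rule symp[OF alternating_polar_formI[OF fd s]])
        (use s in \<open>simp_all add: \<eta> radical_def perp_def alternating_form_def\<close>)
    then show "int (grassmann_dim scale \<eta> k) = int_binomial N (int k) - int_binomial N (int k - 2)" by blast
  next
    fix q assume \<eta>: "\<eta> = Quadratic q"
    let ?b = "bilinearization q"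
    have q: "quadratic_form scale q" using assms(7) \<eta> by simp
    note pf = quadratic_polar_form[OF fd q]
    have ts: "totally_singular \<eta> X \<longleftrightarrow> (\<forall>x \<in> X. q x = 0 \<and> (\<forall>y \<in> X. ?b x y = 0))" if "subspace X" for X
      using that subspace_add[OF that] by (auto simp: \<eta> bilinearization_def)
    have rad: "radical \<eta> = {v. (\<forall>x. ?b v x = 0) \<and> q v = 0}"
      by (auto simp: \<eta> radical_def perp_def)
    have odd: "grassmann_dim scale \<eta> k = N choose k \<and> grassmann_span scale \<eta> k = ext_power scale k"
      if "CHAR('f) \<noteq> 2"
    proof (rule full[OF pf(1) ts rad])
      have two: "(2::'f) \<noteq> 0" using that two_eq_0_iff_CHAR by blast
      then have "(1::'f) \<noteq> - 1" by (metis eq_neg_iff_add_eq_0 one_add_one)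
      then show "(id :: 'f \<Rightarrow> 'f) \<noteq> id \<or> (1::'f) \<noteq> - 1" by blast
      show "q x = 0" if "?b x x = 0" for x using that two by (simp add: pf(2))
    qed
    have even: "int (grassmann_dim scale \<eta> k) = int_binomial N (int k) - int_binomial N (int k - 2) \<and>
        grassmann_span scale \<eta> k = isotropic_span scale ?b k" if "CHAR('f) = 2"
    proof (rule symp[OF _ ts rad])
      have "(2::'f) = 0" using that two_eq_0_iff_CHAR by blast
      \<comment> \<open>The bilinearization is alternating because its value at (x, x) is 2 q(x) =
        0.\<close>
      then show "alternating_polar_form scale Basis id 1 ?b (\<lambda>x. q x = 0)"
        using pf by (intro alternating_polar_form.intro) (auto simp: alternating_polar_form_axioms_def)
    qed
    have alt: "alternating_form scale ?b" if "CHAR('f) = 2"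
      using that two_eq_0_iff_CHAR[where 'f = 'f] q pf(2) by (simp add: alternating_form_def quadratic_form_def)
    show "grassmann_dim scale \<eta> k = N choose k" if "CHAR('f) \<noteq> 2" using odd[OF that] by blast
    show "int (grassmann_dim scale \<eta> k) = int_binomial N (int k) - int_binomial N (int k - 2)"
      if "CHAR('f) = 2" using even[OF that] by blast
    show "grassmann_span scale \<eta> k = ext_power scale k" if "CHAR('f) \<noteq> 2 \<or> k = 1"
    proof (cases "CHAR('f) = 2")
      case True
      \<comment> \<open>For k = 1 the isotropy condition only says that the alternating form
        vanishes on the diagonal.\<close>
      have "{wedge scale us | us. length us = 1 \<and> (\<forall>x \<in> set us. \<forall>y \<in> set us. ?b x y = 0)} =
          {wedge scale us | us. length us = 1}"
        using alt[OF True] by (auto simp: alternating_form_def length_Suc_conv)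
      then show ?thesis
        using even[OF True] that True by (simp add: isotropic_span_def ext_power_def)
    qed (use odd in blast)
    show "grassmann_span scale \<eta> k = grassmann_span scale (Alternating ?b) k"
      if "\<not> (CHAR('f) \<noteq> 2 \<or> k = 1)"
    proof -
      have c: "CHAR('f) = 2" using that by blast
      \<comment> \<open>With every vector counted as singular, the singular span of this instance is
        by definition the isotropic span of the bilinearization.\<close>
      interpret A: alternating_polar_form scale Basis id "- 1" ?b "\<lambda>_. True"
        by (rule alternating_polar_formI[OF fd alt[OF c]])
      have "grassmann_span scale (Alternating ?b) k = A.singular_span k"
        by (rule A.grassmann_span_eq) simp
      also have "\<dots> = isotropic_span scale ?b k"
        by (simp add: A.singular_span_def isotropic_span_def)
      finally show ?thesis using even[OF c] by simp
    qed
  qed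
qed

end
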